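(* Let $r\geq 2$ and $n\geq 2r+1$ be integers, set $\alpha:=\left\lfloor \frac{n+1}{r+1}\right\rfloor$, and write $r=2^{\lambda_1}+\dots+2^{\lambda_s}+\varepsilon$ with $\lambda_1>\lambda_2>\dots>\lambda_s\geq 1$ and $\varepsilon\in\{0,1\}$. If either - $h\leq(\alpha-1)(\alpha^{\lambda_1-1}+\dots+\alpha^{\lambda_s-1})+1$, or - $n\geq r^2+3r+1$ and $h\leq\alpha^{\lambda_1}+\dots+\alpha^{\lambda_s}+1$, then the Grassmannian $\mathbb{G}(r,n)$ is not $h$-defective.
   Context: The base field is $\mathbb{C}$. $\mathbb{G}(r,n)$ is the Grassmannian of $r$-dimensional linear subspaces of $\mathbb{P}^n$, embedded in $\mathbb{P}^N$, $N=\binom{n+1}{r+1}-1$, by the Plücker embedding. For a non-degenerate variety $X\subset\mathbb{P}^N$, $\mathbb{S}ec_h(X)$ is the closure of the union of the linear spans of $h$ points of $X$, and $X$ is $h$-defective if $\dim\mathbb{S}ec_h(X)<\min\{h\dim X+h-1,N\}$. *)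

theory Defs
  imports
    "HOL-Analysis.Abstract_Topology"
    "HOL-Library.Extended_Real"
    "HOL-Library.Function_Algebras"
    "HOL-Library.Poly_Mapping"
    "Jordan_Normal_Form.Determinant"
begin

section \<open>Projective spaces over the complex numbers\<close>

text \<open>
  The coordinate space of a finite index set \<open>I\<close> consists of the complex functions that vanish
  off \<open>I\<close>.  Points of a projective space are one-dimensional linear subspaces.
\<close>

definition scale_fun :: "complex \<Rightarrow> ('i \<Rightarrow> complex) \<Rightarrow> 'i \<Rightarrow> complex" where
  "scale_fun c x = (\<lambda>i. c * x i)"

global_interpretation cfun: vector_space "scale_fun :: complex \<Rightarrow> ('i \<Rightarrow> complex) \<Rightarrow> 'i \<Rightarrow> complex"
  by standard (simp_all add: scale_fun_def fun_eq_iff algebra_simps)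

definition coord_space :: "'i set \<Rightarrow> ('i \<Rightarrow> complex) set" where
  "coord_space I = {x. \<forall>i. i \<notin> I \<longrightarrow> x i = 0}"

definition projectivization :: "('i \<Rightarrow> complex) set \<Rightarrow> ('i \<Rightarrow> complex) set set" where
  "projectivization U = {L. cfun.subspace L \<and> cfun.dim L = 1 \<and> L \<subseteq> U}"

definition proj_space :: "'i set \<Rightarrow> ('i \<Rightarrow> complex) set set" where
  "proj_space I = projectivization (coord_space I)"


section \<open>The Zariski topology\<close>

text \<open>
  A polynomial is a finitely supported map from monomials (exponent vectors) to coefficients;
  addition and multiplication on this type are those of the polynomial ring.
\<close>

type_synonym 'i cpoly = "('i \<Rightarrow>\<^sub>0 nat) \<Rightarrow>\<^sub>0 complex"

definition eval_monom :: "('i \<Rightarrow>\<^sub>0 nat) \<Rightarrow> ('i \<Rightarrow> complex) \<Rightarrow> complex" where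
  "eval_monom m x = (\<Prod>i\<in>Poly_Mapping.keys m. x i ^ Poly_Mapping.lookup m i)"

definition eval_poly :: "'i cpoly \<Rightarrow> ('i \<Rightarrow> complex) \<Rightarrow> complex" where
  "eval_poly f x = (\<Sum>m\<in>Poly_Mapping.keys f. Poly_Mapping.lookup f m * eval_monom m x)"

definition monom_degree :: "('i \<Rightarrow>\<^sub>0 nat) \<Rightarrow> nat" where
  "monom_degree m = (\<Sum>i\<in>Poly_Mapping.keys m. Poly_Mapping.lookup m i)"

definition homogeneous :: "'i set \<Rightarrow> 'i cpoly \<Rightarrow> bool" where
  "homogeneous I f \<longleftrightarrow>
     (\<exists>d. \<forall>m\<in>Poly_Mapping.keys f. Poly_Mapping.keys m \<subseteq> I \<and> monom_degree m = d)"

definition proj_zeros :: "'i set \<Rightarrow> 'i cpoly set \<Rightarrow> ('i \<Rightarrow> complex) set set" where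
  "proj_zeros I F = {L \<in> proj_space I. \<forall>f\<in>F. \<forall>x\<in>L. eval_poly f x = 0}"

definition zariski :: "'i set \<Rightarrow> ('i \<Rightarrow> complex) set topology" where
  "zariski I =
     topology (\<lambda>U. \<exists>F. (\<forall>f\<in>F. homogeneous I f) \<and> U = proj_space I - proj_zeros I F)"


text \<open>The remainder of this section checks that the above family of sets is a topology.\<close>

lemma eval_monom_superset:
  assumes "finite A" "Poly_Mapping.keys m \<subseteq> A"
  shows "eval_monom m x = (\<Prod>i\<in>A. x i ^ Poly_Mapping.lookup m i)"
  unfolding eval_monom_def
  by (rule prod.mono_neutral_left) (use assms in \<open>auto simp: in_keys_iff\<close>)

lemma eval_monom_add: "eval_monom (m + m') x = eval_monom m x * eval_monom m' x"
proof -
  let ?A = "Poly_Mapping.keys m \<union> Poly_Mapping.keys m'"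
  have "Poly_Mapping.keys (m + m') \<subseteq> ?A"
    by (rule Poly_Mapping.keys_add)
  then show ?thesis
    by (simp add: eval_monom_superset[of ?A] lookup_add power_add prod.distrib)
qed

lemma monom_degree_superset:
  assumes "finite A" "Poly_Mapping.keys m \<subseteq> A"
  shows "monom_degree m = (\<Sum>i\<in>A. Poly_Mapping.lookup m i)"
  unfolding monom_degree_def
  by (rule sum.mono_neutral_left) (use assms in \<open>auto simp: in_keys_iff\<close>)

lemma monom_degree_add: "monom_degree (m + m') = monom_degree m + monom_degree m'"
proof -
  let ?A = "Poly_Mapping.keys m \<union> Poly_Mapping.keys m'"
  have "Poly_Mapping.keys (m + m') \<subseteq> ?A"
    by (rule Poly_Mapping.keys_add)
  then show ?thesis
    by (simp add: monom_degree_superset[of ?A] lookup_add sum.distrib)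
qed

lemma eval_poly_superset:
  assumes "finite A" "Poly_Mapping.keys f \<subseteq> A"
  shows "eval_poly f x = (\<Sum>m\<in>A. Poly_Mapping.lookup f m * eval_monom m x)"
  unfolding eval_poly_def
  by (rule sum.mono_neutral_left) (use assms in \<open>auto simp: in_keys_iff\<close>)

lemma eval_poly_zero [simp]: "eval_poly 0 x = 0"
  by (simp add: eval_poly_def)

lemma eval_poly_one [simp]: "eval_poly 1 x = 1"
  by (simp add: eval_poly_def eval_monom_def)

lemma eval_poly_add: "eval_poly (f + g) x = eval_poly f x + eval_poly g x"
proof -
  let ?A = "Poly_Mapping.keys f \<union> Poly_Mapping.keys g"
  have "Poly_Mapping.keys (f + g) \<subseteq> ?A"
    by (rule Poly_Mapping.keys_add)
  then show ?thesis
    by (simp add: eval_poly_superset[of ?A] lookup_add sum.distrib algebra_simps)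
qed

lemma eval_poly_sum: "eval_poly (\<Sum>a\<in>A. f a) x = (\<Sum>a\<in>A. eval_poly (f a) x)"
  by (induction A rule: infinite_finite_induct) (simp_all add: eval_poly_add)

lemma eval_poly_single: "eval_poly (Poly_Mapping.single m c) x = c * eval_monom m x"
  by (cases "c = 0") (simp_all add: eval_poly_def)

lemma cpoly_expand:
  "(f :: 'i cpoly) =
     (\<Sum>m\<in>Poly_Mapping.keys f. Poly_Mapping.single m (Poly_Mapping.lookup f m))"
  by (rule poly_mapping_eqI) (auto simp: lookup_sum lookup_single when_def in_keys_iff)

lemma eval_poly_mult: "eval_poly (f * g) x = eval_poly f x * eval_poly g x"
proof -
  have "f * g = (\<Sum>m\<in>Poly_Mapping.keys f. \<Sum>m'\<in>Poly_Mapping.keys g.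
      Poly_Mapping.single (m + m') (Poly_Mapping.lookup f m * Poly_Mapping.lookup g m'))"
    by (subst (1) cpoly_expand[of f], subst (1) cpoly_expand[of g])
       (simp add: sum_product mult_single)
  then have "eval_poly (f * g) x = (\<Sum>m\<in>Poly_Mapping.keys f. \<Sum>m'\<in>Poly_Mapping.keys g.
      Poly_Mapping.lookup f m * Poly_Mapping.lookup g m' * (eval_monom m x * eval_monom m' x))"
    by (simp only: eval_poly_sum eval_poly_single eval_monom_add)
  also have "\<dots> = eval_poly f x * eval_poly g x"
    unfolding eval_poly_def sum_product by (intro sum.cong refl) (simp add: algebra_simps)
  finally show ?thesis .
qed

lemma homogeneous_mult:
  assumes "homogeneous I f" "homogeneous I g"
  shows "homogeneous I (f * g)"
proof -
  obtain d e where
    d: "\<And>m. m \<in> Poly_Mapping.keys f \<Longrightarrow> Poly_Mapping.keys m \<subseteq> I \<and> monom_degree m = d" and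
    e: "\<And>m. m \<in> Poly_Mapping.keys g \<Longrightarrow> Poly_Mapping.keys m \<subseteq> I \<and> monom_degree m = e"
    using assms unfolding homogeneous_def by blast
  have "Poly_Mapping.keys m \<subseteq> I \<and> monom_degree m = d + e"
    if m: "m \<in> Poly_Mapping.keys (f * g)" for m
  proof -
    obtain a b where "a \<in> Poly_Mapping.keys f" "b \<in> Poly_Mapping.keys g" "m = a + b"
      using m Poly_Mapping.keys_mult[of f g] by blast
    then show ?thesis
      using d[of a] e[of b] Poly_Mapping.keys_add[of a b] by (auto simp: monom_degree_add)
  qed
  then show ?thesis
    unfolding homogeneous_def by blast
qed

lemma homogeneous_eval_scale:
  fixes f :: "'i cpoly"
  assumes "homogeneous I f"
  shows "\<exists>d. \<forall>c x. eval_poly f (scale_fun c x) = c ^ d * eval_poly f x"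
proof -
  obtain d where d: "\<And>m. m \<in> Poly_Mapping.keys f \<Longrightarrow> monom_degree m = d"
    using assms unfolding homogeneous_def by blast
  have "eval_monom m (scale_fun c x) = c ^ monom_degree m * eval_monom m x"
    for m c and x :: "'i \<Rightarrow> complex"
    by (simp add: eval_monom_def monom_degree_def scale_fun_def power_mult_distrib
        prod.distrib power_sum)
  then have "eval_poly f (scale_fun c x) = c ^ d * eval_poly f x" for c x
    unfolding eval_poly_def sum_distrib_left
    by (intro sum.cong refl) (simp add: d algebra_simps)
  then show ?thesis by blast
qed

lemma proj_space_generator:
  assumes "L \<in> proj_space I"
  obtains v where "v \<in> L" "v \<noteq> 0" "L = range (\<lambda>c. scale_fun c v)"
proof -
  have L: "cfun.subspace L" "cfun.dim L = 1"
    using assms by (auto simp: proj_space_def projectivization_def)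
  obtain B where B: "B \<subseteq> L" "cfun.independent B" "L \<subseteq> cfun.span B" "card B = cfun.dim L"
    using cfun.basis_exists[of L] by blast
  then obtain v where v: "B = {v}"
    using L by (auto simp: card_1_singleton_iff)
  have "cfun.span B \<subseteq> L"
    using B L by (simp add: cfun.span_minimal)
  then have "L = range (\<lambda>c. scale_fun c v)"
    using B v by (auto simp: cfun.span_singleton)
  moreover have "v \<noteq> 0"
    using B v cfun.dependent_zero by blast
  ultimately show ?thesis
    using that B v by blast
qed

lemma proj_zeros_product:
  assumes "\<And>f. f \<in> F \<Longrightarrow> homogeneous I f" "\<And>g. g \<in> G \<Longrightarrow> homogeneous I g"
  shows "proj_zeros I F \<union> proj_zeros I G = proj_zeros I {f * g | f g. f \<in> F \<and> g \<in> G}"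
proof (rule Set.set_eqI)
  fix L
  show "L \<in> proj_zeros I F \<union> proj_zeros I G \<longleftrightarrow> L \<in> proj_zeros I {f * g | f g. f \<in> F \<and> g \<in> G}"
  proof (cases "L \<in> proj_space I")
    case True
    then obtain v where v: "v \<in> L" "L = range (\<lambda>c. scale_fun c v)"
      by (rule proj_space_generator)
    have vanish: "(\<forall>x\<in>L. eval_poly f x = 0) \<longleftrightarrow> eval_poly f v = 0" if f: "homogeneous I f" for f
    proof -
      obtain d where "\<And>c x. eval_poly f (scale_fun c x) = c ^ d * eval_poly f x"
        using homogeneous_eval_scale[OF f] by blast
      then have "\<forall>x\<in>L. eval_poly f x = 0" if "eval_poly f v = 0"
        using that unfolding v(2) by auto
      then show ?thesis
        using v(1) by auto
    qed
    have zeros: "L \<in> proj_zeros I H \<longleftrightarrow> (\<forall>f\<in>H. eval_poly f v = 0)"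
      if "\<And>f. f \<in> H \<Longrightarrow> homogeneous I f" for H
      using that True vanish unfolding proj_zeros_def by auto
    have "homogeneous I k" if "k \<in> {f * g | f g. f \<in> F \<and> g \<in> G}" for k
      using that assms homogeneous_mult by blast
    then have "L \<in> proj_zeros I {f * g | f g. f \<in> F \<and> g \<in> G} \<longleftrightarrow>
        (\<forall>f\<in>F. \<forall>g\<in>G. eval_poly f v = 0 \<or> eval_poly g v = 0)"
      by (subst zeros) (force simp: eval_poly_mult[symmetric] mult_eq_0_iff[symmetric]
          simp del: mult_eq_0_iff)+
    moreover have "L \<in> proj_zeros I F \<longleftrightarrow> (\<forall>f\<in>F. eval_poly f v = 0)"
      by (rule zeros) (rule assms(1))
    moreover have "L \<in> proj_zeros I G \<longleftrightarrow> (\<forall>f\<in>G. eval_poly f v = 0)"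
      by (rule zeros) (rule assms(2))
    ultimately show ?thesis
      by blast
  qed (auto simp: proj_zeros_def)
qed

lemma istopology_zariski:
  "istopology (\<lambda>U. \<exists>F. (\<forall>f\<in>F. homogeneous I f) \<and> U = proj_space I - proj_zeros I F)"
  unfolding istopology_def
proof (intro conjI allI impI)
  fix S T
  assume "\<exists>F. (\<forall>f\<in>F. homogeneous I f) \<and> S = proj_space I - proj_zeros I F"
    and "\<exists>F. (\<forall>f\<in>F. homogeneous I f) \<and> T = proj_space I - proj_zeros I F"
  then obtain F G where
    F: "\<And>f. f \<in> F \<Longrightarrow> homogeneous I f" "S = proj_space I - proj_zeros I F" and
    G: "\<And>g. g \<in> G \<Longrightarrow> homogeneous I g" "T = proj_space I - proj_zeros I G"
    by blast
  have "S \<inter> T = proj_space I - proj_zeros I {f * g | f g. f \<in> F \<and> g \<in> G}"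
    using proj_zeros_product[of F I G] F G by blast
  moreover have "\<forall>k\<in>{f * g | f g. f \<in> F \<and> g \<in> G}. homogeneous I k"
    using F(1) G(1) homogeneous_mult by blast
  ultimately show "\<exists>F. (\<forall>f\<in>F. homogeneous I f) \<and> S \<inter> T = proj_space I - proj_zeros I F"
    by blast
next
  fix \<K>
  assume "\<forall>K\<in>\<K>. \<exists>F. (\<forall>f\<in>F. homogeneous I f) \<and> K = proj_space I - proj_zeros I F"
  then obtain F where
    F: "\<And>K. K \<in> \<K> \<Longrightarrow> (\<forall>f\<in>F K. homogeneous I f) \<and> K = proj_space I - proj_zeros I (F K)"
    by metis
  have "\<Union>\<K> = (\<Union>K\<in>\<K>. proj_space I - proj_zeros I (F K))"
    using F by auto
  also have "\<dots> = proj_space I - proj_zeros I (\<Union>K\<in>\<K>. F K)"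
    by (auto simp: proj_zeros_def)
  finally have "\<Union>\<K> = proj_space I - proj_zeros I (\<Union>K\<in>\<K>. F K)" .
  moreover have "\<forall>f\<in>(\<Union>K\<in>\<K>. F K). homogeneous I f"
    using F by blast
  ultimately show "\<exists>F. (\<forall>f\<in>F. homogeneous I f) \<and> \<Union>\<K> = proj_space I - proj_zeros I F"
    by blast
qed

lemma openin_zariski:
  "openin (zariski I) U \<longleftrightarrow>
     (\<exists>F. (\<forall>f\<in>F. homogeneous I f) \<and> U = proj_space I - proj_zeros I F)"
  unfolding zariski_def topology_inverse'[OF istopology_zariski] by simp

lemma topspace_zariski [simp]: "topspace (zariski I) = proj_space I"
proof (rule antisym)
  show "topspace (zariski I) \<subseteq> proj_space I"
    unfolding topspace_def by (auto simp: openin_zariski)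
  have "proj_zeros I {1} = {}"
    by (auto simp: proj_zeros_def elim: proj_space_generator)
  moreover have "homogeneous I 1"
    by (auto simp: homogeneous_def monom_degree_def)
  ultimately have "openin (zariski I) (proj_space I)"
    unfolding openin_zariski by (intro exI[of _ "{1}"]) auto
  then show "proj_space I \<subseteq> topspace (zariski I)"
    by (rule openin_subset)
qed

lemma closedin_zariski:
  "closedin (zariski I) Z \<longleftrightarrow> (\<exists>F. (\<forall>f\<in>F. homogeneous I f) \<and> Z = proj_zeros I F)"
proof -
  have "proj_zeros I F \<subseteq> proj_space I" for F
    by (auto simp: proj_zeros_def)
  then show ?thesis
    unfolding closedin_def openin_zariski topspace_zariski
    by (metis Diff_Diff_Int Diff_subset double_diff inf.absorb_iff2)
qed


section \<open>Dimension\<close>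

definition irreducible_closedin :: "'a topology \<Rightarrow> 'a set \<Rightarrow> bool" where
  "irreducible_closedin T Z \<longleftrightarrow>
     closedin T Z \<and> Z \<noteq> {} \<and>
     (\<forall>A B. closedin T A \<and> closedin T B \<and> Z = A \<union> B \<longrightarrow> Z = A \<or> Z = B)"

text \<open>
  A chain of \<open>k\<close> irreducible closed sets has length \<open>k - 1\<close>.  Because of the empty chain, the
  dimension of the empty space is \<open>-1\<close>.
\<close>

definition krull_dim :: "'a topology \<Rightarrow> ereal" where
  "krull_dim T =
     (SUP C \<in> {C. finite C \<and> (\<forall>Z\<in>C. irreducible_closedin T Z) \<and> chain\<^sub>\<subseteq> C}.
        ereal (real (card C) - 1))"

definition proj_dim :: "'i set \<Rightarrow> ('i \<Rightarrow> complex) set set \<Rightarrow> ereal" where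
  "proj_dim I X = krull_dim (subtopology (zariski I) X)"


section \<open>Secant varieties\<close>

definition secant_variety ::
    "'i set \<Rightarrow> nat \<Rightarrow> ('i \<Rightarrow> complex) set set \<Rightarrow> ('i \<Rightarrow> complex) set set" where
  "secant_variety I h X =
     zariski I closure_of
       (\<Union>A \<in> {A. A \<subseteq> X \<and> finite A \<and> card A = h}. projectivization (cfun.span (\<Union>A)))"

text \<open>The ambient projective space of \<open>I\<close> has dimension \<open>card I - 1\<close>.\<close>

definition defective :: "'i set \<Rightarrow> nat \<Rightarrow> ('i \<Rightarrow> complex) set set \<Rightarrow> bool" where
  "defective I h X \<longleftrightarrow>
     proj_dim I (secant_variety I h X) <
       min (ereal (real h) * proj_dim I X + ereal (real h) - 1) (ereal (real (card I) - 1))"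


section \<open>Grassmannians in their Pluecker embedding\<close>

text \<open>
  An \<open>r\<close>-dimensional linear subspace of projective \<open>n\<close>-space is the projectivization of a unique
  linear subspace of dimension \<open>r + 1\<close> of the coordinate space of \<open>{..n}\<close>.
\<close>

definition linear_subspaces :: "nat \<Rightarrow> nat \<Rightarrow> (nat \<Rightarrow> complex) set set" where
  "linear_subspaces r n = {W. cfun.subspace W \<and> W \<subseteq> coord_space {..n} \<and> cfun.dim W = r + 1}"

definition plucker_index :: "nat \<Rightarrow> nat \<Rightarrow> nat set set" where
  "plucker_index r n = {S. S \<subseteq> {..n} \<and> card S = r + 1}"

lemma card_plucker_index: "card (plucker_index r n) = (n + 1) choose (r + 1)"
  using n_subsets[of "{..n}" "r + 1"] by (simp add: plucker_index_def)

text \<open>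
  The coordinates of \<open>w 0 \<and> \<dots> \<and> w r\<close> are the maximal minors of the matrix with rows
  \<open>w 0, \<dots>, w r\<close>.
\<close>

definition wedge :: "nat \<Rightarrow> nat \<Rightarrow> (nat \<Rightarrow> nat \<Rightarrow> complex) \<Rightarrow> nat set \<Rightarrow> complex" where
  "wedge r n w = (\<lambda>S.
     if S \<in> plucker_index r n
     then det (mat (r + 1) (r + 1) (\<lambda>(i, j). w i (sorted_list_of_set S ! j)))
     else 0)"

text \<open>The image of \<open>W\<close> is its top exterior power, which is a line when \<open>W\<close> has dimension \<open>r + 1\<close>.\<close>

definition plucker :: "nat \<Rightarrow> nat \<Rightarrow> (nat \<Rightarrow> complex) set \<Rightarrow> (nat set \<Rightarrow> complex) set" where
  "plucker r n W = cfun.span {wedge r n w | w. \<forall>i\<le>r. w i \<in> W}"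

definition grassmannian :: "nat \<Rightarrow> nat \<Rightarrow> (nat set \<Rightarrow> complex) set set" where
  "grassmannian r n = plucker r n ` linear_subspaces r n"

end

theory Submission
  imports Defs
begin

text \<open>
  Write \<open>d = (r + 1) * (n - r)\<close>.  It suffices to show that the Grassmannian has dimension at most
  \<open>d\<close> and that its \<open>h\<close>-secant variety has dimension at least \<open>h * (d + 1) - 1\<close>.  Since the
  dimension is defined by chains of irreducible closed sets, both bounds are obtained by counting
  forms.

  \<^emph>\<open>Upper bound.\<close>  If \<open>Z\<^sub>0 \<subset> \<dots> \<subset> Z\<^sub>k\<close> are irreducible, choose for each step a form that vanishes on
  \<open>Z\<^sub>i\<close> but not on \<open>Z\<^sub>i\<^sub>+\<^sub>1\<close>.  As homogeneous ideals of irreducible sets are prime, products of powers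
  of these forms are linearly independent on \<open>Z\<^sub>k\<close>, so at least \<open>(T + 1) ^ k\<close> forms of degree
  \<open>O(T)\<close> are independent (\<open>independent_forms_on_chain\<close>).  On the other hand, pulled back to the
  affine chart \<open>[1 | y]\<close>, forms of degree \<open>O(T)\<close> become polynomials of degree \<open>O(T)\<close> in \<open>d\<close>
  variables.  Hence \<open>k \<le> d\<close> (\<open>proj_dim_grassmannian_le\<close>).

  \<^emph>\<open>Lower bound.\<close>  Let \<open>G\<close> be a polynomial map into the cone over a variety, such that \<open>G(0)\<close> and the
  \<open>D\<close> partial derivatives at \<open>0\<close> are linearly independent.  The closures of the images of the
  coordinate subspaces of dimensions \<open>0, \<dots>, D\<close> are irreducible, and they increase strictly: the
  forms of a given degree in the coordinates dual to \<open>G(0)\<close> and the first \<open>k\<close> derivatives are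
  independent on the \<open>k\<close>-dimensional image, since the lowest-degree terms of a relation would
  themselves be a relation, but on the image of smaller dimension there are too many of them
  (\<open>proj_dim_closure_ge\<close>).  Applied to sums of \<open>h\<close> decomposable vectors this is Terracini's lemma in
  the form needed here: if the tangent spaces at \<open>h\<close> points are independent, the secant variety
  has the expected dimension (\<open>not_defective_if_independent_tangents\<close>).

  \<^emph>\<open>Choice of the points.\<close>  At the coordinate point of an \<open>(r + 1)\<close>-set \<open>S\<close>, the tangent space is
  spanned by the unit vectors of the sets that differ from \<open>S\<close> in at most one element.  So \<open>h\<close> sets
  any two of which differ in at least three elements give independent tangent spaces
  (\<open>not_defective_if_code\<close>).  Such sets come from codes of length \<open>r + 1\<close> and distance 3 over \<open>\<alpha>\<close>
  letters: repeating \<open>r div 2\<close> free letters and appending their sum modulo \<open>\<alpha>\<close> gives \<open>\<alpha> ^ (r div 2)\<close>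
  codewords.  The first bound of the theorem is at most \<open>\<alpha> ^ \<lambda>\<^sub>1\<close> and the second one at most
  \<open>\<alpha> ^ (\<lambda>\<^sub>1 + 1)\<close>; comparing exponents settles the first case, and the second one for \<open>r \<ge> 6\<close>.
  For \<open>r \<le> 5\<close> the second bound is \<open>\<alpha> ^ (r div 2) + 1\<close>, and one point is lacking.  If \<open>r \<ge> 3\<close>, a
  further word can be added to the code.  If \<open>r = 2\<close> and \<open>n + 1 = 3 * \<alpha>\<close>, there are no \<open>\<alpha> + 1\<close>
  disjoint triples; instead a plane in general position is added to \<open>\<alpha>\<close> coordinate planes
  (\<open>not_defective_planes\<close>).
\<close>

section \<open>Polynomial functions of bounded degree\<close>

definition monom_fun :: "'j set \<Rightarrow> ('j \<Rightarrow> nat) \<Rightarrow> ('j \<Rightarrow> complex) \<Rightarrow> complex" where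
  "monom_fun J b = (\<lambda>x. \<Prod>j\<in>J. x j ^ b j)"

text \<open>
  The exponent of each variable is bounded separately: this makes the number of monomials the
  power \<open>(e + 1) ^ card J\<close>, and only its order of growth in \<open>e\<close> matters.
\<close>

definition polyfun :: "'j set \<Rightarrow> nat \<Rightarrow> (('j \<Rightarrow> complex) \<Rightarrow> complex) set" where
  "polyfun J e = cfun.span {monom_fun J b | b. \<forall>j\<in>J. b j \<le> e}"

lemma monom_fun_in_polyfun: "(\<And>j. j \<in> J \<Longrightarrow> b j \<le> e) \<Longrightarrow> monom_fun J b \<in> polyfun J e"
  unfolding polyfun_def by (rule cfun.span_base) blast

lemma polyfun_mono: "e \<le> e' \<Longrightarrow> polyfun J e \<subseteq> polyfun J e'"
  unfolding polyfun_def by (rule cfun.span_mono) (auto intro: order_trans)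

lemma polyfun_const: "(\<lambda>x. c) \<in> polyfun J e"
proof -
  have "(\<lambda>x. c) = scale_fun c (monom_fun J (\<lambda>_. 0))"
    by (simp add: scale_fun_def monom_fun_def)
  then show ?thesis
    using monom_fun_in_polyfun[of J "\<lambda>_. 0" e] cfun.span_scale unfolding polyfun_def by auto
qed

lemma polyfun_var:
  assumes "finite J" "j \<in> J"
  shows "(\<lambda>x. x j) \<in> polyfun J 1"
proof -
  have "(\<Prod>i\<in>J. x i ^ (if i = j then 1 else 0)) = x j" for x :: "'a \<Rightarrow> complex"
    using assms by (simp add: if_distrib prod.delta' cong: if_cong)
  then have "(\<lambda>x. x j) = monom_fun J (\<lambda>i. if i = j then 1 else 0)"
    by (simp add: monom_fun_def)
  then show ?thesis
    using monom_fun_in_polyfun[of J "\<lambda>i. if i = j then 1 else 0" 1] by auto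
qed

lemma polyfun_add: "f \<in> polyfun J e \<Longrightarrow> g \<in> polyfun J e \<Longrightarrow> (\<lambda>x. f x + g x) \<in> polyfun J e"
  unfolding polyfun_def using cfun.span_add[of f _ g] by (simp add: plus_fun_def)

lemma polyfun_sum:
  "(\<And>a. a \<in> A \<Longrightarrow> f a \<in> polyfun J e) \<Longrightarrow> (\<lambda>x. \<Sum>a\<in>A. f a x) \<in> polyfun J e"
  by (induction A rule: infinite_finite_induct) (simp_all add: polyfun_const polyfun_add)

lemma polyfun_mult:
  assumes f: "f \<in> polyfun J d" and g: "g \<in> polyfun J e"
  shows "(\<lambda>x. f x * g x) \<in> polyfun J (d + e)"
proof -
  have monoms: "(\<lambda>x. monom_fun J a x * monom_fun J b x) \<in> polyfun J (d + e)"
    if "\<forall>j\<in>J. a j \<le> d" "\<forall>j\<in>J. b j \<le> e" for a b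
  proof -
    have "(\<lambda>x. monom_fun J a x * monom_fun J b x) = monom_fun J (\<lambda>j. a j + b j)"
      by (simp add: monom_fun_def power_add prod.distrib)
    then show ?thesis
      using monom_fun_in_polyfun[of J "\<lambda>j. a j + b j" "d + e"] that by (simp add: add_mono)
  qed
  have left: "(\<lambda>x. f x * monom_fun J b x) \<in> polyfun J (d + e)" if b: "\<forall>j\<in>J. b j \<le> e" for b
    using f[unfolded polyfun_def]
  proof (induction rule: cfun.span_induct_alt)
    case base
    then show ?case by (simp add: polyfun_const)
  next
    case (step c h k)
    have "(\<lambda>x. h x * monom_fun J b x) \<in> polyfun J (d + e)"
      using step(1) monoms b by auto
    then have "scale_fun c (\<lambda>x. h x * monom_fun J b x) \<in> polyfun J (d + e)"
      unfolding polyfun_def by (rule cfun.span_scale)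
    from polyfun_add[OF this step(2)] show ?case
      by (simp add: scale_fun_def algebra_simps)
  qed
  show ?thesis
    using g[unfolded polyfun_def]
  proof (induction rule: cfun.span_induct_alt)
    case base
    then show ?case by (simp add: polyfun_const)
  next
    case (step c h k)
    have "(\<lambda>x. f x * h x) \<in> polyfun J (d + e)"
      using step(1) left by auto
    then have "scale_fun c (\<lambda>x. f x * h x) \<in> polyfun J (d + e)"
      unfolding polyfun_def by (rule cfun.span_scale)
    from polyfun_add[OF this step(2)] show ?case
      by (simp add: scale_fun_def algebra_simps)
  qed
qed

lemma polyfun_power: "f \<in> polyfun J e \<Longrightarrow> (\<lambda>x. f x ^ n) \<in> polyfun J (e * n)"
proof (induction n)
  case 0
  then show ?case by (simp add: polyfun_const)
next
  case (Suc n)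
  then show ?case using polyfun_mult[of f J e "\<lambda>x. f x ^ n" "e * n"] by (simp add: algebra_simps)
qed

lemma polyfun_prod:
  "(\<And>a. a \<in> A \<Longrightarrow> f a \<in> polyfun J (e a)) \<Longrightarrow> (\<lambda>x. \<Prod>a\<in>A. f a x) \<in> polyfun J (\<Sum>a\<in>A. e a)"
  by (induction A rule: infinite_finite_induct) (simp_all add: polyfun_const polyfun_mult)

lemma polyfun_eval_poly:
  assumes G: "\<And>i. i \<in> I \<Longrightarrow> (\<lambda>x. G x i) \<in> polyfun J e"
    and f: "\<And>m. m \<in> Poly_Mapping.keys f \<Longrightarrow> Poly_Mapping.keys m \<subseteq> I \<and> monom_degree m = t"
  shows "(\<lambda>x. eval_poly f (G x)) \<in> polyfun J (e * t)"
  unfolding eval_poly_def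
proof (rule polyfun_sum)
  fix m assume m: "m \<in> Poly_Mapping.keys f"
  have "(\<lambda>x. eval_monom m (G x)) \<in> polyfun J (\<Sum>i\<in>Poly_Mapping.keys m. e * Poly_Mapping.lookup m i)"
    unfolding eval_monom_def using G f[OF m] by (intro polyfun_prod polyfun_power) auto
  then have "(\<lambda>x. eval_monom m (G x)) \<in> polyfun J (e * t)"
    using f[OF m] by (simp add: monom_degree_def sum_distrib_left[symmetric])
  then show "(\<lambda>x. Poly_Mapping.lookup f m * eval_monom m (G x)) \<in> polyfun J (e * t)"
    using polyfun_mult[OF polyfun_const[of _ J 0]] by fastforce
qed

lemma polyfun_on_line:
  assumes "f \<in> polyfun J e"
  shows "\<exists>p. \<forall>t. f (\<lambda>j. x j + t * y j) = poly p t"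
  using assms[unfolded polyfun_def]
proof (induction rule: cfun.span_induct_alt)
  case base
  show ?case by (rule exI[of _ 0]) simp
next
  case (step c h k)
  obtain b where h: "h = monom_fun J b" using step(1) by blast
  obtain p where p: "\<And>t. k (\<lambda>j. x j + t * y j) = poly p t" using step(2) by blast
  show ?case
    by (rule exI[of _ "Polynomial.smult c (\<Prod>j\<in>J. [:x j, y j:] ^ b j) + p"])
       (simp add: h p scale_fun_def monom_fun_def poly_prod)
qed

text \<open>
  Two points at which two polynomial functions are respectively nonzero are joined by a line, on
  which each function has finitely many zeros: this is why parameter spaces are irreducible.
\<close>

lemma polyfun_common_nonzero:
  assumes "\<And>f. f \<in> S \<Longrightarrow> f \<in> polyfun J e \<and> (f x \<noteq> 0 \<or> f y \<noteq> 0)" "finite S"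
  shows "\<exists>t. \<forall>f\<in>S. f (\<lambda>j. x j + t * (y j - x j)) \<noteq> 0"
proof -
  have "finite {t. f (\<lambda>j. x j + t * (y j - x j)) = 0}" if fS: "f \<in> S" for f
  proof -
    obtain p where p: "\<And>t. f (\<lambda>j. x j + t * (y j - x j)) = poly p t"
      using polyfun_on_line[of f J e x "\<lambda>j. y j - x j"] assms(1)[OF fS] by blast
    have "poly p 0 = f x" "poly p 1 = f y"
      unfolding p[symmetric] by simp_all
    then have "p \<noteq> 0"
      using assms(1)[OF fS] by auto
    then show ?thesis
      by (simp add: p poly_roots_finite)
  qed
  then have "finite (\<Union>f\<in>S. {t. f (\<lambda>j. x j + t * (y j - x j)) = 0})"
    using assms(2) by blast
  then obtain t where "t \<notin> (\<Union>f\<in>S. {t. f (\<lambda>j. x j + t * (y j - x j)) = 0})"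
    using ex_new_if_finite[OF infinite_UNIV_char_0] by blast
  then show ?thesis by blast
qed

text \<open>The nonvanishing set of a nonzero polynomial function \<open>g\<close> is dense for such functions.\<close>

lemma polyfun_zero_density:
  assumes f: "f \<in> polyfun J d" and g: "g \<in> polyfun J e" and "g y \<noteq> 0"
    and van: "\<And>x. g x \<noteq> 0 \<Longrightarrow> f x = 0"
  shows "f x = 0"
proof (rule ccontr)
  assume "f x \<noteq> 0"
  have "f \<in> polyfun J (max d e)" "g \<in> polyfun J (max d e)"
    using f g polyfun_mono[of d "max d e" J] polyfun_mono[of e "max d e" J] by auto
  then have "\<exists>t. \<forall>h\<in>{f, g}. h (\<lambda>j. x j + t * (y j - x j)) \<noteq> 0"
    using assms(3) \<open>f x \<noteq> 0\<close> by (intro polyfun_common_nonzero[where e = "max d e"]) auto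
  then show False using van by auto
qed

lemma sum_apply: "(\<Sum>a\<in>A. f a) x = (\<Sum>a\<in>A. f a x :: complex)"
  by (induction A rule: infinite_finite_induct) simp_all

lemma linear_dependence_bound:
  fixes \<phi> :: "'k \<Rightarrow> 'i \<Rightarrow> complex"
  assumes "finite K" "\<And>k. k \<in> K \<Longrightarrow> \<phi> k \<in> cfun.span B" "finite B" "card B < card K"
  shows "\<exists>c. (\<exists>k\<in>K. c k \<noteq> 0) \<and> (\<forall>x. (\<Sum>k\<in>K. c k * \<phi> k x) = 0)"
proof (cases "inj_on \<phi> K")
  case True
  have "\<not> cfun.independent (\<phi> ` K)"
  proof
    assume "cfun.independent (\<phi> ` K)"
    then have "card (\<phi> ` K) \<le> card B"
      using cfun.independent_span_bound[of B "\<phi> ` K"] assms by auto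
    then show False
      using assms(4) True by (simp add: card_image)
  qed
  then obtain u where u: "\<exists>v\<in>\<phi> ` K. u v \<noteq> 0" "(\<Sum>v\<in>\<phi> ` K. scale_fun (u v) v) = 0"
    using cfun.dependent_finite[of "\<phi> ` K"] assms(1) by auto
  have "(\<Sum>k\<in>K. u (\<phi> k) * \<phi> k x) = 0" for x
  proof -
    have "(\<Sum>v\<in>\<phi> ` K. scale_fun (u v) v) x = (\<Sum>k\<in>K. u (\<phi> k) * \<phi> k x)"
      by (simp add: sum.reindex[OF True] sum_apply scale_fun_def)
    then show ?thesis using u(2) by simp
  qed
  then show ?thesis using u(1) by (intro exI[of _ "\<lambda>k. u (\<phi> k)"]) auto
next
  case False
  then obtain a b where ab: "a \<in> K" "b \<in> K" "a \<noteq> b" "\<phi> a = \<phi> b"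
    unfolding inj_on_def by blast
  let ?c = "\<lambda>k. if k = a then 1 else if k = b then - 1 else 0 :: complex"
  have "(\<Sum>k\<in>K. ?c k * \<phi> k x) = (\<Sum>k\<in>{a, b}. ?c k * \<phi> k x)" for x
    using ab assms(1) by (intro sum.mono_neutral_right) auto
  then show ?thesis using ab by (intro exI[of _ ?c]) (auto intro!: bexI[of _ a])
qed

lemma polyfun_dependence:
  assumes "finite J" "finite K" "\<And>k. k \<in> K \<Longrightarrow> \<phi> k \<in> polyfun J e" "(e + 1) ^ card J < card K"
  shows "\<exists>c. (\<exists>k\<in>K. c k \<noteq> 0) \<and> (\<forall>x. (\<Sum>k\<in>K. c k * \<phi> k x) = 0)"
proof -
  let ?B = "monom_fun J ` (J \<rightarrow>\<^sub>E {..e})"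
  have "{monom_fun J b | b. \<forall>j\<in>J. b j \<le> e} \<subseteq> ?B"
  proof clarify
    fix b assume "\<forall>j\<in>J. b j \<le> e"
    then have "restrict b J \<in> J \<rightarrow>\<^sub>E {..e}" "monom_fun J b = monom_fun J (restrict b J)"
      by (auto simp: monom_fun_def)
    then show "monom_fun J b \<in> ?B" by blast
  qed
  then have sp: "polyfun J e \<subseteq> cfun.span ?B"
    unfolding polyfun_def by (rule cfun.span_mono)
  have fin: "finite ?B"
    using assms(1) by (simp add: finite_PiE)
  have "card ?B \<le> card (J \<rightarrow>\<^sub>E {..e})"
    using assms(1) by (intro card_image_le finite_PiE) auto
  also have "\<dots> = (e + 1) ^ card J"
    using assms(1) by (simp add: card_PiE)
  finally show ?thesis
    using assms(2,3,4) sp fin by (intro linear_dependence_bound[of K \<phi> ?B]) auto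
qed

text \<open>
  The count behind both dimension bounds: if \<open>d < k\<close>, a family of about \<open>T ^ k\<close> functions does not fit into the polynomial functions of
  degree \<open>O(T)\<close> in \<open>d\<close> variables.
\<close>

lemma power_growth:
  assumes "d < k"
  shows "\<exists>T. (A * T + 1) ^ d < (T + 1 :: nat) ^ k"
proof -
  \<comment> \<open>The factor \<open>(A + 1) ^ d\<close> lost on the left is compensated by one more factor \<open>T + 1\<close>.\<close>
  let ?T = "(A + 1) ^ d"
  have "(A * ?T + 1) ^ d \<le> ((A + 1) * (?T + 1)) ^ d"
    by (intro power_mono) auto
  also have "\<dots> = ?T * (?T + 1) ^ d"
    by (rule power_mult_distrib)
  also have "\<dots> < (?T + 1) * (?T + 1) ^ d"
    by (intro mult_strict_right_mono) auto
  also have "\<dots> = (?T + 1) ^ Suc d"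
    by simp
  also have "\<dots> \<le> (?T + 1) ^ k"
    using assms by (intro power_increasing) auto
  finally show ?thesis by blast
qed

text \<open>
  In a relation between monomials, the coefficient of each power of one variable is a relation
  in the other variables.
\<close>

lemma monom_fun_independent:
  assumes "finite J" "finite K" "K \<subseteq> PiE J (\<lambda>_. UNIV)"
    and "\<And>x. (\<Sum>b\<in>K. c b * monom_fun J b x) = 0" and "b \<in> K"
  shows "c b = 0"
  using assms
proof (induction J arbitrary: K c b rule: finite_induct)
  case empty
  then have "K = {\<lambda>_. undefined}" "b = (\<lambda>_. undefined)" by auto
  then show ?case using empty(3)[of undefined] by (simp add: monom_fun_def)
next
  case (insert j J)
  let ?r = "\<lambda>b. restrict b J"
  define n where "n = b j"
  define K' where "K' = {b \<in> K. b j = n}"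
  have inj: "inj_on ?r K'"
  proof (rule inj_onI)
    fix b b' assume b: "b \<in> K'" "b' \<in> K'" "restrict b J = restrict b' J"
    have ext: "b \<in> insert j J \<rightarrow>\<^sub>E UNIV" "b' \<in> insert j J \<rightarrow>\<^sub>E UNIV"
      using b insert.prems(2) by (auto simp: K'_def)
    show "b = b'"
    proof
      fix i
      consider "i = j" | "i \<in> J" | "i \<notin> insert j J" by blast
      then show "b i = b' i"
      proof cases
        case 1 then show ?thesis using b by (simp add: K'_def)
      next
        case 2 then show ?thesis using fun_cong[OF b(3), of i] by simp
      next
        case 3 then show ?thesis using ext by (metis PiE_arb)
      qed
    qed
  qed
  have zero: "(\<Sum>b\<in>?r ` K'. c (the_inv_into K' ?r b) * monom_fun J b x) = 0" for x
  proof -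
    \<comment> \<open>The relation as a polynomial in the variable \<open>j\<close>, with the others fixed.\<close>
    define p where "p = (\<Sum>b\<in>K. Polynomial.monom (c b * monom_fun J b x) (b j))"
    have "poly p s = 0" for s
    proof -
      have "monom_fun (insert j J) b (x(j := s)) = s ^ b j * monom_fun J b x" for b
      proof -
        have "(\<Prod>i\<in>J. (x(j := s)) i ^ b i) = (\<Prod>i\<in>J. x i ^ b i)"
          using insert.hyps by (intro prod.cong) auto
        then show ?thesis using insert.hyps by (simp add: monom_fun_def)
      qed
      then have "poly p s = (\<Sum>b\<in>K. c b * monom_fun (insert j J) b (x(j := s)))"
        by (simp add: p_def poly_sum poly_monom algebra_simps)
      then show ?thesis using insert.prems(3) by simp
    qed
    then have "p = 0"
      using poly_all_0_iff_0 by blast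
    then have "coeff p n = 0" by simp
    then have "0 = (\<Sum>b\<in>K. if b j = n then c b * monom_fun J b x else 0)"
      by (simp add: p_def coeff_sum)
    also have "\<dots> = (\<Sum>b\<in>K'. c b * monom_fun J b x)"
      unfolding K'_def by (rule sum.inter_filter[symmetric]) (rule insert.prems)
    also have "\<dots> = (\<Sum>b\<in>K'. c (the_inv_into K' ?r (?r b)) * monom_fun J (?r b) x)"
      by (intro sum.cong refl) (auto simp: the_inv_into_f_f[OF inj] monom_fun_def)
    also have "\<dots> = (\<Sum>b\<in>?r ` K'. c (the_inv_into K' ?r b) * monom_fun J b x)"
      by (simp add: sum.reindex[OF inj])
    finally show ?thesis by simp
  qed
  have bK': "b \<in> K'" using insert.prems by (simp add: K'_def n_def)
  have "c (the_inv_into K' ?r (?r b)) = 0"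
  proof (rule insert.IH[where K = "?r ` K'" and c = "\<lambda>b. c (the_inv_into K' ?r b)"])
    show "finite (?r ` K')" using insert.prems by (simp add: K'_def)
  qed (use zero bK' in \<open>auto intro: imageI[of b K' ?r, unfolded restrict_def] simp: restrict_def\<close>)
  then show ?case by (simp add: the_inv_into_f_f[OF inj bK'])
qed

section \<open>Forms and projective varieties\<close>

text \<open>Homogeneous polynomials of a known degree, so that degrees can be added up.\<close>

definition form :: "'i set \<Rightarrow> nat \<Rightarrow> 'i cpoly \<Rightarrow> bool" where
  "form I t f \<longleftrightarrow> (\<forall>m\<in>Poly_Mapping.keys f. Poly_Mapping.keys m \<subseteq> I \<and> monom_degree m = t)"

lemma homogeneous_iff_form: "homogeneous I f \<longleftrightarrow> (\<exists>t. form I t f)"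
  by (simp add: homogeneous_def form_def)

lemma form_eval_scale:
  assumes "form I t f"
  shows "eval_poly f (scale_fun c x) = c ^ t * eval_poly f x"
proof -
  have "eval_monom m (scale_fun c x) = c ^ monom_degree m * eval_monom m x" for m
    by (simp add: eval_monom_def monom_degree_def scale_fun_def power_mult_distrib
        prod.distrib power_sum)
  then show ?thesis
    using assms unfolding eval_poly_def sum_distrib_left form_def
    by (intro sum.cong refl) (simp add: algebra_simps)
qed

lemma form_mult:
  assumes "form I d f" "form I e g"
  shows "form I (d + e) (f * g)"
  unfolding form_def
proof
  fix m assume m: "m \<in> Poly_Mapping.keys (f * g)"
  obtain a b where "a \<in> Poly_Mapping.keys f" "b \<in> Poly_Mapping.keys g" "m = a + b"
    using m Poly_Mapping.keys_mult[of f g] by blast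
  then show "Poly_Mapping.keys m \<subseteq> I \<and> monom_degree m = d + e"
    using assms[unfolded form_def] Poly_Mapping.keys_add[of a b] by (fastforce simp: monom_degree_add)
qed

lemma form_const: "form I 0 (Poly_Mapping.single 0 c)"
  by (simp add: form_def monom_degree_def)

lemma form_one: "form I 0 1"
  by (auto simp: form_def monom_degree_def)

lemma form_power: "form I e f \<Longrightarrow> form I (e * n) (f ^ n)"
proof (induction n)
  case (Suc n)
  then show ?case using form_mult[of I e f "e * n" "f ^ n"] by simp
qed (simp add: form_one)

lemma form_add: "form I e f \<Longrightarrow> form I e g \<Longrightarrow> form I e (f + g)"
  using Poly_Mapping.keys_add[of f g] unfolding form_def by blast

lemma form_sum: "(\<And>a. a \<in> A \<Longrightarrow> form I e (f a)) \<Longrightarrow> form I e (\<Sum>a\<in>A. f a)"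
  by (induction A rule: infinite_finite_induct) (auto simp: form_add, auto simp: form_def)

lemma form_prod: "(\<And>a. a \<in> A \<Longrightarrow> form I (e a) (f a)) \<Longrightarrow> form I (\<Sum>a\<in>A. e a) (\<Prod>a\<in>A. f a)"
  by (induction A rule: infinite_finite_induct) (simp_all add: form_one form_mult)

lemma eval_poly_power: "eval_poly (f ^ n) x = eval_poly f x ^ n"
  by (induction n) (auto simp: eval_poly_mult)

lemma eval_poly_prod: "eval_poly (\<Prod>a\<in>A. f a) x = (\<Prod>a\<in>A. eval_poly (f a) x)"
  by (induction A rule: infinite_finite_induct) (auto simp: eval_poly_mult)

lemma eval_poly_const: "eval_poly (Poly_Mapping.single 0 c) x = c"
  by (simp add: eval_poly_single eval_monom_def)

definition linear_form :: "'i set \<Rightarrow> ('i \<Rightarrow> complex) \<Rightarrow> 'i cpoly" where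
  "linear_form I c = (\<Sum>i\<in>I. Poly_Mapping.single (Poly_Mapping.single i 1) (c i))"

lemma form_linear_form: "form I 1 (linear_form I c)"
  unfolding linear_form_def by (rule form_sum) (auto simp: form_def monom_degree_def)

lemma eval_linear_form: "eval_poly (linear_form I c) x = (\<Sum>i\<in>I. c i * x i)"
  by (simp add: linear_form_def eval_poly_sum eval_poly_single eval_monom_def)

lemma span_singleton: "cfun.span {v} = range (\<lambda>c. scale_fun c v)"
  by (simp add: cfun.span_singleton)

lemma scale_fun_one [simp]: "scale_fun 1 v = v"
  by (simp add: scale_fun_def)

lemma line_in_proj_space:
  assumes "v \<in> coord_space I" "v \<noteq> 0"
  shows "cfun.span {v} \<in> proj_space I"
proof -
  have "cfun.independent {v}"
    using assms(2) cfun.independent_insert[of v "{}"] by (auto simp: cfun.independent_empty)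
  then have "cfun.dim (cfun.span {v}) = 1"
    using cfun.dim_span_eq_card_independent by fastforce
  moreover have "cfun.span {v} \<subseteq> coord_space I"
    using assms(1) by (auto simp: span_singleton coord_space_def scale_fun_def)
  ultimately show ?thesis
    by (simp add: proj_space_def projectivization_def cfun.subspace_span)
qed

definition vanishes :: "'i cpoly \<Rightarrow> ('i \<Rightarrow> complex) set set \<Rightarrow> bool" where
  "vanishes f Z \<longleftrightarrow> (\<forall>L\<in>Z. \<forall>x\<in>L. eval_poly f x = 0)"

lemma vanishes_on_line_iff:
  assumes "homogeneous I f"
  shows "(\<forall>x\<in>cfun.span {v}. eval_poly f x = 0) \<longleftrightarrow> eval_poly f v = 0"
proof -
  obtain t where t: "form I t f"
    using assms homogeneous_iff_form by blast
  show ?thesis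
    unfolding span_singleton
    by (auto simp: form_eval_scale[OF t] dest: spec[of _ 1])
qed

text \<open>
  The homogeneous ideal of an irreducible set is prime: the zeros of the two factors would
  otherwise split the set.
\<close>

lemma vanishes_prime:
  assumes Z: "irreducible_closedin (subtopology (zariski I) X) Z"
    and f: "homogeneous I f" and g: "homogeneous I g" and fg: "vanishes (f * g) Z"
  shows "vanishes f Z \<or> vanishes g Z"
proof -
  let ?T = "subtopology (zariski I) X"
  have cl: "closedin ?T Z"
    using Z by (simp add: irreducible_closedin_def)
  then have ZX: "Z \<subseteq> proj_space I"
    using closedin_subset by fastforce
  have part: "closedin ?T (Z \<inter> proj_zeros I {k})" if "homogeneous I k" for k
  proof -
    have "closedin (zariski I) (proj_zeros I {k})"
      using that closedin_zariski by blast
    then have "closedin ?T (X \<inter> proj_zeros I {k})"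
      by (rule closedin_subtopology_Int_closed)
    then have "closedin ?T (Z \<inter> (X \<inter> proj_zeros I {k}))"
      by (rule closedin_Int[OF cl])
    moreover have "Z \<subseteq> X"
      using closedin_subset[OF cl] by auto
    ultimately show ?thesis by (simp add: inf.absorb1 Int_assoc[symmetric])
  qed
  have "Z \<subseteq> proj_zeros I {f} \<union> proj_zeros I {g}"
  proof
    fix L assume L: "L \<in> Z"
    then obtain v where v: "v \<in> L" "L = cfun.span {v}"
      using ZX proj_space_generator[of L I] span_singleton by (metis subsetD)
    have "eval_poly f v * eval_poly g v = 0"
      using fg L v unfolding vanishes_def eval_poly_mult by blast
    then show "L \<in> proj_zeros I {f} \<union> proj_zeros I {g}"
      using v L ZX vanishes_on_line_iff[OF f, of v] vanishes_on_line_iff[OF g, of v]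
      by (auto simp: proj_zeros_def)
  qed
  then have "Z = (Z \<inter> proj_zeros I {f}) \<union> (Z \<inter> proj_zeros I {g})"
    by blast
  then have "Z = Z \<inter> proj_zeros I {f} \<or> Z = Z \<inter> proj_zeros I {g}"
    using Z part[OF f] part[OF g] unfolding irreducible_closedin_def by blast
  then show ?thesis
    by (auto simp: vanishes_def proj_zeros_def)
qed

lemma vanishes_prime_power:
  assumes Z: "irreducible_closedin (subtopology (zariski I) X) Z"
    and f: "homogeneous I f" and g: "homogeneous I g" and fg: "vanishes (f ^ n * g) Z"
    and nz: "\<not> vanishes f Z"
  shows "vanishes g Z"
proof -
  have "\<not> vanishes (f ^ n) Z"
    using nz by (auto simp: vanishes_def eval_poly_power)
  moreover have "homogeneous I (f ^ n)"
    using f form_power homogeneous_iff_form by blast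
  ultimately show ?thesis
    using vanishes_prime[OF Z _ g fg] by blast
qed

lemma chain_has_top:
  assumes "finite C" "C \<noteq> {}" "chain\<^sub>\<subseteq> C"
  obtains Z where "Z \<in> C" "\<And>Y. Y \<in> C \<Longrightarrow> Y \<subseteq> Z"
proof -
  have "\<exists>Z\<in>C. \<forall>Y\<in>C. Y \<subseteq> Z"
    using assms
  proof (induction C rule: finite_ne_induct)
    case (insert A C)
    then obtain Z where Z: "Z \<in> C" "\<forall>Y\<in>C. Y \<subseteq> Z"
      by (auto simp: chain_subset_def)
    then have "A \<subseteq> Z \<or> Z \<subseteq> A"
      using insert.prems by (auto simp: chain_subset_def)
    then show ?case using Z by blast
  qed simp
  then show ?thesis using that by blast
qed

text \<open>
  The step of the next lemma: if \<open>f\<close> vanishes on \<open>Y\<close> but not on the larger irreducible \<open>Z\<close>, the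
  forms on \<open>Z\<close> gain one degree of freedom over those on \<open>Y\<close>, since a relation
  \<open>\<Sum>j. f ^ j * x ^ (e * (T - j)) * h j = 0\<close> on \<open>Z\<close> can be divided by the lowest power of \<open>f\<close> that
  occurs and then restricted to \<open>Y\<close>, where only its first term survives.  The powers of the
  linear form \<open>x\<close> equalize the degrees.
\<close>

lemma relation_descends:
  assumes Z: "irreducible_closedin (subtopology (zariski I) X) Z"
    and Y: "irreducible_closedin (subtopology (zariski I) X) Y" and "Y \<subseteq> Z"
    and f: "form I e f" "vanishes f Y" "\<not> vanishes f Z"
    and x: "form I 1 x" "\<not> vanishes x Y"
    and h: "\<And>j. form I t (h j)"
    and rel: "vanishes (\<Sum>j\<le>T. f ^ j * x ^ (e * (T - j)) * h j) Z"
    and "j \<le> T" and lower: "\<And>i. i < j \<Longrightarrow> h i = 0"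
  shows "vanishes (h j) Y"
proof -
  have homx: "homogeneous I x" and homf: "homogeneous I f" and homh: "homogeneous I (h j)"
    using x(1) f(1) h[of j] homogeneous_iff_form by blast+
  define Q where "Q = (\<Sum>i\<in>{j..T}. f ^ (i - j) * x ^ (e * (T - i)) * h i)"
  have hom: "form I (e * (i - j) + e * (T - i) + t) (f ^ (i - j) * x ^ (e * (T - i)) * h i)" for i
    using form_mult[OF form_mult[OF form_power[OF f(1)] form_power[OF x(1)]] h] by simp
  have "form I (e * (T - j) + t) Q"
    unfolding Q_def
  proof (rule form_sum)
    fix i assume "i \<in> {j..T}"
    then have "e * (i - j) + e * (T - i) + t = e * (T - j) + t"
      by (simp flip: distrib_left)
    then show "form I (e * (T - j) + t) (f ^ (i - j) * x ^ (e * (T - i)) * h i)"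
      using hom[of i] by simp
  qed
  then have Q: "homogeneous I Q"
    using homogeneous_iff_form by blast
  have "(\<Sum>i\<le>T. f ^ i * x ^ (e * (T - i)) * h i) = (\<Sum>i\<in>{j..T}. f ^ i * x ^ (e * (T - i)) * h i)"
    using lower by (intro sum.mono_neutral_right) (auto simp: not_le)
  also have "\<dots> = f ^ j * Q"
    unfolding Q_def sum_distrib_left
    by (intro sum.cong refl) (simp add: mult.assoc[symmetric] power_add[symmetric])
  finally have "vanishes Q Z"
    using rel vanishes_prime_power[OF Z homf Q _ f(3)] by simp
  have "vanishes (x ^ (e * (T - j)) * h j) Y"
    unfolding vanishes_def
  proof (intro ballI)
    fix L v assume Lv: "L \<in> Y" "v \<in> L"
    then have fv: "eval_poly f v = 0" and "eval_poly Q v = 0"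
      using f(2) \<open>vanishes Q Z\<close> \<open>Y \<subseteq> Z\<close> by (auto simp: vanishes_def)
    have "eval_poly Q v = (\<Sum>i\<in>{j..T}. if i = j then eval_poly (x ^ (e * (T - j)) * h j) v else 0)"
      unfolding Q_def eval_poly_sum
      by (intro sum.cong refl) (auto simp: eval_poly_mult eval_poly_power fv)
    also have "\<dots> = eval_poly (x ^ (e * (T - j)) * h j) v"
      using \<open>j \<le> T\<close> by (simp add: sum.delta')
    finally show "eval_poly (x ^ (e * (T - j)) * h j) v = 0"
      using \<open>eval_poly Q v = 0\<close> by simp
  qed
  then show ?thesis
    using vanishes_prime_power[OF Y homx homh _ x(2)] by blast
qed

text \<open>
  Each step of a chain multiplies the number of independent forms by \<open>T + 1\<close>: if \<open>f\<close> separates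
  the last two members, the forms \<open>f ^ j\<close> for \<open>j \<le> T\<close> are multiplied with the family that is
  already independent on the smaller one.  The linear form \<open>x\<close> that vanishes on no member
  accompanies the induction because \<open>relation_descends\<close> needs it; an index list records the
  exponents.
\<close>

lemma independent_forms_on_chain:
  fixes I :: "'i set"
  assumes "finite C" "\<And>Z. Z \<in> C \<Longrightarrow> irreducible_closedin (subtopology (zariski I) X) Z"
    and "chain\<^sub>\<subseteq> C" "card C = Suc k" "finite I"
  shows "\<exists>Z\<in>C. (\<forall>Y\<in>C. Y \<subseteq> Z) \<and> (\<exists>x. form I 1 x \<and> \<not> vanishes x Z) \<and>
    (\<exists>A. \<forall>T. \<exists>K (g :: nat list \<Rightarrow> 'i cpoly). finite K \<and> card K = (T + 1) ^ k \<and>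
      (\<forall>b. form I (A * T) (g b)) \<and>
      (\<forall>c. vanishes (\<Sum>b\<in>K. Poly_Mapping.single 0 (c b) * g b) Z \<longrightarrow> (\<forall>b\<in>K. c b = 0)))"
  using assms
proof (induction k arbitrary: C)
  case 0
  then obtain Z where C: "C = {Z}"
    using card_1_singletonE by auto
  have irr: "irreducible_closedin (subtopology (zariski I) X) Z"
    using 0 C by blast
  then obtain L where L: "L \<in> Z" "L \<in> proj_space I"
    using closedin_subset by (fastforce simp: irreducible_closedin_def)
  then obtain v where v: "v \<in> L" "v \<noteq> 0"
    using proj_space_generator by metis
  have "v \<in> coord_space I"
    using v L by (auto simp: proj_space_def projectivization_def)
  then obtain s where s: "s \<in> I" "v s \<noteq> 0"
    using v(2) by (auto simp: coord_space_def fun_eq_iff)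
  define x where "x = linear_form I (\<lambda>i. if i = s then 1 else 0 :: complex)"
  have "eval_poly x v = v s"
    using s \<open>finite I\<close> by (simp add: x_def eval_linear_form if_distrib[of "\<lambda>c. c * _"] sum.delta cong: if_cong)
  then have x: "form I 1 x \<and> \<not> vanishes x Z"
    using s L v form_linear_form unfolding x_def vanishes_def by metis
  have "c = 0" if "vanishes (Poly_Mapping.single 0 c) Z" for c
    using that L v by (auto simp: vanishes_def eval_poly_const)
  then have "finite {[]} \<and> card {[]} = (T + 1) ^ 0 \<and> (\<forall>b. form I (0 * T) (1 :: 'i cpoly)) \<and>
      (\<forall>c. vanishes (\<Sum>b\<in>{[]}. Poly_Mapping.single 0 (c b) * 1) Z \<longrightarrow> (\<forall>b\<in>{[]}. c b = 0))" for T
    by (simp add: form_one)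
  then have "\<exists>A. \<forall>T. \<exists>K (g :: nat list \<Rightarrow> 'i cpoly). finite K \<and> card K = (T + 1) ^ 0 \<and>
      (\<forall>b. form I (A * T) (g b)) \<and>
      (\<forall>c. vanishes (\<Sum>b\<in>K. Poly_Mapping.single 0 (c b) * g b) Z \<longrightarrow> (\<forall>b\<in>K. c b = 0))"
    by (intro exI[of _ 0] exI[of _ "{[]}"] exI[of _ "\<lambda>_. 1"] allI)
  then show ?case
    unfolding C using x by auto
next
  case (Suc k)
  obtain Z where Z: "Z \<in> C" "\<And>Y. Y \<in> C \<Longrightarrow> Y \<subseteq> Z"
    by (rule chain_has_top[of C]) (use Suc.prems in auto)
  \<comment> \<open>The induction hypothesis applies to the chain without its top \<open>Z\<close>; its own top is \<open>Y\<close>.\<close>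
  have "\<exists>Y\<in>C - {Z}. (\<forall>W\<in>C - {Z}. W \<subseteq> Y) \<and> (\<exists>x. form I 1 x \<and> \<not> vanishes x Y) \<and>
    (\<exists>A. \<forall>T. \<exists>K (g :: nat list \<Rightarrow> 'i cpoly). finite K \<and> card K = (T + 1) ^ k \<and>
      (\<forall>b. form I (A * T) (g b)) \<and>
      (\<forall>c. vanishes (\<Sum>b\<in>K. Poly_Mapping.single 0 (c b) * g b) Y \<longrightarrow> (\<forall>b\<in>K. c b = 0)))"
    using Suc.prems Z(1) by (intro Suc.IH) (auto simp: chain_subset_def)
  then obtain Y x A where Y: "Y \<in> C" "Y \<noteq> Z" and x: "form I 1 x" "\<not> vanishes x Y"
    and A: "\<And>T. \<exists>K (g :: nat list \<Rightarrow> 'i cpoly). finite K \<and> card K = (T + 1) ^ k \<and>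
      (\<forall>b. form I (A * T) (g b)) \<and>
      (\<forall>c. vanishes (\<Sum>b\<in>K. Poly_Mapping.single 0 (c b) * g b) Y \<longrightarrow> (\<forall>b\<in>K. c b = 0))"
    by blast
  have YZ: "Y \<subseteq> Z" using Y Z by blast
  have irr: "irreducible_closedin (subtopology (zariski I) X) Z"
    "irreducible_closedin (subtopology (zariski I) X) Y"
    using Suc.prems Y Z by auto
  obtain U where U: "closedin (zariski I) U" "Y = U \<inter> X"
    using irr(2) by (auto simp: irreducible_closedin_def closedin_subtopology)
  obtain F where F: "\<forall>f\<in>F. homogeneous I f" "U = proj_zeros I F"
    using U closedin_zariski by metis
  have ZX: "Z \<subseteq> proj_space I" "Z \<subseteq> X"
    using irr(1) closedin_subset by (fastforce simp: irreducible_closedin_def)+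
  obtain f where f: "f \<in> F" "\<not> vanishes f Z"
  proof -
    have "\<not> Z \<subseteq> proj_zeros I F"
      using U F ZX Y YZ by auto
    then show ?thesis
      using that ZX by (auto simp: proj_zeros_def vanishes_def)
  qed
  have fY: "vanishes f Y"
    using f U F by (auto simp: proj_zeros_def vanishes_def)
  obtain e where e: "form I e f"
    using F f homogeneous_iff_form by blast
  have "\<exists>K (g :: nat list \<Rightarrow> 'i cpoly). finite K \<and> card K = (T + 1) ^ Suc k \<and>
      (\<forall>b. form I ((A + e) * T) (g b)) \<and>
      (\<forall>c. vanishes (\<Sum>b\<in>K. Poly_Mapping.single 0 (c b) * g b) Z \<longrightarrow> (\<forall>b\<in>K. c b = 0))" for T
  proof -
    obtain K and g :: "nat list \<Rightarrow> 'i cpoly" where K: "finite K" "card K = (T + 1) ^ k"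
      and g: "\<And>b. form I (A * T) (g b)"
      and ind: "\<And>c. vanishes (\<Sum>b\<in>K. Poly_Mapping.single 0 (c b) * g b) Y \<Longrightarrow> \<forall>b\<in>K. c b = 0"
      using A[of T] by blast
    define K' where "K' = (\<lambda>(j, b). j # b) ` ({..T} \<times> K)"
    \<comment> \<open>The minimum only makes \<open>g'\<close> a form of the right degree for every list.\<close>
    define g' where "g' b = (let j = min T (hd b) in f ^ j * x ^ (e * (T - j)) * g (tl b))" for b
    have inj: "inj_on (\<lambda>(j, b). j # b) ({..T} \<times> K)"
      by (auto simp: inj_on_def)
    have "card K' = (T + 1) ^ Suc k"
      by (simp add: K'_def card_image[OF inj] K)
    moreover have "form I ((A + e) * T) (g' b)" for b
    proof -
      let ?j = "min T (hd b)"
      have "e * ?j + e * (T - ?j) + A * T = (A + e) * T"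
        by (simp flip: distrib_left add: algebra_simps)
      then show ?thesis
        using form_mult[OF form_mult[OF form_power[OF e] form_power[OF x(1)]] g, of ?j "e * (T - ?j)"]
        unfolding g'_def Let_def by (metis mult_1)
    qed
    moreover have "\<forall>b\<in>K'. c b = 0"
      if rel: "vanishes (\<Sum>b\<in>K'. Poly_Mapping.single 0 (c b) * g' b) Z" for c
    proof -
      define h where "h j = (\<Sum>b\<in>K. Poly_Mapping.single 0 (c (j # b)) * g b)" for j
      have hform: "form I (A * T) (h j)" for j
        unfolding h_def using form_mult[OF form_const g] by (intro form_sum) auto
      have "(\<Sum>b\<in>K'. Poly_Mapping.single 0 (c b) * g' b) =
          (\<Sum>(j, b)\<in>{..T} \<times> K. Poly_Mapping.single 0 (c (j # b)) * g' (j # b))"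
        unfolding K'_def by (subst sum.reindex[OF inj]) (simp add: case_prod_unfold)
      also have "\<dots> = (\<Sum>j\<le>T. \<Sum>b\<in>K. Poly_Mapping.single 0 (c (j # b)) * g' (j # b))"
        by (simp add: sum.cartesian_product)
      also have "\<dots> = (\<Sum>j\<le>T. f ^ j * x ^ (e * (T - j)) * h j)"
        unfolding h_def sum_distrib_left
        by (intro sum.cong refl) (simp add: g'_def Let_def algebra_simps)
      finally have rel': "vanishes (\<Sum>j\<le>T. f ^ j * x ^ (e * (T - j)) * h j) Z"
        using rel by simp
      have "j \<le> T \<longrightarrow> (\<forall>b\<in>K. c (j # b) = 0)" for j
      proof (induction j rule: less_induct)
        case (less j)
        show ?case
        proof
          assume j: "j \<le> T"
          have "h i = 0" if "i < j" for i
            unfolding h_def using less that j by (intro sum.neutral) auto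
          then have "vanishes (h j) Y"
            using relation_descends[OF irr YZ e fY f(2) x hform rel' j] by blast
          then show "\<forall>b\<in>K. c (j # b) = 0"
            unfolding h_def by (rule ind)
        qed
      qed
      then show ?thesis by (auto simp: K'_def)
    qed
    moreover have "finite K'"
      by (simp add: K'_def K(1))
    ultimately show ?thesis
      by (intro exI[of _ K'] exI[of _ g'] conjI allI impI)
  qed
  moreover have "\<not> vanishes x Z"
    using x(2) YZ by (auto simp: vanishes_def)
  ultimately show ?case
    using x(1) by (intro bexI[of _ Z] conjI exI[of _ x] exI[of _ "A + e"] ballI allI Z)
qed

text \<open>
  If forms on \<open>X\<close> are determined by their pullbacks along a polynomial family \<open>G\<close>, monomials in
  \<open>card J\<close> variables bound the number of independent ones, hence the length of chains.
\<close>

lemma proj_dim_le: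
  fixes G :: "('j \<Rightarrow> complex) \<Rightarrow> 'i \<Rightarrow> complex"
  assumes "finite I" "finite J"
    and G: "\<And>i. i \<in> I \<Longrightarrow> (\<lambda>y. G y i) \<in> polyfun J e"
    and dense: "\<And>f. homogeneous I f \<Longrightarrow> (\<And>y. eval_poly f (G y) = 0) \<Longrightarrow> vanishes f X"
  shows "proj_dim I X \<le> ereal (real (card J))"
  unfolding proj_dim_def krull_dim_def
proof (rule SUP_least, clarify)
  fix C assume C: "finite C" "\<forall>Z\<in>C. irreducible_closedin (subtopology (zariski I) X) Z" "chain\<^sub>\<subseteq> C"
  show "ereal (real (card C) - 1) \<le> ereal (real (card J))"
  proof (rule ccontr)
    assume "\<not> ?thesis"
    then obtain k where k: "card C = Suc k" "card J < k"
      by (cases "card C") auto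
    obtain Z A where Z: "Z \<in> C" and A: "\<And>T. \<exists>K (g :: nat list \<Rightarrow> 'i cpoly).
      finite K \<and> card K = (T + 1) ^ k \<and> (\<forall>b. form I (A * T) (g b)) \<and>
      (\<forall>c. vanishes (\<Sum>b\<in>K. Poly_Mapping.single 0 (c b) * g b) Z \<longrightarrow> (\<forall>b\<in>K. c b = 0))"
      using independent_forms_on_chain[OF C(1) _ C(3) k(1) \<open>finite I\<close>, of X] C(2) by blast
    obtain T where T: "(e * A * T + 1) ^ card J < (T + 1) ^ k"
      using power_growth[OF k(2)] by blast
    obtain K and g :: "nat list \<Rightarrow> 'i cpoly" where K: "finite K" "card K = (T + 1) ^ k"
      and g: "\<And>b. form I (A * T) (g b)"
      and ind: "\<And>c. vanishes (\<Sum>b\<in>K. Poly_Mapping.single 0 (c b) * g b) Z \<Longrightarrow> \<forall>b\<in>K. c b = 0"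
      using A[of T] by blast
    have "(\<lambda>y. eval_poly (g b) (G y)) \<in> polyfun J (e * (A * T))" for b
      using G g[unfolded form_def] by (intro polyfun_eval_poly[where I = I]) auto
    moreover have "(e * (A * T) + 1) ^ card J < card K"
      using T K by (simp add: mult.assoc)
    ultimately obtain c where c: "\<exists>b\<in>K. c b \<noteq> 0" "\<And>y. (\<Sum>b\<in>K. c b * eval_poly (g b) (G y)) = 0"
      using polyfun_dependence[OF assms(2) K(1), of "\<lambda>b y. eval_poly (g b) (G y)"] by blast
    have "form I (A * T) (\<Sum>b\<in>K. Poly_Mapping.single 0 (c b) * g b)"
      using form_mult[OF form_const g] by (intro form_sum) auto
    then have "vanishes (\<Sum>b\<in>K. Poly_Mapping.single 0 (c b) * g b) X"
      using c(2) homogeneous_iff_form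
      by (intro dense) (auto simp: eval_poly_sum eval_poly_mult eval_poly_const)
    moreover have "Z \<subseteq> X"
      using Z C(2) closedin_subset by (fastforce simp: irreducible_closedin_def)
    ultimately have "vanishes (\<Sum>b\<in>K. Poly_Mapping.single 0 (c b) * g b) Z"
      by (auto simp: vanishes_def)
    then show False using ind c(1) by blast
  qed
qed

section \<open>A lower bound for dimensions\<close>

abbreviation zariski_closure :: "'i set \<Rightarrow> ('i \<Rightarrow> complex) set set \<Rightarrow> ('i \<Rightarrow> complex) set set" where
  "zariski_closure I E \<equiv> Abstract_Topology.closure_of (zariski I) E"

text \<open>
  Families rather than sets, since the vectors to be proved independent are not known to be
  distinct beforehand.
\<close>

definition independent_family :: "'k set \<Rightarrow> ('k \<Rightarrow> 'i \<Rightarrow> complex) \<Rightarrow> bool" where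
  "independent_family K v \<longleftrightarrow>
     (\<forall>c. (\<forall>i. (\<Sum>k\<in>K. c k * v k i) = 0) \<longrightarrow> (\<forall>k\<in>K. c k = 0))"

lemma independent_familyD:
  "independent_family K v \<Longrightarrow> (\<And>i. (\<Sum>k\<in>K. c k * v k i) = 0) \<Longrightarrow> k \<in> K \<Longrightarrow> c k = 0"
  unfolding independent_family_def by blast

lemma independent_family_inj:
  assumes "independent_family K v" "finite K"
  shows "inj_on v K"
proof (rule inj_onI, rule ccontr)
  fix a b assume ab: "a \<in> K" "b \<in> K" "v a = v b" "a \<noteq> b"
  let ?c = "\<lambda>k. if k = a then 1 else if k = b then - 1 else 0 :: complex"
  have "(\<Sum>k\<in>K. ?c k * v k i) = (\<Sum>k\<in>{a, b}. ?c k * v k i)" for i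
    using ab assms(2) by (intro sum.mono_neutral_right) auto
  then have "(\<Sum>k\<in>K. ?c k * v k i) = 0" for i
    using ab(3,4) by simp
  then have "?c a = 0"
    using ab(1) by (rule independent_familyD[OF assms(1)])
  then show False
    by simp
qed

lemma independent_family_iff:
  assumes "finite K"
  shows "independent_family K v \<longleftrightarrow> inj_on v K \<and> cfun.independent (v ` K)"
proof
  assume v: "independent_family K v"
  have inj: "inj_on v K" by (rule independent_family_inj[OF v assms])
  moreover have "cfun.independent (v ` K)"
  proof
    assume "cfun.dependent (v ` K)"
    then obtain u where u: "\<exists>w\<in>v ` K. u w \<noteq> 0" "(\<Sum>w\<in>v ` K. scale_fun (u w) w) = 0"
      using cfun.dependent_finite[of "v ` K"] assms by auto
    have "(\<Sum>k\<in>K. u (v k) * v k i) = (\<Sum>w\<in>v ` K. scale_fun (u w) w) i" for i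
      by (simp add: sum.reindex[OF inj] sum_apply scale_fun_def)
    then have "(\<Sum>k\<in>K. u (v k) * v k i) = 0" for i
      using u(2) by simp
    then have "u (v k) = 0" if "k \<in> K" for k
      using independent_familyD[OF v, of "\<lambda>k. u (v k)"] that by blast
    then show False using u(1) by auto
  qed
  ultimately show "inj_on v K \<and> cfun.independent (v ` K)" ..
next
  assume v: "inj_on v K \<and> cfun.independent (v ` K)"
  show "independent_family K v"
    unfolding independent_family_def
  proof (intro allI impI)
    fix c assume "\<forall>i. (\<Sum>k\<in>K. c k * v k i) = 0"
    then have "(\<Sum>w\<in>v ` K. scale_fun (c (the_inv_into K v w)) w) = 0"
      using v by (simp add: sum.reindex the_inv_into_f_f fun_eq_iff sum_apply scale_fun_def)
    then have "\<forall>w\<in>v ` K. c (the_inv_into K v w) = 0"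
      using v assms cfun.dependent_finite[of "v ` K"] by auto
    then show "\<forall>k\<in>K. c k = 0"
      using v by (simp add: the_inv_into_f_f)
  qed
qed

definition unit_fun :: "'i \<Rightarrow> 'i \<Rightarrow> complex" where
  "unit_fun i = (\<lambda>j. if j = i then 1 else 0)"

lemma coord_space_expand:
  assumes "finite I" "x \<in> coord_space I"
  shows "x = (\<Sum>i\<in>I. scale_fun (x i) (unit_fun i))"
proof
  fix j
  have "(\<Sum>i\<in>I. scale_fun (x i) (unit_fun i)) j = (\<Sum>i\<in>I. if j = i then x i else 0)"
    unfolding sum_apply by (intro sum.cong) (auto simp: scale_fun_def unit_fun_def)
  then show "x j = (\<Sum>i\<in>I. scale_fun (x i) (unit_fun i)) j"
    using assms by (auto simp: coord_space_def sum.delta')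
qed

text \<open>Linear forms dual to an independent family, read off from a basis that extends it.\<close>

lemma dual_functionals:
  fixes v :: "'k \<Rightarrow> 'i \<Rightarrow> complex"
  assumes "finite I" "finite K" "independent_family K v" "\<And>k. k \<in> K \<Longrightarrow> v k \<in> coord_space I"
  shows "\<exists>y. \<forall>k\<in>K. \<forall>l\<in>K. (\<Sum>i\<in>I. y k i * v l i) = (if k = l then 1 else 0)"
proof -
  define B where "B = cfun.extend_basis (v ` K)"
  have inj: "inj_on v K" and ind: "cfun.independent (v ` K)"
    using assms(2,3) independent_family_iff by auto
  have B: "cfun.independent B" "cfun.span B = UNIV" "v ` K \<subseteq> B"
    unfolding B_def using cfun.independent_extend_basis[OF ind] cfun.span_extend_basis[OF ind]
      cfun.extend_basis_superset[OF ind] by auto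
  define y where "y k i = cfun.representation B (unit_fun i) (v k)" for k i
  have "(\<Sum>i\<in>I. y k i * v l i) = (if k = l then 1 else 0)" if kl: "k \<in> K" "l \<in> K" for k l
  proof -
    have "cfun.representation B (v l) (v k) =
        cfun.representation B (\<Sum>i\<in>I. scale_fun (v l i) (unit_fun i)) (v k)"
      using coord_space_expand[OF assms(1) assms(4)[OF kl(2)]] by simp
    also have "\<dots> = (\<Sum>i\<in>I. y k i * v l i)"
      using B by (simp add: cfun.representation_sum cfun.representation_scale y_def mult.commute)
    finally have "(\<Sum>i\<in>I. y k i * v l i) = cfun.representation B (v l) (v k)" ..
    also have "\<dots> = (if k = l then 1 else 0)"
      using B kl inj by (auto simp: cfun.representation_basis inj_on_eq_iff)
    finally show ?thesis .
  qed
  then show ?thesis by blast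
qed

lemma polyfun_truncate:
  assumes "f \<in> polyfun J e" "finite J" "J' \<subseteq> J"
  shows "(\<lambda>x. f (\<lambda>j. if j \<in> J' then x j else 0)) \<in> polyfun J' e"
  using assms(1)[unfolded polyfun_def]
proof (induction rule: cfun.span_induct_alt)
  case base
  show ?case by (simp add: polyfun_const)
next
  case (step c h k)
  obtain b where b: "h = monom_fun J b" "\<forall>j\<in>J. b j \<le> e" using step(1) by blast
  have "h (\<lambda>j. if j \<in> J' then x j else 0) = (\<Prod>j\<in>J - J'. 0 ^ b j) * monom_fun J' b x" for x
  proof -
    have "h (\<lambda>j. if j \<in> J' then x j else 0) =
        (\<Prod>j\<in>J - J'. 0 ^ b j) * (\<Prod>j\<in>J'. (if j \<in> J' then x j else 0) ^ b j)"
      using prod.subset_diff[OF assms(3,2), of "\<lambda>j. (if j \<in> J' then x j else 0) ^ b j"]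
      by (simp add: b monom_fun_def)
    then show ?thesis by (simp add: monom_fun_def)
  qed
  moreover have "monom_fun J' b \<in> polyfun J' e"
    using b assms(3) by (intro monom_fun_in_polyfun) auto
  ultimately have "(\<lambda>x. h (\<lambda>j. if j \<in> J' then x j else 0)) \<in> polyfun J' e"
    using polyfun_mult[OF polyfun_const[of _ J' 0]] by fastforce
  then have "(\<lambda>x. c * h (\<lambda>j. if j \<in> J' then x j else 0)) \<in> polyfun J' e"
    using polyfun_mult[OF polyfun_const[of _ J' 0]] by fastforce
  from polyfun_add[OF this step(2)] show ?case
    by (simp add: scale_fun_def)
qed

text \<open>
  Functions \<open>u j\<close> that vanish to first order with prescribed derivatives \<open>x j\<close> satisfy no
  polynomial relation for all \<open>x\<close>: the terms of lowest degree of such a relation would survive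
  as a relation between the \<open>x j\<close>.
\<close>

lemma lowest_degree_limit:
  fixes u :: "nat \<Rightarrow> complex \<Rightarrow> complex"
  assumes "finite K" and w: "(w \<longlongrightarrow> 1) (at 0)"
    and u: "\<And>j. j < m \<Longrightarrow> u j 0 = 0 \<and> (u j has_field_derivative x j) (at 0)"
    and rel: "\<And>s. (\<Sum>b\<in>K. c b * (w s ^ n b * (\<Prod>j<m. u j s ^ b j))) = 0"
    and low: "\<And>b. b \<in> K \<Longrightarrow> c b \<noteq> 0 \<Longrightarrow> d \<le> (\<Sum>j<m. b j)"
  shows "(\<Sum>b\<in>K. (if (\<Sum>j<m. b j) = d then c b else 0) * monom_fun {..<m} b x) = 0"
proof -
  let ?h = "\<lambda>s. \<Sum>b\<in>K. c b * (s ^ ((\<Sum>j<m. b j) - d) * (w s ^ n b * (\<Prod>j<m. (u j s / s) ^ b j)))"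
  have lim: "((\<lambda>s. u j s / s) \<longlongrightarrow> x j) (at 0)" if "j < m" for j
    using u[OF that] by (auto simp: has_field_derivative_iff)
  have "(?h \<longlongrightarrow> (\<Sum>b\<in>K. c b * (0 ^ ((\<Sum>j<m. b j) - d) * (1 ^ n b * (\<Prod>j<m. x j ^ b j))))) (at 0)"
    using lim by (intro tendsto_intros w) auto
  moreover have "?h s = 0" if s: "s \<noteq> 0" for s
  proof -
    have "s ^ d * ?h s = (\<Sum>b\<in>K. c b * (w s ^ n b * (\<Prod>j<m. u j s ^ b j)))"
      unfolding sum_distrib_left
    proof (intro sum.cong refl)
      fix b assume b: "b \<in> K"
      show "s ^ d * (c b * (s ^ ((\<Sum>j<m. b j) - d) * (w s ^ n b * (\<Prod>j<m. (u j s / s) ^ b j)))) =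
          c b * (w s ^ n b * (\<Prod>j<m. u j s ^ b j))"
      proof (cases "c b = 0")
        case False
        have "s ^ d * s ^ ((\<Sum>j<m. b j) - d) = (\<Prod>j<m. s ^ b j)"
          using low[OF b False] by (simp add: power_add[symmetric] power_sum[symmetric])
        moreover have "(\<Prod>j<m. s ^ b j) * (\<Prod>j<m. (u j s / s) ^ b j) = (\<Prod>j<m. u j s ^ b j)"
          unfolding prod.distrib[symmetric] power_mult_distrib[symmetric] using s by simp
        ultimately show ?thesis
          by (metis (no_types, lifting) mult.assoc mult.left_commute)
      qed simp
    qed
    then show ?thesis using rel s by simp
  qed
  then have "(?h \<longlongrightarrow> 0) (at 0)"
    by (intro tendsto_eventually) (auto simp: eventually_at_filter)
  ultimately have "(\<Sum>b\<in>K. c b * (0 ^ ((\<Sum>j<m. b j) - d) * (1 ^ n b * (\<Prod>j<m. x j ^ b j)))) = 0"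
    using tendsto_unique[OF at_neq_bot] by blast
  moreover have "c b * (0 ^ ((\<Sum>j<m. b j) - d) * (1 ^ n b * (\<Prod>j<m. x j ^ b j))) =
      (if (\<Sum>j<m. b j) = d then c b else 0) * monom_fun {..<m} b x" if "b \<in> K" for b
    using low[OF that] by (cases "c b = 0") (auto simp: monom_fun_def power_0_left)
  ultimately show ?thesis by simp
qed

text \<open>
  A polynomial map into the affine cone over a projective variety.  The vector \<open>v 0\<close> is its value
  at the origin, \<open>v 1, \<dots>, v D\<close> are its partial derivatives there.  Independence of all of them, not
  just of the derivatives, makes the induced map to projective space an immersion.
\<close>

locale immersion =
  fixes I :: "'i set" and D e :: nat and G :: "(nat \<Rightarrow> complex) \<Rightarrow> 'i \<Rightarrow> complex"
    and v :: "nat \<Rightarrow> 'i \<Rightarrow> complex"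
  assumes finite_I: "finite I"
    and G_polyfun: "\<And>i. i \<in> I \<Longrightarrow> (\<lambda>x. G x i) \<in> polyfun {..<D} e"
    and G_coord: "\<And>x. G x \<in> coord_space I"
    and G_0: "G (\<lambda>_. 0) = v 0"
    and v_independent: "independent_family {..D} v"
    and G_deriv: "\<And>x i. i \<in> I \<Longrightarrow>
      ((\<lambda>s. G (\<lambda>j. s * x j) i) has_field_derivative (\<Sum>j<D. x j * v (Suc j) i)) (at 0)"
    and v_coord: "\<And>j. j \<le> D \<Longrightarrow> v j \<in> coord_space I"
begin

definition trunc :: "nat \<Rightarrow> (nat \<Rightarrow> complex) \<Rightarrow> nat \<Rightarrow> complex" where
  "trunc k x = (\<lambda>j. if j < k then x j else 0)"

text \<open>
  The images of \<open>k\<close>- and \<open>k + 1\<close>-dimensional parameter spaces satisfy different equations: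
  there are too many forms for all of them to be independent on the first image, but on the
  second one they are, because its tangent space is large enough.
\<close>

lemma separating_form:
  assumes "k < D"
  shows "\<exists>f. homogeneous I f \<and> (\<forall>x. eval_poly f (G (trunc k x)) = 0) \<and>
    (\<exists>x. eval_poly f (G (trunc (Suc k) x)) \<noteq> 0)"
proof -
  obtain y where y: "\<forall>p\<in>{..D}. \<forall>q\<in>{..D}. (\<Sum>i\<in>I. y p i * v q i) = (if p = q then 1 else 0)"
    using dual_functionals[OF finite_I finite_atMost v_independent] v_coord by auto
  define Y where "Y p = linear_form I (y p)" for p
  obtain T where T: "(e * Suc k * T + 1) ^ k < (T + 1) ^ Suc k"
    using power_growth[of k "Suc k"] by blast
  define t where "t = Suc k * T"
  define K where "K = ({..<Suc k} \<rightarrow>\<^sub>E {..T})"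
  have K: "finite K" "card K = (T + 1) ^ Suc k"
    by (auto simp: K_def finite_PiE card_PiE)
  \<comment> \<open>All monomials in \<open>Y 1, \<dots>, Y (Suc k)\<close> with exponents at most \<open>T\<close>, made homogeneous by \<open>Y 0\<close>.\<close>
  define g where "g b = Y 0 ^ (t - (\<Sum>j<Suc k. b j)) * (\<Prod>j<Suc k. Y (Suc j) ^ b j)" for b :: "nat \<Rightarrow> nat"
  have Y: "form I 1 (Y p)" for p
    by (simp add: Y_def form_linear_form del: One_nat_def)
  have g: "form I t (g b)" if "b \<in> K" for b
  proof -
    have "(\<Sum>j<Suc k. b j) \<le> (\<Sum>j<Suc k. T)"
      using that unfolding K_def by (intro sum_mono) auto
    then have le: "(\<Sum>j<Suc k. b j) \<le> t"
      by (simp add: t_def)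
    have "form I (1 * (t - (\<Sum>j<Suc k. b j)) + (\<Sum>j<Suc k. 1 * b j)) (g b)"
      unfolding g_def by (intro form_mult form_prod form_power Y)
    then show ?thesis using le by (simp del: sum.lessThan_Suc)
  qed
  have "(\<lambda>x. eval_poly (g b) (G (trunc k x))) \<in> polyfun {..<k} (e * t)" if "b \<in> K" for b
  proof (rule polyfun_eval_poly[where I = I])
    fix i assume "i \<in> I"
    then show "(\<lambda>x. G (trunc k x) i) \<in> polyfun {..<k} e"
      using polyfun_truncate[OF G_polyfun finite_lessThan, of i "{..<k}"] assms
      by (auto simp: trunc_def)
  qed (use g[OF that] in \<open>auto simp: form_def\<close>)
  moreover have "(e * t + 1) ^ card {..<k} < card K"
    using T K by (simp only: t_def mult.assoc card_lessThan)
  ultimately have "\<exists>c. (\<exists>b\<in>K. c b \<noteq> 0) \<and> (\<forall>x. (\<Sum>b\<in>K. c b * eval_poly (g b) (G (trunc k x))) = 0)"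
    by (intro polyfun_dependence[OF finite_lessThan K(1),
          where \<phi> = "\<lambda>b x. eval_poly (g b) (G (trunc k x))" and e = "e * t"])
  then obtain c where c: "\<exists>b\<in>K. c b \<noteq> 0"
    and dep: "\<And>x. (\<Sum>b\<in>K. c b * eval_poly (g b) (G (trunc k x))) = 0"
    by blast
  define f where "f = (\<Sum>b\<in>K. Poly_Mapping.single 0 (c b) * g b)"
  have eval_f: "eval_poly f z = (\<Sum>b\<in>K. c b * eval_poly (g b) z)" for z
    by (simp add: f_def eval_poly_sum eval_poly_mult eval_poly_const)
  have "form I (0 + t) f"
    unfolding f_def by (intro form_sum form_mult form_const g)
  then have "homogeneous I f"
    using homogeneous_iff_form by blast
  moreover have "\<exists>x. eval_poly f (G (trunc (Suc k) x)) \<noteq> 0"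
  proof (rule ccontr)
    assume "\<not> ?thesis"
    then have zero: "eval_poly f (G (trunc (Suc k) x)) = 0" for x by blast
    define d where "d = Min ((\<lambda>b. \<Sum>j<Suc k. b j) ` {b \<in> K. c b \<noteq> 0})"
    have fin: "finite {b \<in> K. c b \<noteq> 0}" "{b \<in> K. c b \<noteq> 0} \<noteq> {}"
      using K(1) c by auto
    have low: "d \<le> (\<Sum>j<Suc k. b j)" if "b \<in> K" "c b \<noteq> 0" for b
      unfolding d_def using fin that by (intro Min_le) auto
    have "d \<in> (\<lambda>b. \<Sum>j<Suc k. b j) ` {b \<in> K. c b \<noteq> 0}"
      unfolding d_def using fin by (intro Min_in) auto
    then obtain b0 where b0: "b0 \<in> K" "c b0 \<noteq> 0" "(\<Sum>j<Suc k. b0 j) = d"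
      by blast
    define c' where "c' b = (if (\<Sum>j<Suc k. b j) = d then c b else 0)" for b
    have "(\<Sum>b\<in>K. c' b * monom_fun {..<Suc k} b x) = 0" for x
    proof -
      \<comment> \<open>The dual coordinates along the ray through \<open>x\<close>.\<close>
      define \<phi> where "\<phi> p s = eval_poly (Y p) (G (\<lambda>j. s * trunc (Suc k) x j))" for p s
      have \<phi>_eq: "\<phi> p s = (\<Sum>i\<in>I. y p i * G (\<lambda>j. s * trunc (Suc k) x j) i)" for p s
        by (simp add: \<phi>_def Y_def eval_linear_form)
      have deriv: "(\<phi> p has_field_derivative
          (\<Sum>i\<in>I. y p i * (\<Sum>j<D. trunc (Suc k) x j * v (Suc j) i))) (at 0)" for p
        unfolding \<phi>_eq by (intro DERIV_sum DERIV_cmult G_deriv)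
      have \<phi>_0: "\<phi> p 0 = (if p = 0 then 1 else 0)" if "p \<le> D" for p
        using y that by (simp add: \<phi>_eq G_0)
      have "(\<Sum>i\<in>I. y (Suc q) i * (\<Sum>j<D. trunc (Suc k) x j * v (Suc j) i)) = x q" if q: "q < Suc k" for q
      proof -
        have "(\<Sum>i\<in>I. y (Suc q) i * (\<Sum>j<D. trunc (Suc k) x j * v (Suc j) i)) =
            (\<Sum>j<D. trunc (Suc k) x j * (\<Sum>i\<in>I. y (Suc q) i * v (Suc j) i))"
          unfolding sum_distrib_left
          by (subst sum.swap) (intro sum.cong refl, simp add: algebra_simps)
        also have "\<dots> = (\<Sum>j<D. if j = q then trunc (Suc k) x j else 0)"
          using y q assms by (intro sum.cong refl) auto
        also have "\<dots> = x q"
          using q assms by (simp add: trunc_def)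
        finally show ?thesis .
      qed
      then have \<phi>_deriv: "(\<phi> (Suc q) has_field_derivative x q) (at 0)" if "q < Suc k" for q
        using deriv[of "Suc q"] that by simp
      have "isCont (\<phi> 0) 0"
        using deriv by (rule DERIV_isCont)
      then have "(\<phi> 0 \<longlongrightarrow> 1) (at 0)"
        using \<phi>_0[of 0] by (simp add: isCont_def)
      moreover have "(\<Sum>b\<in>K. c b * (\<phi> 0 s ^ (t - (\<Sum>j<Suc k. b j)) * (\<Prod>j<Suc k. \<phi> (Suc j) s ^ b j))) = 0" for s
      proof -
        have eq: "(\<lambda>j. s * trunc (Suc k) x j) = trunc (Suc k) (\<lambda>j. s * x j)"
          by (auto simp: trunc_def)
        have "(\<Sum>b\<in>K. c b * (\<phi> 0 s ^ (t - (\<Sum>j<Suc k. b j)) * (\<Prod>j<Suc k. \<phi> (Suc j) s ^ b j))) =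
            eval_poly f (G (trunc (Suc k) (\<lambda>j. s * x j)))"
          unfolding eval_f g_def \<phi>_def eval_poly_mult eval_poly_power eval_poly_prod eq ..
        then show ?thesis using zero by simp
      qed
      moreover have "\<phi> (Suc j) 0 = 0 \<and> (\<phi> (Suc j) has_field_derivative x j) (at 0)" if "j < Suc k" for j
        using \<phi>_0[of "Suc j"] \<phi>_deriv[OF that] that assms by simp
      ultimately show ?thesis
        unfolding c'_def using low
        by (intro lowest_degree_limit[OF K(1), where u = "\<lambda>j. \<phi> (Suc j)" and w = "\<phi> 0" and x = x
              and n = "\<lambda>b. t - (\<Sum>j<Suc k. b j)" and c = c and d = d and m = "Suc k"])
    qed
    then have "c' b0 = 0"
      using b0(1) K(1) unfolding K_def
      by (intro monom_fun_independent[where J = "{..<Suc k}" and K = "{..<Suc k} \<rightarrow>\<^sub>E {..T}" and c = c'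
            and b = b0]) auto
    then show False
      using b0 by (simp add: c'_def)
  qed
  ultimately show ?thesis
    using dep eval_f by (intro exI[of _ f]) auto
qed

text \<open>
  The images of the coordinate subspaces; their closures for \<open>k = 0, \<dots>, D\<close> form the required chain.
\<close>

definition stratum :: "nat \<Rightarrow> ('i \<Rightarrow> complex) set set" where
  "stratum k = {cfun.span {G (trunc k x)} | x. G (trunc k x) \<noteq> 0}"

lemma stratum_subset: "stratum k \<subseteq> proj_space I"
  using G_coord line_in_proj_space by (auto simp: stratum_def)

lemma vanishes_stratum_iff:
  assumes f: "homogeneous I f"
  shows "vanishes f (stratum k) \<longleftrightarrow> (\<forall>x. G (trunc k x) \<noteq> 0 \<longrightarrow> eval_poly f (G (trunc k x)) = 0)"
  unfolding vanishes_def stratum_def using vanishes_on_line_iff[OF f] by blast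

lemma vanishes_closure:
  assumes f: "homogeneous I f" and E: "E \<subseteq> proj_space I" and "vanishes f E"
  shows "vanishes f (zariski_closure I E)"
proof -
  have "closedin (zariski I) (proj_zeros I {f})"
    using f closedin_zariski by blast
  moreover have "E \<subseteq> proj_zeros I {f}"
    using assms by (auto simp: proj_zeros_def vanishes_def)
  ultimately have "zariski_closure I E \<subseteq> proj_zeros I {f}"
    by (rule closure_of_minimal[rotated])
  then show ?thesis by (auto simp: proj_zeros_def vanishes_def)
qed

lemma stratum_mono: "k \<le> l \<Longrightarrow> stratum k \<subseteq> stratum l"
proof -
  assume "k \<le> l"
  then have "trunc k x = trunc l (trunc k x)" for x
    by (auto simp: trunc_def)
  then show ?thesis
    unfolding stratum_def by (intro Collect_mono) metis
qed

lemma stratum_closure_strict: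
  assumes "k < D"
  shows "zariski_closure I (stratum k) \<subset> zariski_closure I (stratum (Suc k))"
proof
  show "zariski_closure I (stratum k) \<subseteq> zariski_closure I (stratum (Suc k))"
    by (rule closure_of_mono) (simp add: stratum_mono)
  obtain f x where f: "homogeneous I f" "\<And>x. eval_poly f (G (trunc k x)) = 0"
    and x: "eval_poly f (G (trunc (Suc k) x)) \<noteq> 0"
    using separating_form[OF assms] by blast
  have triv: "trunc l (\<lambda>_. 0) = (\<lambda>_. 0)" for l
    by (simp add: trunc_def)
  have "G (trunc (Suc k) x) \<noteq> 0"
  proof
    assume G0: "G (trunc (Suc k) x) = 0"
    obtain t where t: "form I t f"
      using f homogeneous_iff_form by blast
    have "scale_fun 0 (v 0) = 0"
      by (simp add: scale_fun_def fun_eq_iff)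
    then have "eval_poly f (G (trunc (Suc k) x)) = 0 ^ t * eval_poly f (v 0)"
      using form_eval_scale[OF t, of 0 "v 0"] G0 by simp
    then show False
      using f(2)[of "\<lambda>_. 0"] x by (simp add: triv G_0)
  qed
  then have "\<not> vanishes f (stratum (Suc k))"
    using x vanishes_stratum_iff[OF f(1)] by blast
  then have "\<not> vanishes f (zariski_closure I (stratum (Suc k)))"
    using closure_of_subset[of "stratum (Suc k)" "zariski I"] stratum_subset
    by (auto simp: vanishes_def)
  moreover have "vanishes f (zariski_closure I (stratum k))"
    using f vanishes_stratum_iff stratum_subset by (intro vanishes_closure) auto
  ultimately show "zariski_closure I (stratum k) \<noteq> zariski_closure I (stratum (Suc k))"
    by metis
qed

lemma stratum_closure_irreducible:
  assumes W: "closedin (zariski I) W" and sub: "zariski_closure I (stratum k) \<subseteq> W" and "k \<le> D"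
  shows "irreducible_closedin (subtopology (zariski I) W) (zariski_closure I (stratum k))"
proof -
  let ?Z = "zariski_closure I (stratum k)"
  have EZ: "stratum k \<subseteq> ?Z"
    using stratum_subset by (simp add: closure_of_subset)
  have "\<exists>i. v 0 i \<noteq> 0"
  proof (rule ccontr)
    assume "\<not> ?thesis"
    then have "(\<Sum>j\<le>D. (if j = 0 then 1 else 0) * v j i) = 0" for i
      by (intro sum.neutral) auto
    then show False
      using independent_familyD[OF v_independent, of "\<lambda>j. if j = 0 then 1 else 0" 0] by simp
  qed
  then obtain i0 where i0: "v 0 i0 \<noteq> 0" by blast
  then have i0I: "i0 \<in> I"
    using v_coord[of 0] by (auto simp: coord_space_def)
  have triv: "trunc k (\<lambda>_. 0) = (\<lambda>_. 0)"
    by (simp add: trunc_def)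
  have "cfun.span {G (trunc k (\<lambda>_. 0))} \<in> stratum k"
    using i0 unfolding stratum_def by (intro CollectI exI[of _ "\<lambda>_. 0"]) (auto simp: triv G_0)
  then have ne: "?Z \<noteq> {}"
    using EZ by blast
  have cl: "closedin (subtopology (zariski I) W) ?Z"
    using sub by (simp add: closedin_closed_subtopology[OF W])
  have "?Z = A \<or> ?Z = B"
    if A: "closedin (subtopology (zariski I) W) A" and B: "closedin (subtopology (zariski I) W) B"
      and AB: "?Z = A \<union> B" for A B
  proof (rule ccontr)
    assume neq: "\<not> ?thesis"
    \<comment> \<open>A proper closed subset misses some parameter; a line through two such parameters
      contains one that is missed by \<open>A\<close> and \<open>B\<close> simultaneously.\<close>
    have escape: "\<exists>f x. homogeneous I f \<and> eval_poly f (G (trunc k x)) \<noteq> 0 \<and> vanishes f A'"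
      if A': "closedin (subtopology (zariski I) W) A'" "A' \<subseteq> ?Z" "A' \<noteq> ?Z" for A'
    proof -
      have closed: "closedin (zariski I) A'"
        using A'(1) by (simp add: closedin_closed_subtopology[OF W])
      then obtain F where F: "\<forall>f\<in>F. homogeneous I f" "A' = proj_zeros I F"
        using closedin_zariski by metis
      have "\<not> stratum k \<subseteq> A'"
        using closure_of_minimal[OF _ closed] A' by blast
      then obtain x where x: "G (trunc k x) \<noteq> 0" "cfun.span {G (trunc k x)} \<notin> A'"
        by (auto simp: stratum_def)
      then have "cfun.span {G (trunc k x)} \<in> proj_space I"
        using G_coord line_in_proj_space by blast
      then obtain f where f: "f \<in> F" "\<exists>z\<in>cfun.span {G (trunc k x)}. eval_poly f z \<noteq> 0"
        using x F by (auto simp: proj_zeros_def)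
      then have "eval_poly f (G (trunc k x)) \<noteq> 0"
        using vanishes_on_line_iff F(1) by blast
      moreover have "vanishes f A'"
        using f F by (auto simp: proj_zeros_def vanishes_def)
      ultimately show ?thesis using f F by blast
    qed
    obtain f x where f: "homogeneous I f" "eval_poly f (G (trunc k x)) \<noteq> 0" "vanishes f A"
      using escape[OF A] AB neq by auto
    obtain g y where g: "homogeneous I g" "eval_poly g (G (trunc k y)) \<noteq> 0" "vanishes g B"
      using escape[OF B] AB neq by auto
    \<comment> \<open>The coordinate \<open>i0\<close> keeps the parameter found on the line away from the zeros of \<open>G\<close>.\<close>
    obtain z where z: "eval_poly f (G (trunc k z)) \<noteq> 0" "eval_poly g (G (trunc k z)) \<noteq> 0"
      "G (trunc k z) i0 \<noteq> 0"
    proof -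
      have Gp: "(\<lambda>x. G (trunc k x) i) \<in> polyfun {..<k} e" if "i \<in> I" for i
        using polyfun_truncate[OF G_polyfun[OF that] finite_lessThan, of "{..<k}"] \<open>k \<le> D\<close>
        by (auto simp: trunc_def)
      have fp: "\<exists>d. (\<lambda>x. eval_poly h (G (trunc k x))) \<in> polyfun {..<k} d" if h: "homogeneous I h" for h
      proof -
        obtain t where "form I t h"
          using h homogeneous_iff_form by blast
        then have "(\<lambda>x. eval_poly h (G (trunc k x))) \<in> polyfun {..<k} (e * t)"
          using Gp by (intro polyfun_eval_poly[where I = I]) (auto simp: form_def)
        then show ?thesis ..
      qed
      obtain d1 d2 where d: "(\<lambda>x. eval_poly f (G (trunc k x))) \<in> polyfun {..<k} d1"
        "(\<lambda>x. eval_poly g (G (trunc k x))) \<in> polyfun {..<k} d2"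
        using fp f g by blast
      let ?f = "\<lambda>x. eval_poly f (G (trunc k x))" and ?g = "\<lambda>x. eval_poly g (G (trunc k x))"
        and ?h = "\<lambda>x. G (trunc k x) i0"
      have fg: "(\<lambda>x. ?f x * ?h x) \<in> polyfun {..<k} (d1 + e)"
        using polyfun_mult[OF d(1) Gp[OF i0I]] .
      obtain z1 where z1: "?f z1 \<noteq> 0" "?h z1 \<noteq> 0"
        using polyfun_zero_density[OF d(1) Gp[OF i0I], of "\<lambda>_. 0" x] f(2) i0 by (auto simp: triv G_0)
      then obtain z2 where "?g z2 \<noteq> 0" "?f z2 * ?h z2 \<noteq> 0"
        using polyfun_zero_density[OF d(2) fg, of z1 y] g(2) by auto
      then show ?thesis using that by auto
    qed
    then have "G (trunc k z) \<noteq> 0" by auto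
    then have "cfun.span {G (trunc k z)} \<in> A \<union> B"
      using EZ AB by (auto simp: stratum_def)
    moreover have "G (trunc k z) \<in> cfun.span {G (trunc k z)}"
      by (simp add: cfun.span_base)
    ultimately show False
      using z f(3) g(3) by (auto simp: vanishes_def)
  qed
  then show ?thesis
    using ne cl by (simp add: irreducible_closedin_def)
qed

theorem proj_dim_closure_ge:
  assumes Y: "\<And>x. G x \<noteq> 0 \<Longrightarrow> cfun.span {G x} \<in> Y"
  shows "ereal (real D) \<le> proj_dim I (zariski_closure I Y)"
proof -
  let ?Z = "\<lambda>k. zariski_closure I (stratum k)" and ?W = "zariski_closure I Y"
  have strict: "?Z k \<subset> ?Z l" if "k < l" "l \<le> D" for k l
    using that
  proof (induction l)
    case (Suc l)
    then show ?case
      using stratum_closure_strict[of l] by (cases "k = l") auto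
  qed simp
  have "inj_on ?Z {..D}"
    by (rule linorder_inj_onI) (use strict in force)+
  then have card: "card (?Z ` {..D}) = Suc D"
    by (simp add: card_image)
  have mono: "?Z k \<subseteq> ?Z l \<or> ?Z l \<subseteq> ?Z k" for k l
    using stratum_mono[of k l] stratum_mono[of l k] closure_of_mono by (metis nle_le)
  have "stratum k \<subseteq> Y" for k
    using Y by (auto simp: stratum_def)
  then have "?Z k \<subseteq> ?W" for k
    by (rule closure_of_mono)
  then have "irreducible_closedin (subtopology (zariski I) ?W) (?Z k)" if "k \<le> D" for k
    using that by (intro stratum_closure_irreducible) auto
  then have "?Z ` {..D} \<in> {C. finite C \<and>
      (\<forall>Z\<in>C. irreducible_closedin (subtopology (zariski I) ?W) Z) \<and> chain\<^sub>\<subseteq> C}"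
    using mono by (auto simp: chain_subset_def)
  from SUP_upper[OF this, of "\<lambda>C. ereal (real (card C) - 1)"] show ?thesis
    unfolding proj_dim_def krull_dim_def card by simp
qed

end

section \<open>Wedge products\<close>

definition enum :: "nat set \<Rightarrow> nat \<Rightarrow> nat" where
  "enum S j = sorted_list_of_set S ! j"

lemma enum_bij:
  assumes "S \<in> plucker_index r n"
  shows "bij_betw (enum S) {..r} S"
proof -
  have S: "finite S" "card S = r + 1"
    using assms finite_subset[of S "{..n}"] by (auto simp: plucker_index_def)
  then have "bij_betw (\<lambda>j. sorted_list_of_set S ! j) {..<length (sorted_list_of_set S)} (set (sorted_list_of_set S))"
    by (intro bij_betw_nth) auto
  then show ?thesis
    using S by (simp add: enum_def[abs_def] lessThan_Suc_atMost)
qed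

lemma enum_le: "S \<in> plucker_index r n \<Longrightarrow> j \<le> r \<Longrightarrow> enum S j \<le> n"
  using bij_betwE[OF enum_bij, of S r n] by (auto simp: plucker_index_def)

definition minor :: "nat \<Rightarrow> (nat \<Rightarrow> nat \<Rightarrow> complex) \<Rightarrow> nat set \<Rightarrow> complex mat" where
  "minor r w S = mat (r + 1) (r + 1) (\<lambda>(i, j). w i (enum S j))"

lemma minor_carrier: "minor r w S \<in> carrier_mat (r + 1) (r + 1)"
  by (simp add: minor_def)

lemma permutes_atMost: "p permutes {..r} \<Longrightarrow> i \<le> r \<Longrightarrow> p i \<le> (r :: nat)"
  using permutes_in_image[of p "{..r}" i] by simp

lemma wedge_eq_det: "S \<in> plucker_index r n \<Longrightarrow> wedge r n w S = det (minor r w S)"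
  by (simp add: wedge_def minor_def enum_def)

lemma wedge_coord: "wedge r n w \<in> coord_space (plucker_index r n)"
  by (simp add: coord_space_def wedge_def)

lemma finite_plucker_index: "finite (plucker_index r n)"
  unfolding plucker_index_def by (rule finite_subset[of _ "Pow {..n}"]) auto

lemma wedge_leibniz:
  assumes "S \<in> plucker_index r n"
  shows "wedge r n w S =
    (\<Sum>p\<in>{p. p permutes {..r}}. signof p * (\<Prod>i\<le>r. w i (enum S (p i))))"
proof -
  have eq: "{0..<r + 1} = {..r}" by auto
  show ?thesis
    unfolding wedge_eq_det[OF assms] det_def'[OF minor_carrier] eq
    by (intro sum.cong prod.cong arg_cong2[of _ _ _ _ "(*)"] refl)
       (auto simp: minor_def less_Suc_eq_le permutes_atMost)
qed

lemma wedge_cong: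
  assumes "\<And>i c. i \<le> r \<Longrightarrow> c \<le> n \<Longrightarrow> w i c = w' i c"
  shows "wedge r n w = wedge r n w'"
proof
  fix S
  show "wedge r n w S = wedge r n w' S"
  proof (cases "S \<in> plucker_index r n")
    case True
    show ?thesis
      using assms enum_le[OF True] by (simp add: wedge_leibniz[OF True] permutes_atMost)
  qed (simp add: wedge_def)
qed

lemma wedge_row:
  assumes "S \<in> plucker_index r n" "a \<le> r"
  shows "wedge r n (w(a := u)) S = (\<Sum>p\<in>{p. p permutes {..r}}.
    signof p * (u (enum S (p a)) * (\<Prod>i\<in>{..r} - {a}. w i (enum S (p i)))))"
  unfolding wedge_leibniz[OF assms(1)]
proof (intro sum.cong refl arg_cong2[of _ _ _ _ "(*)"])
  fix p
  have "(\<Prod>i\<le>r. (w(a := u)) i (enum S (p i))) =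
      (w(a := u)) a (enum S (p a)) * (\<Prod>i\<in>{..r} - {a}. (w(a := u)) i (enum S (p i)))"
    using assms(2) by (intro prod.remove) auto
  then show "(\<Prod>i\<le>r. (w(a := u)) i (enum S (p i))) =
      u (enum S (p a)) * (\<Prod>i\<in>{..r} - {a}. w i (enum S (p i)))"
    by simp
qed

lemma wedge_row_sum:
  assumes "a \<le> r"
  shows "wedge r n (w(a := (\<lambda>c. \<Sum>k\<in>K. x k * u k c))) S = (\<Sum>k\<in>K. x k * wedge r n (w(a := u k)) S)"
proof (cases "S \<in> plucker_index r n")
  case True
  show ?thesis
    unfolding wedge_row[OF True assms] sum_distrib_left sum_distrib_right
    by (subst sum.swap) (intro sum.cong refl, simp add: algebra_simps)
qed (simp add: wedge_def)

lemma wedge_row_scale: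
  assumes "a \<le> r"
  shows "wedge r n (w(a := (\<lambda>c. x * w a c))) = scale_fun x (wedge r n w)"
proof
  fix S
  show "wedge r n (w(a := (\<lambda>c. x * w a c))) S = scale_fun x (wedge r n w) S"
    using wedge_row_sum[OF assms, of n w "\<lambda>_. x" "\<lambda>_. w a" "{0 :: nat}"]
    by (simp add: scale_fun_def)
qed

lemma wedge_basis_change:
  shows "wedge r n (\<lambda>i c. \<Sum>j\<le>r. g i j * u j c) =
    scale_fun (det (mat (r + 1) (r + 1) (\<lambda>(i, j). g i j))) (wedge r n u)"
proof
  fix S
  let ?g = "mat (r + 1) (r + 1) (\<lambda>(i, j). g i j)"
  show "wedge r n (\<lambda>i c. \<Sum>j\<le>r. g i j * u j c) S = scale_fun (det ?g) (wedge r n u) S"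
  proof (cases "S \<in> plucker_index r n")
    case True
    have "minor r (\<lambda>i c. \<Sum>j\<le>r. g i j * u j c) S = ?g * minor r u S"
      by (rule eq_matI)
         (auto simp: minor_def scalar_prod_def lessThan_Suc_atMost atLeast0LessThan intro!: sum.cong)
    then have "det (minor r (\<lambda>i c. \<Sum>j\<le>r. g i j * u j c) S) = det ?g * det (minor r u S)"
      using det_mult[OF _ minor_carrier, of ?g] by simp
    then show ?thesis
      by (simp add: wedge_eq_det[OF True] scale_fun_def)
  qed (simp add: wedge_def scale_fun_def)
qed

lemma wedge_polyfun:
  assumes "\<And>i c. i \<le> r \<Longrightarrow> c \<le> n \<Longrightarrow> (\<lambda>x. w x i c) \<in> polyfun J 1"
  shows "(\<lambda>x. wedge r n (w x) S) \<in> polyfun J (r + 1)"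
proof (cases "S \<in> plucker_index r n")
  case True
  have "(\<lambda>x. signof p * (\<Prod>i\<le>r. w x i (enum S (p i)))) \<in> polyfun J (r + 1)" if p: "p permutes {..r}" for p
  proof -
    have "(\<lambda>x. w x i (enum S (p i))) \<in> polyfun J 1" if "i \<le> r" for i
      using assms[OF that enum_le[OF True permutes_atMost[OF p that]]] by simp
    then have "(\<lambda>x. \<Prod>i\<le>r. w x i (enum S (p i))) \<in> polyfun J (\<Sum>i\<le>r. 1)"
      by (intro polyfun_prod) auto
    then show ?thesis
      using polyfun_mult[OF polyfun_const[of _ J 0]] by fastforce
  qed
  then show ?thesis
    unfolding wedge_leibniz[OF True] by (intro polyfun_sum) auto
qed (simp add: wedge_def polyfun_const)

text \<open>The derivative of the wedge product at \<open>w\<close> in direction \<open>m\<close>, by the product rule.\<close>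

definition dwedge :: "nat \<Rightarrow> nat \<Rightarrow> (nat \<Rightarrow> nat \<Rightarrow> complex) \<Rightarrow> (nat \<Rightarrow> nat \<Rightarrow> complex) \<Rightarrow> nat set \<Rightarrow> complex" where
  "dwedge r n w m = (\<lambda>S. \<Sum>a\<le>r. wedge r n (w(a := m a)) S)"

lemma dwedge_coord: "dwedge r n w m \<in> coord_space (plucker_index r n)"
  by (simp add: coord_space_def dwedge_def wedge_def)

lemma dwedge_sum:
  "dwedge r n w (\<lambda>a c. \<Sum>k\<in>K. x k * m k a c) S = (\<Sum>k\<in>K. x k * dwedge r n w (m k) S)"
  unfolding dwedge_def sum_distrib_left
  by (subst sum.swap) (intro sum.cong refl, simp add: wedge_row_sum)

lemma has_field_derivative_wedge:
  "((\<lambda>s. wedge r n (\<lambda>i c. w i c + s * m i c) S) has_field_derivative dwedge r n w m S) (at 0)"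
proof (cases "S \<in> plucker_index r n")
  case True
  have "((\<lambda>s. wedge r n (\<lambda>i c. w i c + s * m i c) S) has_field_derivative
    (\<Sum>p\<in>{p. p permutes {..r}}. signof p * (\<Sum>a\<le>r. m a (enum S (p a)) *
      (\<Prod>i\<in>{..r} - {a}. w i (enum S (p i)) + 0 * m i (enum S (p i)))))) (at 0)"
    unfolding wedge_leibniz[OF True]
    by (intro DERIV_sum DERIV_cmult has_field_derivative_prod) (auto intro!: derivative_eq_intros)
  also have "(\<Sum>p\<in>{p. p permutes {..r}}. signof p * (\<Sum>a\<le>r. m a (enum S (p a)) *
      (\<Prod>i\<in>{..r} - {a}. w i (enum S (p i)) + 0 * m i (enum S (p i))))) = dwedge r n w m S"
    unfolding dwedge_def sum_distrib_left
    by (subst sum.swap) (intro sum.cong refl, simp add: wedge_row[OF True])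
  finally show ?thesis .
qed (simp add: wedge_def dwedge_def)

text \<open>
  At any other index set than the image of \<open>f\<close>, some row of the minor is zero; at the image, the
  minor is a permutation matrix \<open>P\<close>, whose determinant is nonzero because \<open>P P\<^sup>T = 1\<close>.
\<close>

lemma wedge_unit_fun:
  assumes f: "inj_on f {..r}" "f ` {..r} \<subseteq> {..n}"
  shows "\<exists>c. c \<noteq> 0 \<and> wedge r n (\<lambda>i. unit_fun (f i)) = scale_fun c (unit_fun (f ` {..r}))"
proof -
  let ?T = "f ` {..r}" and ?w = "\<lambda>i. unit_fun (f i)"
  have T: "?T \<in> plucker_index r n"
    using f by (simp add: plucker_index_def card_image)
  define P where "P = minor r ?w ?T"
  have P: "P \<in> carrier_mat (r + 1) (r + 1)"
    by (simp only: P_def minor_carrier)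
  have "P * transpose_mat P = 1\<^sub>m (r + 1)"
  proof (rule eq_matI)
    fix i j assume "i < dim_row (1\<^sub>m (r + 1) :: complex mat)" "j < dim_col (1\<^sub>m (r + 1) :: complex mat)"
    then have ij: "i \<le> r" "j \<le> r" by auto
    have "(P * transpose_mat P) $$ (i, j) = (\<Sum>k\<le>r. unit_fun (f i) (enum ?T k) * unit_fun (f j) (enum ?T k))"
      using ij by (simp add: P_def minor_def scalar_prod_def atLeast0LessThan lessThan_Suc_atMost)
    also have "\<dots> = (\<Sum>t\<in>?T. unit_fun (f i) t * unit_fun (f j) t)"
      using sum.reindex_bij_betw[OF enum_bij[OF T], of "\<lambda>t. unit_fun (f i) t * unit_fun (f j) t"] .
    also have "\<dots> = (\<Sum>t\<in>?T. if t = f i then (if f i = f j then 1 else 0) else 0)"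
      by (intro sum.cong) (auto simp: unit_fun_def)
    also have "\<dots> = (if f i = f j then 1 else 0)"
      using ij by (simp add: sum.delta)
    also have "\<dots> = 1\<^sub>m (r + 1) $$ (i, j)"
      using ij f(1) by (auto simp: inj_on_eq_iff)
    finally show "(P * transpose_mat P) $$ (i, j) = 1\<^sub>m (r + 1) $$ (i, j)" .
  qed (use P in auto)
  then have "det P * det (transpose_mat P) = 1"
    using P by (simp add: det_mult[OF P, symmetric])
  then have nz: "det P \<noteq> 0" by auto
  have "wedge r n ?w S = scale_fun (det P) (unit_fun ?T) S" for S
  proof (cases "S \<in> plucker_index r n")
    case True
    show ?thesis
    proof (cases "S = ?T")
      case True
      then show ?thesis
        using T by (simp add: wedge_eq_det P_def scale_fun_def unit_fun_def)
    next
      case False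
      have "finite S" "card S = card ?T"
        using True T finite_subset[of S "{..n}"] by (auto simp: plucker_index_def)
      then have "\<not> ?T \<subseteq> S"
        using False card_subset_eq[of S ?T] by auto
      then obtain i where i: "i \<le> r" "f i \<notin> S" by auto
      have "(\<Prod>k\<le>r. ?w k (enum S (p k))) = 0" if p: "p permutes {..r}" for p
      proof -
        have "enum S (p i) \<in> S"
          using bij_betwE[OF enum_bij[OF True]] permutes_in_image[OF p, of i] i by simp
        then show ?thesis
          using i by (intro prod_zero) (auto simp: unit_fun_def intro!: bexI[of _ i])
      qed
      then have "wedge r n ?w S = 0"
        unfolding wedge_leibniz[OF True] by (intro sum.neutral) simp
      then show ?thesis
        using False by (simp add: scale_fun_def unit_fun_def)
    qed
  next
    case False
    then have "S \<noteq> ?T" using T by blast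
    then show ?thesis using False by (simp add: wedge_def scale_fun_def unit_fun_def)
  qed
  then show ?thesis using nz by blast
qed

section \<open>The Grassmannian and its dimension\<close>

lemma coord_space_subspace: "cfun.subspace (coord_space I)"
  by (auto simp: cfun.subspace_def coord_space_def scale_fun_def)

lemma unit_fun_independent:
  assumes "finite I"
  shows "cfun.independent (unit_fun ` I)" "inj_on unit_fun I"
proof -
  have "independent_family I unit_fun"
    unfolding independent_family_def
  proof (intro allI impI ballI)
    fix c k assume c: "\<forall>i. (\<Sum>k\<in>I. c k * unit_fun k i) = 0" and k: "k \<in> I"
    have "(\<Sum>l\<in>I. c l * unit_fun l k) = (\<Sum>l\<in>I. if l = k then c l else 0)"
      by (intro sum.cong) (auto simp: unit_fun_def)
    then show "c k = 0"
      using c k assms by simp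
  qed
  then show "cfun.independent (unit_fun ` I)" "inj_on unit_fun I"
    using independent_family_iff[OF assms] by auto
qed

lemma coord_space_span:
  assumes "finite I"
  shows "coord_space I = cfun.span (unit_fun ` I)"
proof
  show "coord_space I \<subseteq> cfun.span (unit_fun ` I)"
  proof
    fix x assume "x \<in> coord_space I"
    then have "x = (\<Sum>i\<in>I. scale_fun (x i) (unit_fun i))"
      by (rule coord_space_expand[OF assms])
    then show "x \<in> cfun.span (unit_fun ` I)"
      by (metis (no_types, lifting) cfun.span_base cfun.span_scale cfun.span_sum imageI)
  qed
  have "unit_fun ` I \<subseteq> coord_space I"
    by (auto simp: unit_fun_def coord_space_def)
  then show "cfun.span (unit_fun ` I) \<subseteq> coord_space I"
    by (intro cfun.span_minimal coord_space_subspace)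
qed

lemma linear_subspace_containing:
  assumes "r \<le> n" and w: "\<And>i. i \<le> r \<Longrightarrow> w i \<in> coord_space {..n}"
  shows "\<exists>W\<in>linear_subspaces r n. \<forall>i\<le>r. w i \<in> W"
proof -
  obtain B where B: "B \<subseteq> w ` {..r}" "cfun.independent B" "w ` {..r} \<subseteq> cfun.span B"
    using cfun.maximal_independent_subset by blast
  have "finite B" "card B \<le> r + 1"
    using B(1) finite_subset surj_card_le[of "{..r}" B w] by auto
  have "B \<subseteq> coord_space {..n}"
    using B(1) w by auto
  then obtain C where C: "B \<subseteq> C" "C \<subseteq> coord_space {..n}" "cfun.independent C" "coord_space {..n} \<subseteq> cfun.span C"
    using cfun.maximal_independent_subset_extend B(2) by metis
  have "finite C"
    using cfun.independent_span_bound[of "unit_fun ` {..n}" C] C by (simp add: coord_space_span)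
  have "card (unit_fun ` {..n}) \<le> card C"
    using cfun.independent_span_bound[OF \<open>finite C\<close> unit_fun_independent(1), of "{..n}"] C(4)
      cfun.span_superset[of "unit_fun ` {..n}"] by (simp add: coord_space_span)
  then have "n + 1 \<le> card C"
    by (simp add: card_image unit_fun_independent(2))
  then obtain D where D: "B \<subseteq> D" "D \<subseteq> C" "card D = r + 1"
    using exists_subset_between[of B "r + 1" C] \<open>card B \<le> r + 1\<close> \<open>finite C\<close> C(1) assms(1) by auto
  have "cfun.dim (cfun.span D) = r + 1"
    using D cfun.dim_span_eq_card_independent[OF cfun.independent_mono[OF C(3) D(2)]] by simp
  moreover have "cfun.span D \<subseteq> coord_space {..n}"
    using D C by (intro cfun.span_minimal coord_space_subspace) auto
  moreover have "w i \<in> cfun.span D" if "i \<le> r" for i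
    using B(3) cfun.span_mono[OF D(1)] that by auto
  ultimately show ?thesis
    by (auto simp: linear_subspaces_def cfun.subspace_span)
qed

text \<open>
  The span defining the image of \<open>W\<close> is at most a line, because expressing vectors of \<open>W\<close> in a
  basis \<open>u\<close> scales the wedge product of \<open>u\<close> by a determinant.
\<close>

lemma plucker_line:
  assumes W: "W \<in> linear_subspaces r n"
  obtains u where "\<And>i. i \<le> r \<Longrightarrow> u i \<in> W" "plucker r n W \<subseteq> range (\<lambda>c. scale_fun c (wedge r n u))"
proof -
  obtain B where B: "B \<subseteq> W" "cfun.independent B" "W \<subseteq> cfun.span B" "card B = r + 1"
    using cfun.basis_exists[of W] W by (auto simp: linear_subspaces_def)
  then have "finite B"
    by (metis Suc_eq_plus1 card.infinite nat.distinct(1))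
  then obtain u where u: "bij_betw u {0..<r + 1} B"
    using ex_bij_betw_nat_finite[of B] B(4) by auto
  then have u: "bij_betw u {..r} B"
    by (simp add: atLeast0LessThan lessThan_Suc_atMost)
  have "wedge r n w \<in> range (\<lambda>c. scale_fun c (wedge r n u))" if w: "\<forall>i\<le>r. w i \<in> W" for w
  proof -
    have "\<exists>g. w i = (\<Sum>j\<le>r. scale_fun (g j) (u j))" if "i \<le> r" for i
    proof -
      have "w i \<in> cfun.span B" using w B(3) that by auto
      then obtain h where "w i = (\<Sum>v\<in>B. scale_fun (h v) v)"
        using cfun.span_finite[OF \<open>finite B\<close>] by auto
      then show ?thesis
        using sum.reindex_bij_betw[OF u, of "\<lambda>v. scale_fun (h v) v"]
        by (intro exI[of _ "\<lambda>j. h (u j)"]) simp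
    qed
    then obtain g where g: "\<And>i. i \<le> r \<Longrightarrow> w i = (\<Sum>j\<le>r. scale_fun (g i j) (u j))"
      by metis
    then have "wedge r n w = wedge r n (\<lambda>i c. \<Sum>j\<le>r. g i j * u j c)"
      by (intro wedge_cong) (simp add: sum_apply scale_fun_def)
    then show ?thesis
      unfolding wedge_basis_change by blast
  qed
  then have "plucker r n W \<subseteq> range (\<lambda>c. scale_fun c (wedge r n u))"
    unfolding plucker_def span_singleton[symmetric]
    by (intro cfun.span_minimal) (auto simp: cfun.subspace_span)
  moreover have "u i \<in> W" if "i \<le> r" for i
    using u B(1) that by (auto simp: bij_betw_def)
  ultimately show ?thesis using that by blast
qed

text \<open>So every vector of the cone over the Grassmannian is decomposable: scale one row.\<close>

lemma grassmannian_point: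
  assumes "L \<in> grassmannian r n" "x \<in> L"
  obtains w where "x = wedge r n w"
proof -
  obtain W where W: "W \<in> linear_subspaces r n" "L = plucker r n W"
    using assms by (auto simp: grassmannian_def)
  obtain u where "plucker r n W \<subseteq> range (\<lambda>c. scale_fun c (wedge r n u))"
    using plucker_line[OF W(1)] by blast
  then obtain c where "x = scale_fun c (wedge r n u)"
    using assms(2) W(2) by blast
  then show ?thesis
    using that[of "u(0 := (\<lambda>k. c * u 0 k))"] by (simp only: wedge_row_scale le0)
qed

text \<open>
  Conversely.  The rows of \<open>w\<close> may be dependent: any subspace of the right dimension that contains
  them will do.
\<close>

lemma wedge_on_grassmannian:
  assumes "r \<le> n"
  shows "\<exists>L\<in>grassmannian r n. wedge r n w \<in> L"
proof -
  define w' where "w' i c = (if c \<le> n then w i c else 0)" for i c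
  have eq: "wedge r n w = wedge r n w'"
    by (rule wedge_cong) (simp add: w'_def)
  have "w' i \<in> coord_space {..n}" for i
    by (simp add: coord_space_def w'_def)
  then obtain W where W: "W \<in> linear_subspaces r n" "\<forall>i\<le>r. w' i \<in> W"
    using linear_subspace_containing[OF assms, of w'] by blast
  then have "wedge r n w' \<in> plucker r n W"
    unfolding plucker_def by (intro cfun.span_base) blast
  then show ?thesis
    using W(1) eq by (auto simp: grassmannian_def)
qed

definition chart :: "nat \<Rightarrow> nat \<Rightarrow> (nat \<times> nat \<Rightarrow> complex) \<Rightarrow> nat \<Rightarrow> nat \<Rightarrow> complex" where
  "chart r n y = (\<lambda>i c. if c \<le> r then (if c = i then 1 else 0) else y (i, c))"

text \<open>
  If the first minor of \<open>w\<close> is nonzero, multiplication by the inverse of that block brings \<open>w\<close>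
  into the form \<open>[1 | y]\<close>; such \<open>w\<close> are dense.
\<close>

lemma vanishes_grassmannian:
  assumes "r \<le> n" and f: "homogeneous (plucker_index r n) f"
    and chart0: "\<And>y. eval_poly f (wedge r n (chart r n y)) = 0"
  shows "vanishes f (grassmannian r n)"
  unfolding vanishes_def
proof (intro ballI)
  fix L x assume "L \<in> grassmannian r n" "x \<in> L"
  then obtain w where x: "x = wedge r n w"
    by (rule grassmannian_point)
  let ?J = "{..r} \<times> {..n}"
  let ?g = "\<lambda>z :: nat \<times> nat \<Rightarrow> complex. det (mat (r + 1) (r + 1) (\<lambda>(i, j). z (i, j)))"
  obtain t where t: "form (plucker_index r n) t f"
    using f homogeneous_iff_form by blast
  have var: "(\<lambda>z. z (i, c)) \<in> polyfun ?J 1" if "i \<le> r" "c \<le> n" for i c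
    using that by (intro polyfun_var) auto
  have wedge_poly: "(\<lambda>z. wedge r n (\<lambda>i c. z (i, c)) S) \<in> polyfun ?J (r + 1)" for S
    by (rule wedge_polyfun[where w = "\<lambda>z i c. z (i, c)"]) (rule var)
  have P: "(\<lambda>z. eval_poly f (wedge r n (\<lambda>i c. z (i, c)))) \<in> polyfun ?J ((r + 1) * t)"
    by (rule polyfun_eval_poly[where I = "plucker_index r n" and G = "\<lambda>z. wedge r n (\<lambda>i c. z (i, c))"])
       (use t wedge_poly in \<open>simp_all add: form_def\<close>)
  have T: "{..r} \<in> plucker_index r n"
    using assms(1) by (auto simp: plucker_index_def)
  have "enum {..r} j = j" if "j \<le> r" for j
  proof -
    have "sorted_list_of_set {..r} = [0..<Suc r]"
      by (metis atLeast0AtMost atLeastLessThanSuc_atLeastAtMost sorted_list_of_set_range)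
    then show ?thesis
      using that by (simp add: enum_def del: upt_Suc)
  qed
  then have g_wedge: "?g z = wedge r n (\<lambda>i c. z (i, c)) {..r}" for z
    unfolding wedge_eq_det[OF T] by (intro arg_cong[of _ _ det] eq_matI) (auto simp: minor_def)
  have g: "?g \<in> polyfun ?J (r + 1)"
    unfolding g_wedge by (rule wedge_poly)
  have one: "?g (\<lambda>(i, c). if i = c then 1 else 0) = 1"
  proof -
    have "mat (r + 1) (r + 1) (\<lambda>(i, j). if i = j then 1 else 0 :: complex) = 1\<^sub>m (r + 1)"
      by (rule eq_matI) auto
    then show ?thesis by (simp only: prod.case det_one)
  qed
  have zero: "eval_poly f (wedge r n (\<lambda>i c. z (i, c))) = 0" if gz: "?g z \<noteq> 0" for z
  proof -
    let ?A = "mat (r + 1) (r + 1) (\<lambda>(i, j). z (i, j))"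
    have A: "?A \<in> carrier_mat (r + 1) (r + 1)" by simp
    have "?A \<in> Units (ring_mat TYPE(complex) (r + 1) ())"
      using det_non_zero_imp_unit[OF A gz] by simp
    then obtain B where B: "B \<in> carrier_mat (r + 1) (r + 1)" "B * ?A = 1\<^sub>m (r + 1)" "?A * B = 1\<^sub>m (r + 1)"
      by (auto simp: Units_def ring_mat_def)
    \<comment> \<open>The right-hand block of \<open>B\<close> times \<open>z\<close>.\<close>
    define y where "y = (\<lambda>(i, c). \<Sum>j\<le>r. B $$ (i, j) * z (j, c))"
    have AB: "(\<Sum>k\<le>r. z (i, k) * B $$ (k, j)) = (if i = j then 1 else 0)" if "i \<le> r" "j \<le> r" for i j
    proof -
      have "(?A * B) $$ (i, j) = (\<Sum>k\<le>r. z (i, k) * B $$ (k, j))"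
        using that B(1) by (simp add: scalar_prod_def atLeast0LessThan lessThan_Suc_atMost)
      then show ?thesis using that unfolding B(3) by auto
    qed
    have "(\<Sum>j\<le>r. z (i, j) * chart r n y j c) = z (i, c)" if "i \<le> r" "c \<le> n" for i c
    proof (cases "c \<le> r")
      case True
      have "(\<Sum>j\<le>r. z (i, j) * chart r n y j c) = (\<Sum>j\<le>r. if j = c then z (i, j) else 0)"
        using True by (intro sum.cong) (auto simp: chart_def)
      then show ?thesis using True by simp
    next
      case False
      have "(\<Sum>j\<le>r. z (i, j) * chart r n y j c) = (\<Sum>j\<le>r. \<Sum>k\<le>r. z (i, j) * B $$ (j, k) * z (k, c))"
        using False by (simp add: chart_def y_def sum_distrib_left mult.assoc)
      also have "\<dots> = (\<Sum>k\<le>r. (\<Sum>j\<le>r. z (i, j) * B $$ (j, k)) * z (k, c))"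
        by (subst sum.swap) (simp add: sum_distrib_right)
      also have "\<dots> = (\<Sum>k\<le>r. if k = i then z (k, c) else 0)"
        using that by (intro sum.cong) (auto simp: AB)
      finally show ?thesis using that by simp
    qed
    then have "wedge r n (\<lambda>i c. z (i, c)) = wedge r n (\<lambda>i c. \<Sum>j\<le>r. z (i, j) * chart r n y j c)"
      by (intro wedge_cong) simp
    also have "\<dots> = scale_fun (?g z) (wedge r n (chart r n y))"
      using wedge_basis_change[of r n "\<lambda>i j. z (i, j)" "chart r n y"] by simp
    finally show ?thesis
      using form_eval_scale[OF t] chart0 by simp
  qed
  have "?g (\<lambda>(i, c). if i = c then 1 else 0) \<noteq> 0"
    unfolding one by simp
  then have "eval_poly f (wedge r n (\<lambda>i c. (\<lambda>(i, c). w i c) (i, c))) = 0"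
    by (rule polyfun_zero_density[OF P g]) (rule zero)
  then show "eval_poly f x = 0"
    by (simp add: x)
qed

lemma proj_dim_grassmannian_le:
  assumes "r \<le> n"
  shows "proj_dim (plucker_index r n) (grassmannian r n) \<le> ereal (real ((r + 1) * (n - r)))"
proof -
  let ?J = "{..r} \<times> {r<..n}"
  have "(\<lambda>y. wedge r n (chart r n y) S) \<in> polyfun ?J (r + 1)" for S
  proof (rule wedge_polyfun[where w = "chart r n"])
    fix i c assume "i \<le> r" "c \<le> n"
    show "(\<lambda>y. chart r n y i c) \<in> polyfun ?J 1"
    proof (cases "c \<le> r")
      case True
      then show ?thesis by (simp add: chart_def polyfun_const)
    next
      case False
      then have "(\<lambda>y. y (i, c)) \<in> polyfun ?J 1"
        using \<open>i \<le> r\<close> \<open>c \<le> n\<close> by (intro polyfun_var) auto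
      then show ?thesis using False by (simp add: chart_def)
    qed
  qed
  then have "proj_dim (plucker_index r n) (grassmannian r n) \<le> ereal (real (card ?J))"
    using finite_plucker_index vanishes_grassmannian[OF assms]
    by (intro proj_dim_le[where G = "\<lambda>y. wedge r n (chart r n y)" and e = "r + 1"]) simp_all
  then show ?thesis by (simp add: card_cartesian_product)
qed

section \<open>Secant varieties of Grassmannians\<close>

definition secant_union :: "nat \<Rightarrow> (('i \<Rightarrow> complex) set set) \<Rightarrow> ('i \<Rightarrow> complex) set set" where
  "secant_union h X =
     (\<Union>A \<in> {A. A \<subseteq> X \<and> finite A \<and> card A = h}. projectivization (cfun.span (\<Union>A)))"

lemma secant_variety_eq: "secant_variety I h X = zariski_closure I (secant_union h X)"
  by (simp add: secant_variety_def secant_union_def)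

text \<open>
  A secant variety uses exactly \<open>h\<close> distinct points; the coordinate points provide enough of them.
\<close>

lemma grassmannian_many_points:
  assumes "r \<le> n"
  shows "\<exists>A. A \<subseteq> grassmannian r n \<and> finite A \<and> card A = card (plucker_index r n)"
proof -
  let ?I = "plucker_index r n"
  have "\<exists>L\<in>grassmannian r n. unit_fun S \<in> L" if S: "S \<in> ?I" for S
  proof -
    have bij: "bij_betw (enum S) {..r} S"
      using S by (rule enum_bij)
    then have inj: "inj_on (enum S) {..r}" and im: "enum S ` {..r} = S"
      by (auto simp: bij_betw_def)
    have "S \<subseteq> {..n}"
      using S by (auto simp: plucker_index_def)
    then obtain c where c: "c \<noteq> 0" "wedge r n (\<lambda>i. unit_fun (enum S i)) = scale_fun c (unit_fun S)"
      using wedge_unit_fun[OF inj, of n] unfolding im by blast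
    let ?w = "\<lambda>i. unit_fun (enum S i)"
    have "wedge r n (?w(0 := (\<lambda>k. inverse c * ?w 0 k))) = scale_fun (inverse c) (scale_fun c (unit_fun S))"
      unfolding c(2)[symmetric] by (rule wedge_row_scale) simp
    also have "\<dots> = unit_fun S"
      using c(1) by (simp add: scale_fun_def mult.assoc[symmetric])
    finally show ?thesis
      using wedge_on_grassmannian[OF assms, of "?w(0 := (\<lambda>k. inverse c * ?w 0 k))"] by simp
  qed
  then have "\<forall>S\<in>?I. \<exists>L. L \<in> grassmannian r n \<and> unit_fun S \<in> L"
    by blast
  from bchoice[OF this] obtain L where
    L: "\<And>S. S \<in> ?I \<Longrightarrow> L S \<in> grassmannian r n \<and> unit_fun S \<in> L S"
    by blast
  have "inj_on L ?I"
  proof (rule inj_onI)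
    fix S T assume ST: "S \<in> ?I" "T \<in> ?I" "L S = L T"
    obtain W where W: "W \<in> linear_subspaces r n" "L S = plucker r n W"
      using L[OF ST(1)] by (auto simp: grassmannian_def)
    obtain u where "plucker r n W \<subseteq> range (\<lambda>c. scale_fun c (wedge r n u))"
      using plucker_line[OF W(1)] by blast
    moreover have "unit_fun S \<in> plucker r n W" "unit_fun T \<in> plucker r n W"
      using L[OF ST(1)] L[OF ST(2)] ST(3) W(2) by auto
    ultimately obtain a b where a: "unit_fun S = scale_fun a (wedge r n u)"
      and b: "unit_fun T = scale_fun b (wedge r n u)"
      by blast
    have "a * wedge r n u S = 1" "b * wedge r n u T = 1" "a * wedge r n u T = (if T = S then 1 else 0)"
      using fun_cong[OF a, of S] fun_cong[OF b, of T] fun_cong[OF a, of T]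
      by (simp_all add: unit_fun_def scale_fun_def split: if_splits)
    then show "S = T"
      by (cases "a = 0"; cases "wedge r n u T = 0"; cases "T = S") auto
  qed
  then show ?thesis
    using L finite_plucker_index by (intro exI[of _ "L ` ?I"]) (auto simp: card_image)
qed

lemma sum_wedges_in_secant_union:
  assumes "r \<le> n" "h \<le> card (plucker_index r n)"
    and x: "x = (\<lambda>S. \<Sum>i<h. wedge r n (w i) S)" "x \<noteq> 0"
  shows "cfun.span {x} \<in> secant_union h (grassmannian r n)"
proof -
  let ?X = "grassmannian r n"
  have "\<forall>i. \<exists>L. L \<in> ?X \<and> wedge r n (w i) \<in> L"
    using wedge_on_grassmannian[OF assms(1)] by blast
  from choice[OF this] obtain L where L: "\<And>i. L i \<in> ?X \<and> wedge r n (w i) \<in> L i"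
    by blast
  obtain A0 where A0: "A0 \<subseteq> ?X" "finite A0" "card A0 = card (plucker_index r n)"
    using grassmannian_many_points[OF assms(1)] by blast
  \<comment> \<open>Coinciding lines are padded with further points to exactly \<open>h\<close> of them.\<close>
  have "card (L ` {..<h}) \<le> h"
    using card_image_le[of "{..<h}" L] by simp
  moreover have "h \<le> card (L ` {..<h} \<union> A0)"
    using assms(2) A0 card_mono[of "L ` {..<h} \<union> A0" A0] by simp
  ultimately obtain A where A: "L ` {..<h} \<subseteq> A" "A \<subseteq> L ` {..<h} \<union> A0" "card A = h"
    using exists_subset_between[of "L ` {..<h}" h "L ` {..<h} \<union> A0"] A0(2) by auto
  have AX: "A \<subseteq> ?X" "finite A"
    using A(2) A0(1,2) L by (auto intro: finite_subset[OF A(2)])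
  have "x = (\<Sum>i<h. wedge r n (w i))"
    by (simp add: x(1) fun_eq_iff sum_apply)
  moreover have "wedge r n (w i) \<in> cfun.span (\<Union>A)" if "i < h" for i
    using that L A(1) by (intro cfun.span_base) blast
  ultimately have "x \<in> cfun.span (\<Union>A)"
    by (auto intro: cfun.span_sum)
  then have "cfun.span {x} \<subseteq> cfun.span (\<Union>A)"
    by (intro cfun.span_minimal) (auto simp: cfun.subspace_span)
  moreover have "x \<in> coord_space UNIV"
    by (simp add: coord_space_def)
  then have "cfun.span {x} \<in> proj_space UNIV"
    using x(2) by (rule line_in_proj_space)
  ultimately have "cfun.span {x} \<in> projectivization (cfun.span (\<Union>A))"
    by (simp add: proj_space_def projectivization_def)
  then show ?thesis
    using A AX by (auto simp: secant_union_def)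
qed

text \<open>
  A nonzero vector can take the place of one member of an independent family.  This trades a
  derivative for the base point in the hypotheses of the locale \<open>immersion\<close>.
\<close>

lemma exchange_first:
  assumes K: "finite K" "card K = Suc D" and v: "independent_family K v" and "v0 \<noteq> 0"
  shows "\<exists>k. (\<forall>j<D. k j \<in> K) \<and>
    independent_family {..D} (\<lambda>j. if j = 0 then v0 else v (k (j - 1)))"
proof -
  have inj: "inj_on v K" and ind: "cfun.independent (v ` K)"
    using v K independent_family_iff by auto
  have "cfun.independent {v0}"
    using assms(4) cfun.independent_insert[of v0 "{}"] by (auto simp: cfun.independent_empty)
  then obtain B where B: "{v0} \<subseteq> B" "B \<subseteq> insert v0 (v ` K)" "cfun.independent B" "insert v0 (v ` K) \<subseteq> cfun.span B"
    using cfun.maximal_independent_subset_extend[of "{v0}" "insert v0 (v ` K)"] by blast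
  have fin: "finite B"
    using B(2) K(1) finite_subset by blast
  have "Suc D \<le> card B"
    using cfun.independent_span_bound[OF fin ind] B(4) K by (simp add: card_image[OF inj])
  then have "D \<le> card (B - {v0})"
    using B(1) fin by simp
  then obtain C where C: "C \<subseteq> B - {v0}" "card C = D" "finite C"
    using obtain_subset_with_card_n by blast
  then obtain e where e: "bij_betw e {0..<D} C"
    using ex_bij_betw_nat_finite by blast
  have eC: "e j \<in> C" if "j < D" for j
    using e that by (auto simp: bij_betw_def)
  have "e j \<in> v ` K" if "j < D" for j
    using eC[OF that] C(1) B(2) by blast
  then have k: "inv_into K v (e j) \<in> K \<and> v (inv_into K v (e j)) = e j" if "j < D" for j
    using that by (simp add: inv_into_into f_inv_into_f)
  define k where "k j = inv_into K v (e j)" for j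
  have k: "k j \<in> K \<and> v (k j) = e j" if "j < D" for j
    using k[OF that] by (simp add: k_def)
  define g where "g j = (if j = 0 then v0 else v (k (j - 1)))" for j
  have gS: "g j = e (j - 1)" "g j \<in> C" if "0 < j" "j \<le> D" for j
    using that k[of "j - 1"] eC[of "j - 1"] by (auto simp: g_def)
  have "inj_on g {..D}"
  proof (rule inj_onI)
    fix i j assume ij: "i \<in> {..D}" "j \<in> {..D}" "g i = g j"
    have "g 0 \<notin> C"
      using C(1) by (auto simp: g_def)
    moreover have "i \<noteq> 0 \<Longrightarrow> g i \<in> C" "j \<noteq> 0 \<Longrightarrow> g j \<in> C"
      using gS(2)[of i] gS(2)[of j] ij(1,2) by simp_all
    ultimately have "i = 0 \<longleftrightarrow> j = 0"
      using ij(3) by metis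
    then consider "i = 0" "j = 0" | "0 < i" "0 < j"
      by blast
    then show "i = j"
    proof cases
      case 2
      then have "e (i - 1) = e (j - 1)"
        using gS(1)[of i] gS(1)[of j] ij by simp
      then have "i - 1 = j - 1"
        using 2 ij e by (auto simp: bij_betw_def inj_on_def)
      then show ?thesis using 2 by simp
    qed simp
  qed
  moreover have "g j \<in> B" if "j \<le> D" for j
  proof (cases "j = 0")
    case True
    then show ?thesis using B(1) by (simp add: g_def)
  next
    case False
    then show ?thesis using gS(2)[of j] that C(1) by blast
  qed
  then have "g ` {..D} \<subseteq> B" by blast
  then have "cfun.independent (g ` {..D})"
    using B(3) cfun.independent_mono by blast
  ultimately have "independent_family {..D} g"
    using independent_family_iff by blast
  then show ?thesis
    using k unfolding g_def[abs_def] by (intro exI[of _ k] conjI allI impI) blast+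
qed

lemma independent_family_card:
  assumes "finite K" "finite I" "independent_family K v" "\<And>k. k \<in> K \<Longrightarrow> v k \<in> coord_space I"
  shows "card K \<le> card I"
proof -
  have "inj_on v K" "cfun.independent (v ` K)"
    using assms independent_family_iff by auto
  then have "card K \<le> card (unit_fun ` I)"
    using cfun.independent_span_bound[of "unit_fun ` I" "v ` K"] assms
    by (auto simp: card_image coord_space_span)
  then show ?thesis
    using card_image_le[OF assms(2), of unit_fun] by linarith
qed

text \<open>
  The part of Terracini's lemma that is needed here.  The tangent vectors at the \<open>h\<close> points are
  derivatives of the map that adds up \<open>h\<close> decomposable vectors, so their independence makes it an
  immersion into the secant variety.
\<close>

theorem not_defective_if_independent_tangents:
  fixes m :: "'k \<Rightarrow> nat \<Rightarrow> nat \<Rightarrow> nat \<Rightarrow> complex"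
  assumes "r \<le> n" "1 \<le> h" "finite K" "card K = h * ((r + 1) * (n - r) + 1)"
    and ind: "independent_family K (\<lambda>k S. \<Sum>i<h. dwedge r n (w i) (m k i) S)"
    and nz: "(\<lambda>S. \<Sum>i<h. wedge r n (w i) S) \<noteq> 0"
  shows "\<not> defective (plucker_index r n) h (grassmannian r n)"
proof -
  let ?I = "plucker_index r n" and ?X = "grassmannian r n" and ?d = "(r + 1) * (n - r)"
  define v where "v k = (\<lambda>S. \<Sum>i<h. dwedge r n (w i) (m k i) S)" for k
  define v0 where "v0 = (\<lambda>S. \<Sum>i<h. wedge r n (w i) S)"
  have tangent_coord: "v k \<in> coord_space ?I" for k
    using dwedge_coord[of r n] by (auto simp: v_def coord_space_def)
  have v0_coord: "v0 \<in> coord_space ?I"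
    using wedge_coord[of r n] by (auto simp: v0_def coord_space_def)
  have indv: "independent_family K v"
    using ind by (simp add: v_def[abs_def])
  define D where "D = card K - 1"
  have D: "card K = Suc D"
    using assms(2,4) by (simp add: D_def)
  obtain k where k: "\<And>j. j < D \<Longrightarrow> k j \<in> K"
    and indk: "independent_family {..D} (\<lambda>j. if j = 0 then v0 else v (k (j - 1)))"
    using exchange_first[OF assms(3) D indv, of v0] nz unfolding v0_def by blast
  define u where "u j = (if j = 0 then v0 else v (k (j - 1)))" for j
  \<comment> \<open>Moving all \<open>h\<close> points at once, with parameter \<open>x j\<close> in the direction \<open>m (k j)\<close>.\<close>
  define G where "G x = (\<lambda>S. \<Sum>i<h. wedge r n (\<lambda>a c. w i a c + (\<Sum>j<D. x j * m (k j) i a c)) S)"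
    for x :: "nat \<Rightarrow> complex"
  interpret immersion ?I D "r + 1" G u
  proof
    show "finite ?I" by (rule finite_plucker_index)
    show "(\<lambda>x. G x S) \<in> polyfun {..<D} (r + 1)" for S
      unfolding G_def
    proof (rule polyfun_sum)
      fix i
      show "(\<lambda>x. wedge r n (\<lambda>a c. w i a c + (\<Sum>j<D. x j * m (k j) i a c)) S) \<in> polyfun {..<D} (r + 1)"
      proof (rule wedge_polyfun[where w = "\<lambda>x a c. w i a c + (\<Sum>j<D. x j * m (k j) i a c)"])
        fix a c
        have "(\<lambda>x. x j * m (k j) i a c) \<in> polyfun {..<D} 1" if "j < D" for j
          using polyfun_mult[OF polyfun_var polyfun_const[of "m (k j) i a c" _ 0], of "{..<D}" j] that by simp
        then show "(\<lambda>x. w i a c + (\<Sum>j<D. x j * m (k j) i a c)) \<in> polyfun {..<D} 1"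
          by (intro polyfun_add polyfun_const polyfun_sum) auto
      qed
    qed
    show "G x \<in> coord_space ?I" for x
      using wedge_coord[of r n] by (auto simp: G_def coord_space_def)
    show "G (\<lambda>_. 0) = u 0"
      by (simp add: G_def u_def v0_def)
    show "independent_family {..D} u"
      using indk by (simp add: u_def[abs_def])
    show "u j \<in> coord_space ?I" for j
      using tangent_coord v0_coord by (simp add: u_def)
    fix x S
    have "((\<lambda>s. \<Sum>i<h. wedge r n (\<lambda>a c. w i a c + s * (\<Sum>j<D. x j * m (k j) i a c)) S)
        has_field_derivative (\<Sum>i<h. dwedge r n (w i) (\<lambda>a c. \<Sum>j<D. x j * m (k j) i a c) S)) (at 0)"
      by (intro DERIV_sum has_field_derivative_wedge)
    moreover have "(\<Sum>i<h. dwedge r n (w i) (\<lambda>a c. \<Sum>j<D. x j * m (k j) i a c) S) = (\<Sum>j<D. x j * u (Suc j) S)"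
      by (simp add: dwedge_sum u_def v_def sum_distrib_left) (rule sum.swap)
    moreover have "G (\<lambda>j. s * x j) S = (\<Sum>i<h. wedge r n (\<lambda>a c. w i a c + s * (\<Sum>j<D. x j * m (k j) i a c)) S)" for s
      by (simp add: G_def sum_distrib_left mult.assoc)
    ultimately show "((\<lambda>s. G (\<lambda>j. s * x j) S) has_field_derivative (\<Sum>j<D. x j * u (Suc j) S)) (at 0)"
      by simp
  qed
  have "h \<le> card K"
    using assms(4) by simp
  also have "\<dots> \<le> card ?I"
    using independent_family_card[OF assms(3) finite_plucker_index indv tangent_coord] .
  finally have "cfun.span {G x} \<in> secant_union h ?X" if "G x \<noteq> 0" for x
    using that unfolding G_def by (intro sum_wedges_in_secant_union[OF assms(1)]) auto
  then have lower: "ereal (real D) \<le> proj_dim ?I (secant_variety ?I h ?X)"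
    unfolding secant_variety_eq by (rule proj_dim_closure_ge)
  have "ereal (real h) * proj_dim ?I ?X + ereal (real h) - 1 \<le>
      ereal (real h) * ereal (real ?d) + ereal (real h) - 1"
    using proj_dim_grassmannian_le[OF assms(1)]
    by (intro ereal_minus_mono add_mono ereal_mult_left_mono) auto
  also have "\<dots> = ereal (real D)"
  proof -
    have "real D + 1 = real h * real ?d + real h"
      using D assms(4) by (simp add: algebra_simps flip: of_nat_mult of_nat_add of_nat_Suc)
    then show ?thesis by (simp add: one_ereal_def)
  qed
  also note lower
  finally have "min (ereal (real h) * proj_dim ?I ?X + ereal (real h) - 1) (ereal (real (card ?I) - 1)) \<le>
      proj_dim ?I (secant_variety ?I h ?X)"
    by (rule order_trans[OF min.cobounded1])
  then show ?thesis
    unfolding defective_def by (simp only: not_less)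
qed

text \<open>There are no \<open>0\<close>-secants, and \<open>- 1\<close>, the dimension of the empty set, is the expected one.\<close>

lemma not_defective_0:
  fixes X :: "('i \<Rightarrow> complex) set set"
  shows "\<not> defective I 0 X"
proof -
  have "- 1 \<le> proj_dim I Y" for Y :: "('i \<Rightarrow> complex) set set"
  proof -
    have "{} \<in> {C. finite C \<and> (\<forall>Z\<in>C. irreducible_closedin (subtopology (zariski I) Y) Z) \<and> chain\<^sub>\<subseteq> C}"
      by (simp add: chain_subset_def)
    from SUP_upper[OF this, of "\<lambda>C. ereal (real (card C) - 1)"] show ?thesis
      unfolding proj_dim_def krull_dim_def by (simp add: one_ereal_def)
  qed
  then have "- 1 \<le> proj_dim I (secant_variety I 0 X)" .
  then show ?thesis
    unfolding defective_def by (simp add: min_less_iff_conj not_less one_ereal_def zero_ereal_def[symmetric])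
qed

section \<open>Tangent spaces at coordinate points\<close>

definition neighbours :: "nat \<Rightarrow> nat \<Rightarrow> nat set \<Rightarrow> nat set set" where
  "neighbours r n S = {T \<in> plucker_index r n. card (S - T) \<le> 1}"

lemma wedge_zero_row: "a \<le> r \<Longrightarrow> wedge r n (w(a := (\<lambda>_. 0))) = (\<lambda>_. 0)"
  using wedge_row_sum[of a r n w "\<lambda>_. 0" "\<lambda>_ _. 0" "{} :: nat set"] by (auto simp: fun_eq_iff)

lemma dwedge_zero: "dwedge r n w (\<lambda>_ _. 0) = (\<lambda>_. 0)"
  by (simp add: dwedge_def wedge_zero_row)

lemma dwedge_single_row:
  assumes "a \<le> r"
  shows "dwedge r n w ((\<lambda>_ _. 0)(a := u)) = wedge r n (w(a := u))"
proof
  fix S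
  have "dwedge r n w ((\<lambda>_ _. 0)(a := u)) S = (\<Sum>b\<le>r. if b = a then wedge r n (w(a := u)) S else 0)"
    unfolding dwedge_def by (intro sum.cong) (auto simp: wedge_zero_row)
  then show "dwedge r n w ((\<lambda>_ _. 0)(a := u)) S = wedge r n (w(a := u)) S"
    using assms by simp
qed

lemma plucker_indexD:
  assumes "S \<in> plucker_index r n"
  shows "finite S" "card S = r + 1" "S \<subseteq> {..n}"
  using assms finite_subset[of S "{..n}"] by (auto simp: plucker_index_def)

lemma neighbour_exchange:
  assumes S: "S \<in> plucker_index r n" and T: "T \<in> neighbours r n S" and "T \<noteq> S"
  shows "\<exists>s\<in>S. \<exists>t\<in>{..n} - S. T = insert t (S - {s})"
proof -
  have T': "T \<in> plucker_index r n" "card (S - T) \<le> 1"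
    using T by (auto simp: neighbours_def)
  have fin: "finite S" "finite T" "card T = card S"
    using plucker_indexD[OF S] plucker_indexD[OF T'(1)] by auto
  have "\<not> S \<subseteq> T"
    using fin assms(3) card_subset_eq[of T S] by auto
  then have "card (S - T) \<noteq> 0"
    using fin by auto
  then have 1: "card (S - T) = 1" using T'(2) by simp
  then obtain s where s: "S - T = {s}"
    by (auto simp: card_1_singleton_iff)
  have "card (T - S) = card (S - T)"
    using fin by (simp add: card_Diff_subset_Int Int_commute)
  then obtain t where t: "T - S = {t}"
    using 1 by (auto simp: card_1_singleton_iff)
  have "T = insert t (S - {s})" "s \<in> S" "t \<in> {..n} - S"
    using s t plucker_indexD[OF T'(1)] by auto
  then show ?thesis by blast
qed

text \<open>This is the dimension of the cone over the Grassmannian.\<close>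

lemma card_neighbours:
  assumes S: "S \<in> plucker_index r n"
  shows "card (neighbours r n S) = (r + 1) * (n - r) + 1"
proof -
  let ?f = "\<lambda>(s, t). insert t (S - {s})" and ?P = "S \<times> ({..n} - S)"
  have fin: "finite S" "card S = r + 1" "S \<subseteq> {..n}"
    using plucker_indexD[OF S] by auto
  have inj: "inj_on ?f ?P"
  proof (rule inj_onI)
    fix p q assume pq: "p \<in> ?P" "q \<in> ?P" "?f p = ?f q"
    obtain s t s' t' where p: "p = (s, t)" "q = (s', t')" by (cases p; cases q) auto
    have "insert t (S - {s}) - S = {t}" "insert t' (S - {s'}) - S = {t'}"
      "S - insert t (S - {s}) = {s}" "S - insert t' (S - {s'}) = {s'}"
      using pq(1,2) p by auto
    then show "p = q" using pq(3) p by auto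
  qed
  have "neighbours r n S = insert S (?f ` ?P)"
  proof
    show "neighbours r n S \<subseteq> insert S (?f ` ?P)"
    proof
      fix T assume T: "T \<in> neighbours r n S"
      show "T \<in> insert S (?f ` ?P)"
      proof (cases "T = S")
        case False
        then obtain s t where "s \<in> S" "t \<in> {..n} - S" "T = insert t (S - {s})"
          using neighbour_exchange[OF S T] by blast
        then show ?thesis by (intro insertI2 image_eqI[of _ _ "(s, t)"]) auto
      qed simp
    qed
    have "insert t (S - {s}) \<in> neighbours r n S" if "s \<in> S" "t \<in> {..n} - S" for s t
    proof -
      have "card (insert t (S - {s})) = r + 1"
        using that fin by (simp add: card_insert_if)
      moreover have "S - insert t (S - {s}) = {s}"
        using that by auto
      ultimately show ?thesis
        using that fin by (auto simp: neighbours_def plucker_index_def)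
    qed
    moreover have "S \<in> neighbours r n S"
      using S by (simp add: neighbours_def)
    ultimately show "insert S (?f ` ?P) \<subseteq> neighbours r n S"
      by auto
  qed
  moreover have "S \<notin> ?f ` ?P"
    by auto
  moreover have "card (?f ` ?P) = (r + 1) * (n - r)"
    using fin by (simp add: card_image[OF inj] card_cartesian_product card_Diff_subset)
  ultimately show ?thesis
    using fin by simp
qed

lemma neighbours_disjoint:
  assumes S: "S \<in> plucker_index r n" and T: "T \<in> plucker_index r n" and "3 \<le> card (S - T)"
  shows "neighbours r n S \<inter> neighbours r n T = {}"
proof (rule ccontr)
  assume "\<not> ?thesis"
  then obtain U where U: "U \<in> plucker_index r n" "card (S - U) \<le> 1" "card (T - U) \<le> 1"
    by (auto simp: neighbours_def)
  have fin: "finite S" "finite T" "finite U" "card T = card U"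
    using plucker_indexD S T U(1) by metis+
  have "card (U - T) = card (T - U)"
    using fin by (simp add: card_Diff_subset_Int Int_commute)
  have "card (S - T) \<le> card ((S - U) \<union> (U - T))"
    using fin by (intro card_mono) auto
  also have "\<dots> \<le> card (S - U) + card (U - T)"
    by (rule card_Un_le)
  finally show False
    using assms(3) U \<open>card (U - T) = card (T - U)\<close> by simp
qed

text \<open>
  Replacing one row of a coordinate point by another unit vector moves to a neighbouring
  coordinate point, so the tangent space is spanned by the unit vectors of all neighbours.
\<close>

lemma tangent_unit_fun:
  assumes S: "S \<in> plucker_index r n" and T: "T \<in> neighbours r n S"
  shows "\<exists>m. dwedge r n (\<lambda>i. unit_fun (enum S i)) m = unit_fun T"
proof -
  let ?w = "\<lambda>i. unit_fun (enum S i)"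
  have S': "inj_on (enum S) {..r}" "enum S ` {..r} = S" "S \<subseteq> {..n}"
    using enum_bij[OF S] plucker_indexD[OF S] by (auto simp: bij_betw_def)
  have "\<exists>a t. a \<le> r \<and> inj_on ((enum S)(a := t)) {..r} \<and> (enum S)(a := t) ` {..r} = T \<and> T \<subseteq> {..n}"
  proof (cases "T = S")
    case True
    then show ?thesis using S' by (intro exI[of _ 0] exI[of _ "enum S 0"]) simp
  next
    case False
    then obtain s t where st: "s \<in> S" "t \<in> {..n} - S" "T = insert t (S - {s})"
      using neighbour_exchange[OF S T] by blast
    then have "s \<in> enum S ` {..r}"
      using S'(2) by simp
    then obtain a where a: "a \<le> r" "enum S a = s"
      by auto
    have ran: "enum S i \<in> S" if "i \<le> r" for i
      using S'(2) that by auto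
    have "inj_on ((enum S)(a := t)) {..r}"
      using S'(1) st(2) ran by (auto simp: inj_on_def)
    have "(enum S)(a := t) ` {..r} = insert t (enum S ` ({..r} - {a}))"
      using a(1) by (auto simp: image_iff)
    moreover have "enum S ` ({..r} - {a}) = S - {s}"
      using S'(1,2) a by (simp add: inj_on_image_set_diff[of _ "{..r}"])
    ultimately have "(enum S)(a := t) ` {..r} = T"
      using st(3) by simp
    moreover have "T \<subseteq> {..n}"
      using st S'(3) by auto
    ultimately show ?thesis
      using a(1) \<open>inj_on ((enum S)(a := t)) {..r}\<close> by (intro exI[of _ a] exI[of _ t] conjI)
  qed
  then obtain a t where a: "a \<le> r" and g: "inj_on ((enum S)(a := t)) {..r}"
    "(enum S)(a := t) ` {..r} = T" "T \<subseteq> {..n}"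
    by blast
  obtain c where c: "c \<noteq> 0" "wedge r n (\<lambda>i. unit_fun (((enum S)(a := t)) i)) = scale_fun c (unit_fun T)"
    using wedge_unit_fun[OF g(1), of n] g(2,3) by auto
  have eq: "(\<lambda>i. unit_fun (((enum S)(a := t)) i)) = ?w(a := unit_fun t)"
    by auto
  have "dwedge r n ?w ((\<lambda>_ _. 0)(a := (\<lambda>k. inverse c * unit_fun t k))) =
      wedge r n (?w(a := (\<lambda>k. inverse c * unit_fun t k)))"
    by (rule dwedge_single_row[OF a])
  also have "\<dots> = wedge r n ((?w(a := unit_fun t))(a := (\<lambda>k. inverse c * (?w(a := unit_fun t)) a k)))"
    by simp
  also have "\<dots> = scale_fun (inverse c) (scale_fun c (unit_fun T))"
    unfolding c(2)[symmetric] eq by (rule wedge_row_scale[OF a])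
  also have "\<dots> = unit_fun T"
    using c(1) by (simp add: scale_fun_def mult.assoc[symmetric])
  finally show ?thesis by blast
qed

lemma sum_lessThan_add:
  fixes h q :: nat
  shows "(\<Sum>i<h + q. f i) = (\<Sum>i<h. f i) + (\<Sum>j<q. f (h + j) :: 'a :: comm_monoid_add)"
  by (induction q) (auto simp: algebra_simps)

text \<open>
  The tangent spaces at coordinate points at mutual distance at least 3 are spanned by disjoint
  sets of unit vectors.  To see that \<open>q\<close> further tangent spaces are independent of them, it
  suffices to look at the remaining coordinates.
\<close>

theorem not_defective_if_code:
  fixes m :: "'k \<Rightarrow> nat \<Rightarrow> nat \<Rightarrow> nat \<Rightarrow> complex"
  assumes "r \<le> n" "1 \<le> h"
    and S: "\<And>i. i < h \<Longrightarrow> S i \<in> plucker_index r n"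
    and dist: "\<And>i j. i < h \<Longrightarrow> j < h \<Longrightarrow> i \<noteq> j \<Longrightarrow> 3 \<le> card (S i - S j)"
    and K: "finite K" "card K = q * ((r + 1) * (n - r) + 1)"
    and indep: "\<And>c. (\<And>T. T \<in> plucker_index r n \<Longrightarrow> (\<And>i. i < h \<Longrightarrow> T \<notin> neighbours r n (S i)) \<Longrightarrow>
        (\<Sum>k\<in>K. c k * (\<Sum>j<q. dwedge r n (p j) (m k j) T)) = 0) \<Longrightarrow> \<forall>k\<in>K. c k = 0"
    and nz: "q = 0 \<or> (\<exists>T. T \<notin> S ` {..<h} \<and> (\<Sum>j<q. wedge r n (p j) T) \<noteq> 0)"
  shows "\<not> defective (plucker_index r n) (h + q) (grassmannian r n)"
proof -
  let ?d = "(r + 1) * (n - r)"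
  let ?u = "\<lambda>i a. unit_fun (enum (S i) a) :: nat \<Rightarrow> complex"
  define K1 where "K1 = (SIGMA i:{..<h}. neighbours r n (S i))"
  have fin_nb: "finite (neighbours r n U)" for U
    using finite_plucker_index by (auto simp: neighbours_def)
  have K1: "finite K1" "card K1 = h * (?d + 1)"
    using card_neighbours[OF S] by (auto simp: K1_def fin_nb)
  have inj: "inj_on snd K1"
  proof (rule inj_onI)
    fix x y assume xy: "x \<in> K1" "y \<in> K1" "snd x = snd y"
    then have "neighbours r n (S (fst x)) \<inter> neighbours r n (S (fst y)) \<noteq> {}"
      by (auto simp: K1_def)
    then have "fst x = fst y"
      using xy(1,2) neighbours_disjoint[OF S S dist] by (force simp: K1_def)
    then show "x = y" using xy(3) by (simp add: prod_eq_iff)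
  qed
  have "\<forall>x. \<exists>M. x \<in> K1 \<longrightarrow> dwedge r n (?u (fst x)) M = unit_fun (snd x)"
  proof
    fix x
    show "\<exists>M. x \<in> K1 \<longrightarrow> dwedge r n (?u (fst x)) M = unit_fun (snd x)"
      using tangent_unit_fun[OF S, of "fst x" "snd x"] by (auto simp: K1_def)
  qed
  from choice[OF this] obtain M where
    M: "\<And>x. x \<in> K1 \<Longrightarrow> dwedge r n (?u (fst x)) (M x) = unit_fun (snd x)"
    by blast
  define w where "w i = (if i < h then ?u i else p (i - h))" for i
  \<comment> \<open>Each direction moves only one of the coordinate points, or all of the further points.\<close>
  define m' where "m' k i = (case k of
      Inl x \<Rightarrow> if i = fst x then M x else (\<lambda>_ _. 0)
    | Inr k \<Rightarrow> if i < h then (\<lambda>_ _. 0) else m k (i - h))" for k i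
  let ?v = "\<lambda>k T. \<Sum>i<h + q. dwedge r n (w i) (m' k i) T"
  have v1: "?v (Inl x) T = unit_fun (snd x) T" if x: "x \<in> K1" for x T
  proof -
    have xh: "fst x < h" using x by (auto simp: K1_def)
    have "?v (Inl x) T = (\<Sum>i<h + q. if i = fst x then unit_fun (snd x) T else 0)"
      using M[OF x] xh by (intro sum.cong) (auto simp: w_def m'_def dwedge_zero)
    then show ?thesis using xh by simp
  qed
  have v2: "?v (Inr k) T = (\<Sum>j<q. dwedge r n (p j) (m k j) T)" for k T
    by (simp add: sum_lessThan_add w_def m'_def dwedge_zero)
  have ind: "independent_family (K1 <+> K) ?v"
    unfolding independent_family_def
  proof (intro allI impI)
    fix c assume c: "\<forall>T. (\<Sum>k\<in>K1 <+> K. c k * ?v k T) = 0"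
    have split: "(\<Sum>x\<in>K1. c (Inl x) * unit_fun (snd x) T) +
        (\<Sum>k\<in>K. c (Inr k) * (\<Sum>j<q. dwedge r n (p j) (m k j) T)) = 0" for T
    proof -
      have "(\<Sum>k\<in>K1 <+> K. c k * ?v k T) =
          (\<Sum>x\<in>K1. c (Inl x) * ?v (Inl x) T) + (\<Sum>k\<in>K. c (Inr k) * ?v (Inr k) T)"
        using K1(1) K(1) by (simp add: sum.Plus)
      also have "(\<Sum>x\<in>K1. c (Inl x) * ?v (Inl x) T) = (\<Sum>x\<in>K1. c (Inl x) * unit_fun (snd x) T)"
        by (intro sum.cong refl) (simp only: v1)
      finally show ?thesis
        using c by (simp only: v2)
    qed
    have cK: "\<forall>k\<in>K. c (Inr k) = 0"
    proof (rule indep)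
      fix T assume "T \<in> plucker_index r n" and T: "\<And>i. i < h \<Longrightarrow> T \<notin> neighbours r n (S i)"
      have "(\<Sum>x\<in>K1. c (Inl x) * unit_fun (snd x) T) = 0"
        using T by (intro sum.neutral) (auto simp: K1_def unit_fun_def)
      then show "(\<Sum>k\<in>K. c (Inr k) * (\<Sum>j<q. dwedge r n (p j) (m k j) T)) = 0"
        using split[of T] by simp
    qed
    have cK1: "c (Inl x) = 0" if x: "x \<in> K1" for x
    proof -
      have "(\<Sum>k\<in>K. c (Inr k) * (\<Sum>j<q. dwedge r n (p j) (m k j) (snd x))) = 0"
        using cK by (intro sum.neutral) auto
      then have "(\<Sum>y\<in>K1. c (Inl y) * unit_fun (snd y) (snd x)) = 0"
        using split[of "snd x"] by simp
      moreover have "(\<Sum>y\<in>K1. c (Inl y) * unit_fun (snd y) (snd x)) = (\<Sum>y\<in>K1. if y = x then c (Inl x) else 0)"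
        using inj x by (intro sum.cong) (auto simp: unit_fun_def dest: inj_onD)
      ultimately show ?thesis
        using x K1(1) by simp
    qed
    show "\<forall>k\<in>K1 <+> K. c k = 0"
      using cK cK1 by auto
  qed
  have "\<exists>T. (\<Sum>i<h + q. wedge r n (w i) T) \<noteq> 0"
  proof -
    have unit: "\<exists>c. c \<noteq> 0 \<and> wedge r n (?u i) = scale_fun c (unit_fun (S i))" if "i < h" for i
      using wedge_unit_fun[of "enum (S i)" r n] enum_bij[OF S[OF that]] plucker_indexD[OF S[OF that]]
      by (auto simp: bij_betw_def)
    have off: "wedge r n (?u i) T = 0" if i: "i < h" "T \<noteq> S i" for i T
    proof -
      obtain c where c: "wedge r n (?u i) = scale_fun c (unit_fun (S i))"
        using unit[OF i(1)] by blast
      show ?thesis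
        unfolding c using i(2) by (simp add: scale_fun_def unit_fun_def)
    qed
    have split: "(\<Sum>i<h + q. wedge r n (w i) T) = (\<Sum>i<h. wedge r n (?u i) T) + (\<Sum>j<q. wedge r n (p j) T)" for T
      by (simp add: sum_lessThan_add w_def)
    from nz show ?thesis
    proof
      assume "\<exists>T. T \<notin> S ` {..<h} \<and> (\<Sum>j<q. wedge r n (p j) T) \<noteq> 0"
      then obtain T where T: "T \<notin> S ` {..<h}" "(\<Sum>j<q. wedge r n (p j) T) \<noteq> 0" by blast
      then have "(\<Sum>i<h. wedge r n (?u i) T) = 0"
        by (intro sum.neutral) (auto intro: off)
      then show ?thesis
        using T(2) split[of T] by (intro exI[of _ T]) simp
    next
      assume "q = 0"
      have "wedge r n (?u i) (S 0) = 0" if "i < h" "i \<noteq> 0" for i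
        using dist[of i 0] that by (intro off) auto
      then have "(\<Sum>i<h. wedge r n (?u i) (S 0)) = (\<Sum>i<h. if i = 0 then wedge r n (?u 0) (S 0) else 0)"
        by (intro sum.cong) auto
      also have "\<dots> = wedge r n (?u 0) (S 0)"
        using assms(2) by simp
      finally have "(\<Sum>i<h + q. wedge r n (w i) (S 0)) = wedge r n (?u 0) (S 0)"
        using split[of "S 0"] \<open>q = 0\<close> by simp
      moreover have "wedge r n (?u 0) (S 0) \<noteq> 0"
      proof -
        obtain c where c: "c \<noteq> 0" "wedge r n (?u 0) = scale_fun c (unit_fun (S 0))"
          using unit[of 0] assms(2) by auto
        show ?thesis
          unfolding c(2) using c(1) by (simp add: scale_fun_def unit_fun_def)
      qed
      ultimately show ?thesis
        by (intro exI[of _ "S 0"]) simp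
    qed
  qed
  then have nonzero: "(\<lambda>T. \<Sum>i<h + q. wedge r n (w i) T) \<noteq> 0"
    by (auto simp: fun_eq_iff)
  have card: "card (K1 <+> K) = (h + q) * (?d + 1)"
    by (simp only: card_Plus[OF K1(1) K(1)] K1(2) K(2) distrib_right)
  show ?thesis
    by (rule not_defective_if_independent_tangents[OF assms(1) _ _ card ind nonzero])
       (use assms(2) K1(1) K(1) in simp_all)
qed

section \<open>One point more for planes\<close>

lemma det_dim_two:
  fixes A :: "complex mat"
  assumes A: "A \<in> carrier_mat 2 2"
  shows "det A = A $$ (0, 0) * A $$ (1, 1) - A $$ (0, 1) * A $$ (1, 0)"
proof -
  have "det (mat_delete A 0 j) = mat_delete A 0 j $$ (0, 0)" for j
    using A by (intro det_single) (auto simp: mat_delete_def)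
  then show ?thesis
    using laplace_expansion_row[OF A, of 0] A
    by (simp add: cofactor_def numeral_2_eq_2 mat_delete_def)
qed

lemma det_dim_three:
  fixes A :: "complex mat"
  assumes A: "A \<in> carrier_mat 3 3"
  shows "det A =
    A $$ (0, 0) * (A $$ (1, 1) * A $$ (2, 2) - A $$ (1, 2) * A $$ (2, 1)) -
    A $$ (0, 1) * (A $$ (1, 0) * A $$ (2, 2) - A $$ (1, 2) * A $$ (2, 0)) +
    A $$ (0, 2) * (A $$ (1, 0) * A $$ (2, 1) - A $$ (1, 1) * A $$ (2, 0))"
proof -
  have "mat_delete A 0 j \<in> carrier_mat 2 2" for j
    using A by (auto simp: mat_delete_def)
  note minors = det_dim_two[OF this]
  have "det A = (\<Sum>j<3. A $$ (0, j) * cofactor A 0 j)"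
    by (rule laplace_expansion_row[OF A]) simp
  then have "det A = A $$ (0, 0) * det (mat_delete A 0 0) - A $$ (0, 1) * det (mat_delete A 0 1) +
      A $$ (0, 2) * det (mat_delete A 0 2)"
    by (simp add: cofactor_def numeral_3_eq_3 numeral_2_eq_2)
  then show ?thesis
    unfolding minors using A by (simp add: mat_delete_def numeral_2_eq_2)
qed

lemma wedge_planes:
  assumes "t0 < t1" "t1 < t2" "t2 \<le> n"
  shows "wedge 2 n w {t0, t1, t2} =
    w 0 t0 * (w 1 t1 * w 2 t2 - w 1 t2 * w 2 t1) -
    w 0 t1 * (w 1 t0 * w 2 t2 - w 1 t2 * w 2 t0) +
    w 0 t2 * (w 1 t0 * w 2 t1 - w 1 t1 * w 2 t0)"
proof -
  have "{t0, t1, t2} \<in> plucker_index 2 n"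
    using assms by (auto simp: plucker_index_def)
  moreover have "sorted_list_of_set {t0, t1, t2} = [t0, t1, t2]"
    using assms by simp
  then have "enum {t0, t1, t2} 0 = t0" "enum {t0, t1, t2} 1 = t1" "enum {t0, t1, t2} 2 = t2"
    by (simp_all add: enum_def)
  moreover have "minor 2 w {t0, t1, t2} \<in> carrier_mat 3 3"
    using minor_carrier[of 2 w "{t0, t1, t2}"] by simp
  ultimately show ?thesis
    by (simp add: wedge_eq_det det_dim_three) (simp add: minor_def)
qed

text \<open>
  The coordinates of the ambient space are arranged in three rows of length \<open>a\<close>, possibly
  with some left over: the entry in row \<open>i\<close> and column \<open>j\<close> is \<open>i * a + j\<close>.  The columns give \<open>a\<close>
  coordinate points; the additional point is spanned by the three row sums.
\<close>

definition column :: "nat \<Rightarrow> nat \<Rightarrow> nat set" where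
  "column a j = {j, a + j, 2 * a + j}"

definition row_sum :: "nat \<Rightarrow> nat \<Rightarrow> nat \<Rightarrow> complex" where
  "row_sum a i c = (if i * a \<le> c \<and> c < (i + 1) * a then 1 else 0)"

text \<open>
  A triple with at most one element in each column is far from all columns, so its coordinate is
  not touched by the tangent spaces of the coordinate points.
\<close>

lemma transversal_not_neighbour:
  assumes t: "t0 < t1" "t1 < t2" and "j < a"
    and cols: "\<And>t t'. t \<in> {t0, t1, t2} \<Longrightarrow> t' \<in> {t0, t1, t2} \<Longrightarrow> t < 3 * a \<Longrightarrow> t' < 3 * a \<Longrightarrow>
      t mod a = t' mod a \<Longrightarrow> t = t'"
  shows "{t0, t1, t2} \<notin> neighbours 2 n (column a j)"
proof
  let ?T = "{t0, t1, t2}"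
  assume "?T \<in> neighbours 2 n (column a j)"
  then have le: "card (column a j - ?T) \<le> 1"
    by (simp add: neighbours_def)
  have col: "finite (column a j)" "card (column a j) = 3"
    using \<open>j < a\<close> by (auto simp: column_def)
  have col_mod: "x < 3 * a \<and> x mod a = j" if "x \<in> column a j" for x
  proof -
    have "(a + j) mod a = j" "(2 * a + j) mod a = j"
      using \<open>j < a\<close> by simp_all
    then show ?thesis
      using that \<open>j < a\<close> by (auto simp: column_def)
  qed
  have "x = y" if "x \<in> column a j \<inter> ?T" "y \<in> column a j \<inter> ?T" for x y
  proof (rule cols)
    have x: "x < 3 * a \<and> x mod a = j" and y: "y < 3 * a \<and> y mod a = j"
      using that by (auto intro!: col_mod simp del: insert_iff)
    show "x < 3 * a" "y < 3 * a" "x mod a = y mod a"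
      using x y by simp_all
  qed (use that in blast)+
  then have single: "\<forall>x\<in>column a j \<inter> ?T. \<forall>y\<in>column a j \<inter> ?T. x = y"
    by (intro ballI)
  have "finite (column a j \<inter> ?T)"
    using col(1) by (rule finite_Int[OF disjI1])
  then have "card (column a j \<inter> ?T) \<le> Suc 0"
    using single card_le_Suc0_iff_eq by blast
  then show False
    using le col card_Diff_subset_Int[of "column a j" ?T] by simp
qed

lemma row_sum_values:
  assumes "j < a"
  shows "row_sum a 0 j = 1" "row_sum a 0 (a + j) = 0" "row_sum a 0 (2 * a + j) = 0"
    "row_sum a (Suc 0) j = 0" "row_sum a (Suc 0) (a + j) = 1" "row_sum a (Suc 0) (2 * a + j) = 0"
    "row_sum a 2 j = 0" "row_sum a 2 (a + j) = 0" "row_sum a 2 (2 * a + j) = 1"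
  using assms by (auto simp: row_sum_def)

text \<open>
  Now let \<open>X\<close> be the rows of a tangent vector at the additional point whose coordinates at all
  transversal triples vanish.
\<close>

context
  fixes a n :: nat and X :: "nat \<Rightarrow> nat \<Rightarrow> complex"
  assumes a: "4 \<le> a" and n: "3 * a \<le> n + 1"
    and zero: "\<And>t0 t1 t2. t0 < t1 \<Longrightarrow> t1 < t2 \<Longrightarrow> t2 \<le> n \<Longrightarrow>
      (\<And>t t'. t \<in> {t0, t1, t2} \<Longrightarrow> t' \<in> {t0, t1, t2} \<Longrightarrow> t < 3 * a \<Longrightarrow> t' < 3 * a \<Longrightarrow>
        t mod a = t' mod a \<Longrightarrow> t = t') \<Longrightarrow> dwedge 2 n (row_sum a) X {t0, t1, t2} = 0"
begin

lemma dwedge_planes: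
  assumes "t0 < t1" "t1 < t2" "t2 \<le> n"
  shows "dwedge 2 n w X {t0, t1, t2} =
    wedge 2 n (w(0 := X 0)) {t0, t1, t2} + wedge 2 n (w(1 := X 1)) {t0, t1, t2} +
    wedge 2 n (w(2 := X 2)) {t0, t1, t2}"
  by (simp add: dwedge_def numeral_2_eq_2 algebra_simps)

lemma column_mod: "j < a \<Longrightarrow> j mod a = j" "j < a \<Longrightarrow> (a + j) mod a = j" "j < a \<Longrightarrow> (2 * a + j) mod a = j"
  by simp_all

lemma row_sum_beyond: "3 * a \<le> c \<Longrightarrow> i \<le> 2 \<Longrightarrow> row_sum a i c = 0"
proof -
  assume *: "3 * a \<le> c" "i \<le> 2"
  have "(i + 1) * a \<le> 3 * a" using *(2) by (intro mult_right_mono) auto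
  then have "\<not> c < (i + 1) * a" using * by linarith
  then show ?thesis by (simp add: row_sum_def)
qed

lemma third_index: "\<exists>k<a. k \<noteq> i \<and> k \<noteq> j"
proof -
  have "\<exists>k\<in>{0, 1, 2 :: nat}. k \<noteq> i \<and> k \<noteq> j" by auto
  then obtain k where "k \<in> {0, 1, 2}" "k \<noteq> i \<and> k \<noteq> j" by blast
  moreover from this have "k < a" using a by auto
  ultimately show ?thesis by blast
qed

lemma fourth_index: "\<exists>k<a. k \<noteq> i \<and> k \<noteq> j \<and> k \<noteq> l"
proof -
  have "\<exists>k\<in>{0, 1, 2, 3 :: nat}. k \<noteq> i \<and> k \<noteq> j \<and> k \<noteq> l" by auto
  then obtain k where "k \<in> {0, 1, 2, 3}" "k \<noteq> i \<and> k \<noteq> j \<and> k \<noteq> l" by blast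
  moreover from this have "k < a" using a by auto
  ultimately show ?thesis by blast
qed

text \<open>Triples with one element in each row.\<close>

lemma transversal_rel:
  assumes "i < a" "j < a" "k < a" "i \<noteq> j" "i \<noteq> k" "j \<noteq> k"
  shows "X 0 i + X 1 (a + j) + X 2 (2 * a + k) = 0"
proof -
  have t: "i < a + j" "a + j < 2 * a + k" "2 * a + k \<le> n"
    using assms n by auto
  have "dwedge 2 n (row_sum a) X {i, a + j, 2 * a + k} = 0"
    by (rule zero[OF t]) (use assms column_mod in auto)
  then show ?thesis
    using assms by (simp add: dwedge_planes[OF t] wedge_planes[OF t] row_sum_values)
qed

text \<open>
  Triples with two elements in one row and one in another: of the three summands only the one
  where the row sum of the remaining row is replaced survives.
\<close>

lemma row_constant_ordered:
  assumes "i < j" "j < a"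
  shows "X 0 (a + i) = X 0 (a + j)" "X 0 (2 * a + i) = X 0 (2 * a + j)"
    "X 1 i = X 1 j" "X 1 (2 * a + i) = X 1 (2 * a + j)"
    "X 2 i = X 2 j" "X 2 (a + i) = X 2 (a + j)"
proof -
  obtain k where k: "k < a" "k \<noteq> i" "k \<noteq> j"
    using third_index by blast
  have le: "2 * a + k \<le> n" "2 * a + j \<le> n" "i < a"
    using assms k n by auto
  note simps = row_sum_values[OF k(1)] row_sum_values[OF assms(2)] row_sum_values[OF le(3)]
  show "X 0 (a + i) = X 0 (a + j)"
  proof -
    have t: "a + i < a + j" "a + j < 2 * a + k" "2 * a + k \<le> n"
      using assms le by auto
    have "dwedge 2 n (row_sum a) X {a + i, a + j, 2 * a + k} = 0"
      by (rule zero[OF t]) (use assms k le column_mod in auto)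
    then show ?thesis
      by (simp add: dwedge_planes[OF t] wedge_planes[OF t] simps)
  qed
  show "X 0 (2 * a + i) = X 0 (2 * a + j)"
  proof -
    have t: "a + k < 2 * a + i" "2 * a + i < 2 * a + j" "2 * a + j \<le> n"
      using assms le k by auto
    have "dwedge 2 n (row_sum a) X {a + k, 2 * a + i, 2 * a + j} = 0"
      by (rule zero[OF t]) (use assms k le column_mod in auto)
    then show ?thesis
      by (simp add: dwedge_planes[OF t] wedge_planes[OF t] simps)
  qed
  show "X 1 i = X 1 j"
  proof -
    have t: "i < j" "j < 2 * a + k" "2 * a + k \<le> n"
      using assms le k by auto
    have "dwedge 2 n (row_sum a) X {i, j, 2 * a + k} = 0"
      by (rule zero[OF t]) (use assms k le column_mod in auto)
    then show ?thesis
      by (simp add: dwedge_planes[OF t] wedge_planes[OF t] simps)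
  qed
  show "X 1 (2 * a + i) = X 1 (2 * a + j)"
  proof -
    have t: "k < 2 * a + i" "2 * a + i < 2 * a + j" "2 * a + j \<le> n"
      using assms le k by auto
    have "dwedge 2 n (row_sum a) X {k, 2 * a + i, 2 * a + j} = 0"
      by (rule zero[OF t]) (use assms k le column_mod in auto)
    then show ?thesis
      by (simp add: dwedge_planes[OF t] wedge_planes[OF t] simps)
  qed
  show "X 2 i = X 2 j"
  proof -
    have t: "i < j" "j < a + k" "a + k \<le> n"
      using assms le k by auto
    have "dwedge 2 n (row_sum a) X {i, j, a + k} = 0"
      by (rule zero[OF t]) (use assms k le column_mod in auto)
    then show ?thesis
      by (simp add: dwedge_planes[OF t] wedge_planes[OF t] simps)
  qed
  show "X 2 (a + i) = X 2 (a + j)"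
  proof -
    have t: "k < a + i" "a + i < a + j" "a + j \<le> n"
      using assms le k by auto
    have "dwedge 2 n (row_sum a) X {k, a + i, a + j} = 0"
      by (rule zero[OF t]) (use assms k le column_mod in auto)
    then show ?thesis
      by (simp add: dwedge_planes[OF t] wedge_planes[OF t] simps)
  qed
qed

lemma leftover_zero:
  assumes "3 * a \<le> c" "c \<le> n"
  shows "X 0 c = 0" "X 1 c = 0" "X 2 c = 0"
proof -
  have lt: "0 < a" "1 < a" using a by auto
  have beyond: "row_sum a 0 c = 0" "row_sum a (Suc 0) c = 0" "row_sum a 2 c = 0"
    using row_sum_beyond[OF assms(1)] by simp_all
  note simps = row_sum_values[OF lt(1), simplified] row_sum_values[OF lt(2), simplified] beyond
  show "X 0 c = 0"
  proof -
    have t: "a + 0 < 2 * a + 1" "2 * a + 1 < c" "c \<le> n"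
      using assms a by auto
    have "dwedge 2 n (row_sum a) X {a + 0, 2 * a + 1, c} = 0"
      by (rule zero[OF t]) (use assms lt column_mod[OF lt(1)] column_mod[OF lt(2)] in auto)
    then show ?thesis
      unfolding dwedge_planes[OF t] wedge_planes[OF t] by (simp add: simps)
  qed
  show "X 1 c = 0"
  proof -
    have t: "0 < 2 * a + 1" "2 * a + 1 < c" "c \<le> n"
      using assms a by auto
    have "dwedge 2 n (row_sum a) X {0, 2 * a + 1, c} = 0"
      by (rule zero[OF t]) (use assms lt column_mod[OF lt(1)] column_mod[OF lt(2)] in auto)
    then show ?thesis
      unfolding dwedge_planes[OF t] wedge_planes[OF t] by (simp add: simps)
  qed
  show "X 2 c = 0"
  proof -
    have t: "0 < a + 1" "a + 1 < c" "c \<le> n"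
      using assms a by auto
    have "dwedge 2 n (row_sum a) X {0, a + 1, c} = 0"
      by (rule zero[OF t]) (use assms lt column_mod[OF lt(1)] column_mod[OF lt(2)] in auto)
    then show ?thesis
      unfolding dwedge_planes[OF t] wedge_planes[OF t] by (simp add: simps)
  qed
qed

text \<open>
  Adding multiples of the row sums to the rows of \<open>X\<close> changes the tangent vector at most by a
  multiple of the point itself.  This freedom is removed by the zeros in column 0, where only
  \<open>X 0 0\<close> is left open.  Four columns allow to vary one index in \<open>transversal_rel\<close> while the other
  two stay fixed, so \<open>X\<close> is constant along the rows, hence zero.
\<close>

lemma rows_vanish:
  assumes norm: "X 0 a = 0" "X 0 (2 * a) = 0" "X 1 0 = 0" "X 1 a = 0" "X 1 (2 * a) = 0"
    "X 2 0 = 0" "X 2 a = 0" "X 2 (2 * a) = 0"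
    and "i \<le> 2" "c \<le> n"
  shows "X i c = 0"
proof -
  have const: "X 0 (a + j) = 0" "X 0 (2 * a + j) = 0" "X 1 j = 0" "X 1 (2 * a + j) = 0"
    "X 2 j = 0" "X 2 (a + j) = 0" if j: "j < a" for j
    using row_constant_ordered[of 0 j] norm j by (cases "j = 0"; simp)+
  have mid: "X 1 (a + j) = 0" if j: "j < a" for j
  proof (cases "j = 0")
    case False
    obtain k where k: "k < a" "k \<noteq> 0" "k \<noteq> j" using third_index by blast
    obtain i where i: "i < a" "i \<noteq> 0" "i \<noteq> j" "i \<noteq> k" using fourth_index by blast
    have "X 0 i + X 1 (a + j) + X 2 (2 * a + k) = 0" "X 0 i + X 1 (a + 0) + X 2 (2 * a + k) = 0"
      using i j k a False by (intro transversal_rel; simp)+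
    then have "X 0 i + X 1 (a + j) + X 2 (2 * a + k) = X 0 i + X 1 (a + 0) + X 2 (2 * a + k)"
      by simp
    then have "X 1 (a + j) = X 1 (a + 0)"
      by (simp only: add_right_cancel add_left_cancel)
    then show ?thesis using norm by simp
  qed (use norm in simp)
  have last: "X 2 (2 * a + j) = 0" if j: "j < a" for j
  proof (cases "j = 0")
    case False
    obtain k where k: "k < a" "k \<noteq> 0" "k \<noteq> j" using third_index by blast
    obtain i where i: "i < a" "i \<noteq> 0" "i \<noteq> j" "i \<noteq> k" using fourth_index by blast
    have "X 0 i + X 1 (a + k) + X 2 (2 * a + j) = 0" "X 0 i + X 1 (a + k) + X 2 (2 * a + 0) = 0"
      using i j k a False by (intro transversal_rel; simp)+
    then have "X 0 i + X 1 (a + k) + X 2 (2 * a + j) = X 0 i + X 1 (a + k) + X 2 (2 * a + 0)"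
      by simp
    then have "X 2 (2 * a + j) = X 2 (2 * a + 0)"
      by (simp only: add_left_cancel)
    then show ?thesis using norm by simp
  qed (use norm in simp)
  have first: "X 0 j = 0" if j: "j < a" for j
  proof -
    obtain k where k: "k < a" "k \<noteq> 0" "k \<noteq> j" using third_index by blast
    obtain i where i: "i < a" "i \<noteq> 0" "i \<noteq> j" "i \<noteq> k" using fourth_index by blast
    show ?thesis
      using transversal_rel[of j i k] mid[OF i(1)] last[OF k(1)] i j k by simp
  qed
  have i: "i = 0 \<or> i = 1 \<or> i = 2" using \<open>i \<le> 2\<close> by auto
  consider "c < a" | "a \<le> c" "c < 2 * a" | "2 * a \<le> c" "c < 3 * a" | "3 * a \<le> c"
    by linarith
  then show ?thesis
  proof cases
    case 1
    then show ?thesis using i first const by auto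
  next
    case 2
    then have "c - a < a" "c = a + (c - a)" by auto
    then show ?thesis using i const[of "c - a"] mid[of "c - a"] by auto
  next
    case 3
    then have "c - 2 * a < a" "c = 2 * a + (c - 2 * a)" by auto
    then show ?thesis using i const[of "c - 2 * a"] last[of "c - 2 * a"] by auto
  next
    case 4
    then show ?thesis using i leftover_zero[OF _ \<open>c \<le> n\<close>] by auto
  qed
qed

end

theorem not_defective_planes:
  assumes a: "4 \<le> a" and n: "3 * a \<le> n + 1"
  shows "\<not> defective (plucker_index 2 n) (a + 1) (grassmannian 2 n)"
proof -
  define C where "C = {..n} - {0, a, 2 * a}"
  define K where "K = insert None (Some ` ({..2 :: nat} \<times> C))"
  \<comment> \<open>\<open>None\<close> stands for the point itself; column 0 is left out of the other directions, since
    replacing a row by a combination of the row sums gives nothing new.\<close>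
  define m where "m k = (case k of None \<Rightarrow> (\<lambda>_ _. 0)(0 := row_sum a 0)
    | Some (i, c) \<Rightarrow> (\<lambda>_ _. 0)(i := unit_fun c))" for k :: "(nat \<times> nat) option"
  have colS: "column a j \<in> plucker_index 2 n" if "j < a" for j
    using that n by (auto simp: column_def plucker_index_def)
  have dist: "3 \<le> card (column a i - column a j)" if "i < a" "j < a" "i \<noteq> j" for i j
  proof -
    have "column a i - column a j = column a i"
      using that by (auto simp: column_def)
    then show ?thesis
      using that by (simp add: column_def)
  qed
  have "card C = n - 2"
    using a n by (simp add: C_def card_Diff_subset)
  then have cardK: "card K = 1 * ((2 + 1) * (n - 2) + 1)"
    by (simp add: K_def card_image card_cartesian_product C_def)
  have finK: "finite K"
    by (simp add: K_def C_def)
  have indep: "\<forall>k\<in>K. g k = 0"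
    if van: "\<And>T. T \<in> plucker_index 2 n \<Longrightarrow> (\<And>i. i < a \<Longrightarrow> T \<notin> neighbours 2 n (column a i)) \<Longrightarrow>
        (\<Sum>k\<in>K. g k * (\<Sum>j<1 :: nat. dwedge 2 n (row_sum a) (m k) T)) = 0" for g :: "(nat \<times> nat) option \<Rightarrow> complex"
  proof -
    define X where "X i c = (\<Sum>k\<in>K. g k * m k i c)" for i c
    have X: "X i c = (if i = 0 then g None * row_sum a 0 c else 0) +
        (if i \<le> 2 \<and> c \<in> C then g (Some (i, c)) else 0)" for i c
    proof -
      have "X i c = g None * m None i c + (\<Sum>k\<in>{..2} \<times> C. g (Some k) * m (Some k) i c)"
        unfolding X_def K_def by (subst sum.insert) (auto simp: C_def sum.reindex)
      also have "(\<Sum>k\<in>{..2} \<times> C. g (Some k) * m (Some k) i c) =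
          (\<Sum>k\<in>{..2} \<times> C. if k = (i, c) then g (Some (i, c)) else 0)"
        by (intro sum.cong) (auto simp: m_def unit_fun_def split: if_splits)
      also have "\<dots> = (if i \<le> 2 \<and> c \<in> C then g (Some (i, c)) else 0)"
        by (subst sum.delta) (auto simp: C_def)
      finally show ?thesis by (simp add: m_def)
    qed
    have X0: "X i c = 0" if "i \<le> 2" "c \<le> n" for i c
    proof (rule rows_vanish[OF a n])
      fix t0 t1 t2 assume t: "t0 < t1" "t1 < t2" "t2 \<le> n"
        and cols: "\<And>t t'. t \<in> {t0, t1, t2} \<Longrightarrow> t' \<in> {t0, t1, t2} \<Longrightarrow> t < 3 * a \<Longrightarrow> t' < 3 * a \<Longrightarrow>
          t mod a = t' mod a \<Longrightarrow> t = t'"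
      let ?T = "{t0, t1, t2}"
      have "?T \<in> plucker_index 2 n"
        using t by (auto simp: plucker_index_def)
      moreover have "?T \<notin> neighbours 2 n (column a j)" if "j < a" for j
        by (rule transversal_not_neighbour[OF t(1,2) that cols])
      ultimately have "(\<Sum>k\<in>K. g k * (\<Sum>j<1 :: nat. dwedge 2 n (row_sum a) (m k) ?T)) = 0"
        by (rule van)
      then have "(\<Sum>k\<in>K. g k * dwedge 2 n (row_sum a) (m k) ?T) = 0"
        by simp
      then show "dwedge 2 n (row_sum a) X ?T = 0"
        unfolding X_def[abs_def] dwedge_sum .
    qed (use that a in \<open>auto simp: X C_def row_sum_def\<close>)
    have "g None = 0"
      using X0[of 0 0] a by (simp add: X C_def row_sum_def)
    moreover have "g (Some (i, c)) = 0" if "i \<le> 2" "c \<in> C" for i c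
      using X0[of i c] that \<open>g None = 0\<close> by (cases "i = 0") (simp_all add: X C_def)
    ultimately show ?thesis by (auto simp: K_def)
  qed
  have nz: "\<exists>T. T \<notin> column a ` {..<a} \<and> (\<Sum>j<1 :: nat. wedge 2 n (row_sum a) T) \<noteq> 0"
  proof (intro exI conjI)
    have t: "0 < a + 1" "a + 1 < 2 * a + 2" "2 * a + 2 \<le> n"
      using a n by auto
    show "{0, a + 1, 2 * a + 2} \<notin> column a ` {..<a}"
    proof
      assume "{0, a + 1, 2 * a + 2} \<in> column a ` {..<a}"
      then obtain j where "j < a" and j: "{0, a + 1, 2 * a + 2} = column a j" by blast
      then have "0 \<in> column a j" "a + 1 \<in> column a j" by auto
      then show False using a \<open>j < a\<close> by (auto simp: column_def)
    qed
    show "(\<Sum>j<1 :: nat. wedge 2 n (row_sum a) {0, a + 1, 2 * a + 2}) \<noteq> 0"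
      unfolding wedge_planes[OF t]
      using row_sum_values[of 0 a] row_sum_values[of 1 a] row_sum_values[of 2 a] a by simp
  qed
  show ?thesis
    by (rule not_defective_if_code[where S = "column a" and m = "\<lambda>k _. m k" and p = "\<lambda>_. row_sum a",
          OF _ _ colS dist finK cardK indep disjI2[OF nz]])
       (use a n in simp_all)
qed

section \<open>Codes\<close>

text \<open>
  Cutting \<open>{..n}\<close> into \<open>r + 1\<close> blocks of length \<open>a\<close>, a word of length \<open>r + 1\<close> over an alphabet
  with \<open>a\<close> letters picks one element of every block.
\<close>

definition word_set :: "nat \<Rightarrow> nat \<Rightarrow> (nat \<Rightarrow> nat) \<Rightarrow> nat set" where
  "word_set a r u = (\<lambda>i. i * a + u i) ` {..r}"

lemma block_eq_iff:
  fixes i j a x y :: nat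
  assumes "x < a" "y < a"
  shows "i * a + x = j * a + y \<longleftrightarrow> i = j \<and> x = y"
proof
  assume eq: "i * a + x = j * a + y"
  have "(i * a + x) div a = i" "(j * a + y) div a = j"
    using assms by simp_all
  then show "i = j \<and> x = y" using eq by auto
qed simp

lemma word_inj:
  fixes a r :: nat and u :: "nat \<Rightarrow> nat"
  assumes u: "\<And>i. i \<le> r \<Longrightarrow> u i < a"
  shows "inj_on (\<lambda>i. i * a + u i) {..r}"
proof (rule inj_onI)
  fix i j assume "i \<in> {..r}" "j \<in> {..r}" and eq: "i * a + u i = j * a + u j"
  then have "u i < a" "u j < a" using u by simp_all
  from block_eq_iff[OF this] eq show "i = j" by blast
qed

lemma word_set_index:
  assumes u: "\<And>i. i \<le> r \<Longrightarrow> u i < a" and n: "(r + 1) * a \<le> n + 1"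
  shows "word_set a r u \<in> plucker_index r n"
proof -
  have "inj_on (\<lambda>i. i * a + u i) {..r}"
    using u by (rule word_inj)
  moreover have "i * a + u i \<le> n" if "i \<le> r" for i
  proof -
    have "i * a + u i < (i + 1) * a" using u[OF that] by simp
    also have "\<dots> \<le> (r + 1) * a" using that by (intro mult_right_mono) auto
    finally show ?thesis using n by simp
  qed
  ultimately show ?thesis
    by (auto simp: plucker_index_def word_set_def card_image)
qed

lemma word_set_distance:
  assumes u: "\<And>i. i \<le> r \<Longrightarrow> u i < a" and v: "\<And>i. i \<le> r \<Longrightarrow> v i < a"
  shows "card {i. i \<le> r \<and> u i \<noteq> v i} \<le> card (word_set a r u - word_set a r v)"
proof -
  let ?D = "{i. i \<le> r \<and> u i \<noteq> v i}" and ?f = "\<lambda>i. i * a + u i"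
  have "inj_on ?f {..r}"
    using u by (rule word_inj)
  then have "inj_on ?f ?D"
    by (rule inj_on_subset) auto
  then have "card ?D = card (?f ` ?D)"
    by (simp add: card_image)
  also have "\<dots> \<le> card (word_set a r u - word_set a r v)"
  proof (rule card_mono)
    show "?f ` ?D \<subseteq> word_set a r u - word_set a r v"
    proof
      fix x assume "x \<in> ?f ` ?D"
      then obtain i where i: "i \<le> r" "u i \<noteq> v i" "x = i * a + u i" by auto
      have "i * a + u i \<noteq> j * a + v j" if "j \<le> r" for j
        using block_eq_iff[OF u[OF i(1)] v[OF that]] i(2) by auto
      then show "x \<in> word_set a r u - word_set a r v"
        using i by (auto simp: word_set_def)
    qed
  qed (simp add: word_set_def)
  finally show ?thesis .
qed

lemma not_defective_words:
  assumes n: "(r + 1) * a \<le> n + 1" and h: "1 \<le> h" and "1 \<le> a"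
    and u: "\<And>x i. x < h \<Longrightarrow> i \<le> r \<Longrightarrow> u x i < a"
    and dist: "\<And>x y. x < h \<Longrightarrow> y < h \<Longrightarrow> x \<noteq> y \<Longrightarrow> 3 \<le> card {i. i \<le> r \<and> u x i \<noteq> u y i}"
  shows "\<not> defective (plucker_index r n) h (grassmannian r n)"
proof -
  have "(r + 1) * 1 \<le> (r + 1) * a"
    using \<open>1 \<le> a\<close> by (intro mult_left_mono) auto
  then have rn: "r \<le> n" using n by simp
  have idx: "word_set a r (u x) \<in> plucker_index r n" if "x < h" for x
    using u[OF that] n by (rule word_set_index)
  have far: "3 \<le> card (word_set a r (u x) - word_set a r (u y))" if "x < h" "y < h" "x \<noteq> y" for x y
    using dist[OF that] word_set_distance[OF u[OF that(1)] u[OF that(2)]] by (rule order_trans)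
  have "\<not> defective (plucker_index r n) (h + 0) (grassmannian r n)"
    by (rule not_defective_if_code[OF rn h idx far, where K = "{} :: nat set"]) simp_all
  then show ?thesis by simp
qed

text \<open>
  The code: \<open>k\<close> free letters, repeated, followed by their sum modulo \<open>a\<close> and padding.  Two
  words differing in at least two free letters differ in four places; if they differ in only one,
  then also in its copy and in the sum.
\<close>

definition codeword :: "nat \<Rightarrow> nat \<Rightarrow> (nat \<Rightarrow> nat) \<Rightarrow> nat \<Rightarrow> nat" where
  "codeword a k u i =
     (if i < k then u i else if i < 2 * k then u (i - k)
      else if i = 2 * k then (\<Sum>j<k. u j) mod a else 0)"

lemma add_mod_cancel:
  fixes x y c a :: nat
  assumes "(x + c) mod a = (y + c) mod a" "x < a" "y < a"
  shows "x = y"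
proof -
  have "int a dvd (int x + int c) - (int y + int c)"
    using assms(1) by (simp only: mod_eq_dvd_iff[symmetric] flip: of_nat_add zmod_int)
  then have "int x mod int a = int y mod int a"
    by (simp add: mod_eq_dvd_iff)
  then show ?thesis using assms by simp
qed

lemma card_ge_3I:
  assumes "finite D" "x \<in> D" "y \<in> D" "z \<in> D" "x \<noteq> y" "x \<noteq> z" "y \<noteq> z"
  shows "3 \<le> card D"
proof -
  have "card {x, y, z} \<le> card D"
    using assms by (intro card_mono) auto
  then show ?thesis using assms by simp
qed

lemma codeword_distance:
  assumes u: "\<And>i. i < k \<Longrightarrow> u i < a" and v: "\<And>i. i < k \<Longrightarrow> v i < a"
    and "i < k" "u i \<noteq> v i" and r: "2 * k \<le> r"
  shows "3 \<le> card {j. j \<le> r \<and> codeword a k u j \<noteq> codeword a k v j}" (is "3 \<le> card ?D")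
proof -
  have fin: "finite ?D" by simp
  have copies: "j \<in> ?D" "j + k \<in> ?D" if "j < k" "u j \<noteq> v j" for j
    using that r by (auto simp: codeword_def)
  show ?thesis
  proof (cases "\<exists>j<k. j \<noteq> i \<and> u j \<noteq> v j")
    case True
    then obtain j where j: "j < k" "j \<noteq> i" "u j \<noteq> v j" by blast
    show ?thesis
      by (rule card_ge_3I[OF fin copies(1)[OF assms(3,4)] copies(1)[OF j(1,3)] copies(2)[OF assms(3,4)]])
         (use j assms(3) in simp_all)
  next
    case False
    define c where "c = (\<Sum>j\<in>{..<k} - {i}. u j)"
    have "(\<Sum>j\<in>{..<k} - {i}. v j) = c"
      unfolding c_def using False by (intro sum.cong) auto
    then have "(\<Sum>j<k. u j) = u i + c" "(\<Sum>j<k. v j) = v i + c"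
      using sum.remove[of "{..<k}" i u] sum.remove[of "{..<k}" i v] assms(3) by (auto simp: c_def)
    then have "(\<Sum>j<k. u j) mod a \<noteq> (\<Sum>j<k. v j) mod a"
      using add_mod_cancel[of "u i" c a "v i"] u v assms(3,4) by auto
    then have last: "2 * k \<in> ?D"
      using r by (auto simp: codeword_def)
    show ?thesis
      by (rule card_ge_3I[OF fin copies[OF assms(3,4)] last]) (use assms(3) in simp_all)
  qed
qed

lemma codeword_less:
  assumes "\<And>i. i < k \<Longrightarrow> u i < a" "0 < a"
  shows "codeword a k u i < a"
  using assms by (auto simp: codeword_def)

text \<open>The word \<open>z\<close> serves the cases in which one more point is needed than there are codewords.\<close>

lemma not_defective_codewords:
  assumes n: "(r + 1) * a \<le> n + 1" and r: "2 * k \<le> r" and a: "1 \<le> a" and h: "1 \<le> h"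
    and hz: "h \<le> a ^ k \<or> h = a ^ k + 1 \<and> (\<forall>i\<le>r. z i < a) \<and>
      (\<forall>u. (\<forall>i<k. u i < a) \<longrightarrow> 3 \<le> card {i. i \<le> r \<and> codeword a k u i \<noteq> z i})"
  shows "\<not> defective (plucker_index r n) h (grassmannian r n)"
proof -
  let ?P = "{..<k} \<rightarrow>\<^sub>E {..<a}"
  have "finite ?P" "card ?P = a ^ k"
    by (auto simp: finite_PiE card_PiE)
  then obtain e where e: "bij_betw e {0..<a ^ k} ?P"
    using ex_bij_betw_nat_finite by metis
  have eP: "e x \<in> ?P" if "x < a ^ k" for x
    using e that by (auto simp: bij_betw_def)
  then have e_less: "e x i < a" if "x < a ^ k" "i < k" for x i
    using that by fastforce
  define w where "w x = (if x < a ^ k then codeword a k (e x) else z)" for x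
  have close: "3 \<le> card {i. i \<le> r \<and> w x i \<noteq> w y i}" if "x < a ^ k" "y < a ^ k" "x \<noteq> y" for x y
  proof -
    have "e x \<noteq> e y"
      using e that by (auto simp: bij_betw_def inj_on_def)
    have "\<exists>i<k. e x i \<noteq> e y i"
    proof (rule ccontr)
      assume "\<not> ?thesis"
      then have "e x = e y"
        by (intro PiE_ext[OF eP[OF that(1)] eP[OF that(2)]]) simp
      then show False using \<open>e x \<noteq> e y\<close> by blast
    qed
    then obtain i where "i < k" "e x i \<noteq> e y i" by blast
    then show ?thesis
      using codeword_distance[of k "e x" a "e y" i r] e_less that r by (simp add: w_def)
  qed
  have extra: "3 \<le> card {i. i \<le> r \<and> w x i \<noteq> w (a ^ k) i}" if "x < a ^ k" "a ^ k < h" for x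
    using hz that e_less by (auto simp: w_def)
  have sym: "{i. i \<le> r \<and> w x i \<noteq> w y i} = {i. i \<le> r \<and> w y i \<noteq> w x i}" for x y
    by auto
  show ?thesis
  proof (rule not_defective_words[OF n h a, where u = w])
    show "w x i < a" if "x < h" "i \<le> r" for x i
      using that hz e_less a by (auto simp: w_def intro!: codeword_less)
    show "3 \<le> card {i. i \<le> r \<and> w x i \<noteq> w y i}" if xy: "x < h" "y < h" "x \<noteq> y" for x y
    proof -
      consider "x < a ^ k" "y < a ^ k" | "x < a ^ k" "y = a ^ k" | "x = a ^ k" "y < a ^ k"
        using xy hz by linarith
      then show ?thesis
        using close[of x y] extra[of x] extra[of y] xy sym[of x y] by cases auto
    qed
  qed
qed

text \<open>
  The word \<open>0 1 2 1\<close> agrees with \<open>x x x 0\<close> in at most one place.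
\<close>

lemma extra_word_3:
  assumes "3 \<le> a"
  defines "z \<equiv> \<lambda>i :: nat. if i = 0 then 0 else if i = 2 then 2 else 1 :: nat"
  shows "\<forall>i\<le>3. z i < a"
    "\<forall>u. (\<forall>i<1. u i < a) \<longrightarrow> 3 \<le> card {i. i \<le> 3 \<and> codeword a 1 u i \<noteq> z i}"
proof -
  show "\<forall>i\<le>3. z i < a"
    using assms by (auto simp: z_def)
  show "\<forall>u. (\<forall>i<1. u i < a) \<longrightarrow> 3 \<le> card {i. i \<le> 3 \<and> codeword a 1 u i \<noteq> z i}"
  proof (intro allI impI)
    fix u :: "nat \<Rightarrow> nat" assume u: "\<forall>i<1. u i < a"
    let ?D = "{i. i \<le> 3 \<and> codeword a 1 u i \<noteq> z i}"
    have vals: "codeword a 1 u 0 = u 0" "codeword a 1 u 1 = u 0" "codeword a 1 u 2 = u 0" "codeword a 1 u 3 = 0"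
      using u by (simp_all add: codeword_def)
    have D: "0 \<in> ?D \<longleftrightarrow> u 0 \<noteq> 0" "1 \<in> ?D \<longleftrightarrow> u 0 \<noteq> 1" "2 \<in> ?D \<longleftrightarrow> u 0 \<noteq> 2" "3 \<in> ?D"
      using vals by (simp_all add: z_def)
    have fin: "finite ?D" by simp
    consider "u 0 = 0" | "u 0 = 1" | "u 0 \<noteq> 0" "u 0 \<noteq> 1" by blast
    then show "3 \<le> card ?D"
    proof cases
      case 1
      show ?thesis by (rule card_ge_3I[of _ 1 2 3, OF fin]) (use D 1 in simp_all)
    next
      case 2
      show ?thesis by (rule card_ge_3I[of _ 0 2 3, OF fin]) (use D 2 in simp_all)
    next
      case 3
      show ?thesis by (rule card_ge_3I[of _ 0 1 3, OF fin]) (use D 3 in simp_all)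
    qed
  qed
qed

text \<open>
  The word \<open>0 0 1 1 3\<close> cannot agree with \<open>x y x y (x + y)\<close> in three places: it would have to
  agree in the sum, whereas \<open>x\<close> and \<open>y\<close> would be 0 or 1 and their sum at most 2.
\<close>

lemma extra_word_4:
  assumes "4 \<le> a" "4 \<le> r"
  defines "z \<equiv> \<lambda>i :: nat. if i < 2 then 0 else if i < 4 then 1 else 3 :: nat"
  shows "\<forall>i\<le>r. z i < a"
    "\<forall>u. (\<forall>i<2. u i < a) \<longrightarrow> 3 \<le> card {i. i \<le> r \<and> codeword a 2 u i \<noteq> z i}"
proof -
  show "\<forall>i\<le>r. z i < a"
    using assms by (auto simp: z_def)
  show "\<forall>u. (\<forall>i<2. u i < a) \<longrightarrow> 3 \<le> card {i. i \<le> r \<and> codeword a 2 u i \<noteq> z i}"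
  proof (intro allI impI)
    fix u :: "nat \<Rightarrow> nat" assume u: "\<forall>i<2. u i < a"
    let ?D = "{i. i \<le> r \<and> codeword a 2 u i \<noteq> z i}"
    have vals: "codeword a 2 u 0 = u 0" "codeword a 2 u 1 = u 1" "codeword a 2 u 2 = u 0"
      "codeword a 2 u 3 = u 1" "codeword a 2 u 4 = (u 0 + u 1) mod a"
      by (simp_all add: codeword_def numeral_2_eq_2 numeral_3_eq_3 numeral_eq_Suc)
    have D: "0 \<in> ?D \<longleftrightarrow> u 0 \<noteq> 0" "1 \<in> ?D \<longleftrightarrow> u 1 \<noteq> 0" "2 \<in> ?D \<longleftrightarrow> u 0 \<noteq> 1" "3 \<in> ?D \<longleftrightarrow> u 1 \<noteq> 1"
      "4 \<in> ?D \<longleftrightarrow> (u 0 + u 1) mod a \<noteq> 3"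
      using vals assms(2) by (simp_all add: z_def)
    have fin: "finite ?D" by simp
    consider "u 0 = 0" "u 1 = 0" | "u 0 = 0" "u 1 = 1" | "u 0 = 1" "u 1 = 0" | "u 0 = 1" "u 1 = 1"
      | "u 0 \<noteq> 0" "u 0 \<noteq> 1" "u 1 = 0" | "u 0 \<noteq> 0" "u 0 \<noteq> 1" "u 1 \<noteq> 0"
      | "u 1 \<noteq> 0" "u 1 \<noteq> 1" "u 0 = 0" | "u 1 \<noteq> 0" "u 1 \<noteq> 1" "u 0 \<noteq> 0" by blast
    then show "3 \<le> card ?D"
    proof cases
      case 1
      show ?thesis by (rule card_ge_3I[of _ 2 3 4, OF fin]) (use D 1 assms(1) in simp_all)
    next
      case 2
      show ?thesis by (rule card_ge_3I[of _ 2 1 4, OF fin]) (use D 2 assms(1) in simp_all)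
    next
      case 3
      show ?thesis by (rule card_ge_3I[of _ 0 3 4, OF fin]) (use D 3 assms(1) in simp_all)
    next
      case 4
      show ?thesis by (rule card_ge_3I[of _ 0 1 4, OF fin]) (use D 4 assms(1) in simp_all)
    next
      case 5
      show ?thesis by (rule card_ge_3I[of _ 0 2 3, OF fin]) (use D 5 in simp_all)
    next
      case 6
      show ?thesis by (rule card_ge_3I[of _ 0 2 1, OF fin]) (use D 6 in simp_all)
    next
      case 7
      show ?thesis by (rule card_ge_3I[of _ 1 3 2, OF fin]) (use D 7 in simp_all)
    next
      case 8
      show ?thesis by (rule card_ge_3I[of _ 1 3 0, OF fin]) (use D 8 in simp_all)
    qed
  qed
qed

section \<open>The bounds\<close>

lemma geometric_sum_nat: "1 \<le> a \<Longrightarrow> (a - 1) * (\<Sum>i<L. a ^ i) + 1 = (a :: nat) ^ L"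
proof (induction L)
  case (Suc L)
  have "(a - 1) * (\<Sum>i<Suc L. a ^ i) + 1 = ((a - 1) * (\<Sum>i<L. a ^ i) + 1) + (a - 1) * a ^ L"
    by (simp add: algebra_simps)
  also have "\<dots> = (1 + (a - 1)) * a ^ L"
    using Suc by (simp only: distrib_right mult_1)
  finally show ?case using Suc.prems by simp
qed simp

lemma sum_distinct_exponents_le:
  fixes lam :: "nat \<Rightarrow> nat"
  assumes dec: "\<And>i j. 1 \<le> i \<Longrightarrow> i < j \<Longrightarrow> j \<le> s \<Longrightarrow> lam i > lam j"
    and pos: "\<And>i. 1 \<le> i \<Longrightarrow> i \<le> s \<Longrightarrow> lam i \<ge> 1"
  shows "inj_on lam {1..s}" "lam ` {1..s} \<subseteq> {1..lam 1}"
    "(\<Sum>i=1..s. g (lam i) :: nat) \<le> (\<Sum>l=1..lam 1. g l)"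
proof -
  show inj: "inj_on lam {1..s}"
    by (rule linorder_inj_onI) (use dec in fastforce)+
  show sub: "lam ` {1..s} \<subseteq> {1..lam 1}"
  proof
    fix l assume "l \<in> lam ` {1..s}"
    then obtain i where i: "1 \<le> i" "i \<le> s" "l = lam i" by auto
    then show "l \<in> {1..lam 1}"
      using pos[of i] dec[of 1 i] by (cases "i = 1") auto
  qed
  have "(\<Sum>i=1..s. g (lam i)) = sum g (lam ` {1..s})"
    by (simp only: sum.reindex[OF inj] o_def)
  also have "\<dots> \<le> (\<Sum>l=1..lam 1. g l)"
    using sub by (intro sum_mono2) auto
  finally show "(\<Sum>i=1..s. g (lam i)) \<le> (\<Sum>l=1..lam 1. g l)" .
qed

lemma first_bound:
  fixes a L :: nat
  assumes "1 \<le> a"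
  shows "(a - 1) * (\<Sum>l=1..L. a ^ (l - 1)) + 1 = a ^ L"
proof -
  have "(\<Sum>l=1..L. a ^ (l - 1)) = (\<Sum>i<L. a ^ i)"
    by (rule sum.reindex_bij_witness[of _ Suc "\<lambda>l. l - 1"]) auto
  then show ?thesis using geometric_sum_nat[OF assms] by simp
qed

lemma second_bound:
  fixes a L :: nat
  assumes "2 \<le> a"
  shows "(\<Sum>l=1..L. a ^ l) + 1 \<le> a ^ (L + 1)"
proof -
  have "{..<L + 1} = insert 0 {1..L}" by auto
  then have "(\<Sum>l=1..L. a ^ l) + 1 = (\<Sum>i<L + 1. a ^ i)"
    by simp
  also have "\<dots> \<le> (a - 1) * (\<Sum>i<L + 1. a ^ i)"
    using assms by (cases "a - 1") auto
  also have "\<dots> + 1 = a ^ (L + 1)"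
    using assms by (intro geometric_sum_nat) auto
  finally show ?thesis by simp
qed

text \<open>The code with \<open>r div 2\<close> free letters is large enough.\<close>

lemma half_ge_exponent:
  assumes "2 ^ L \<le> (r :: nat)" "1 \<le> L"
  shows "L \<le> r div 2" "6 \<le> r \<Longrightarrow> L + 1 \<le> r div 2"
proof -
  obtain M where M: "L = Suc M" using assms(2) by (cases L) auto
  then have half: "2 ^ M \<le> r div 2" using assms(1) by simp
  have "M < 2 ^ M" by (rule less_exp)
  then show "L \<le> r div 2" using half M by linarith
  show "L + 1 \<le> r div 2" if "6 \<le> r"
  proof (cases "M \<le> 1")
    case True
    then show ?thesis using that M by linarith
  next
    case False
    then obtain j where j: "M = j + 2" by (metis le_add_diff_inverse2 not_less_eq_eq numeral_2_eq_2 One_nat_def)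
    have "j < 2 ^ j" by (rule less_exp)
    moreover have "2 ^ M = 4 * (2 :: nat) ^ j" by (simp add: j power_add)
    ultimately have "M + 2 \<le> 2 ^ M" using j by linarith
    then show ?thesis using half M by linarith
  qed
qed

text \<open>Binary expansions of the numbers from 2 to 5, up to the last digit.\<close>

lemma small_exponents:
  fixes A :: "nat set"
  assumes "A \<subseteq> {1..L}" "2 ^ L \<le> r" "r = (\<Sum>l\<in>A. 2 ^ l) + e" "e \<in> {0, 1}" "2 \<le> r" "r \<le> 5"
  shows "A = {r div 2}"
proof -
  have "L \<le> 2"
  proof (rule ccontr)
    assume "\<not> L \<le> 2"
    then have "(2 :: nat) ^ 3 \<le> 2 ^ L" by (intro power_increasing) auto
    then show False using assms by simp
  qed
  then have "A \<subseteq> {1, 2}" using assms(1) by auto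
  then have "A \<in> Pow {1, 2}" by blast
  then consider "A = {}" | "A = {1}" | "A = {2}" | "A = {1, 2}"
    by (auto simp: Pow_insert)
  then show ?thesis
    using assms by cases auto
qed

theorem theorem1p0p3:
  fixes r n \<alpha> s \<epsilon> h :: nat and lam :: "nat \<Rightarrow> nat"
  assumes "r \<ge> 2" and "n \<ge> 2 * r + 1"
    and "\<alpha> = nat \<lfloor>real (n + 1) / real (r + 1)\<rfloor>"
    and "r = (\<Sum>i=1..s. 2 ^ lam i) + \<epsilon>"
    and "\<And>i j. 1 \<le> i \<Longrightarrow> i < j \<Longrightarrow> j \<le> s \<Longrightarrow> lam i > lam j"
    and "\<And>i. 1 \<le> i \<Longrightarrow> i \<le> s \<Longrightarrow> lam i \<ge> 1"
    and "\<epsilon> \<in> {0, 1}"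
    and "h \<le> (\<alpha> - 1) * (\<Sum>i=1..s. \<alpha> ^ (lam i - 1)) + 1 \<or>
         n \<ge> r ^ 2 + 3 * r + 1 \<and> h \<le> (\<Sum>i=1..s. \<alpha> ^ lam i) + 1"
  shows "\<not> defective (plucker_index r n) h (grassmannian r n)"
proof (cases "h = 0")
  case True
  then show ?thesis by (simp add: not_defective_0)
next
  case False
  then have h: "1 \<le> h" by simp
  have \<alpha>: "\<alpha> = (n + 1) div (r + 1)"
    unfolding assms(3) floor_divide_of_nat_eq by simp
  have n: "(r + 1) * \<alpha> \<le> n + 1"
    unfolding \<alpha> by (rule times_div_less_eq_dividend)
  have \<alpha>2: "2 \<le> \<alpha>"
    unfolding \<alpha> using assms(2) by (simp add: less_eq_div_iff_mult_less_eq)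
  have "s \<noteq> 0"
    using assms(1,4,7) by (cases s) auto
  define L where "L = lam 1"
  define k where "k = r div 2"
  note sums = sum_distinct_exponents_le[of s lam, OF assms(5,6)]
  have L1: "1 \<le> L"
    using assms(6)[of 1] \<open>s \<noteq> 0\<close> by (simp add: L_def)
  have "(2 :: nat) ^ L \<le> (\<Sum>i=1..s. 2 ^ lam i)"
    unfolding L_def using \<open>s \<noteq> 0\<close>
    by (intro member_le_sum[of 1 "{1..s}" "\<lambda>i. (2 :: nat) ^ lam i"]) auto
  then have Lr: "2 ^ L \<le> r"
    using assms(4) by linarith
  have k: "2 * k \<le> r"
    by (simp add: k_def)
  have mono: "\<alpha> ^ l \<le> \<alpha> ^ k" if "l \<le> k" for l
    using that \<alpha>2 by (intro power_increasing) auto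
  have code: ?thesis if "h \<le> \<alpha> ^ k"
    using not_defective_codewords[OF n k _ h] \<alpha>2 that by auto
  from assms(8) show ?thesis
  proof
    assume "h \<le> (\<alpha> - 1) * (\<Sum>i=1..s. \<alpha> ^ (lam i - 1)) + 1"
    also have "\<dots> \<le> (\<alpha> - 1) * (\<Sum>l=1..L. \<alpha> ^ (l - 1)) + 1"
      unfolding L_def by (intro add_right_mono mult_left_mono sums(3)) auto
    also have "\<dots> = \<alpha> ^ L"
      using \<alpha>2 by (intro first_bound) auto
    also have "\<dots> \<le> \<alpha> ^ k"
      using half_ge_exponent(1)[OF Lr L1] unfolding k_def[symmetric] by (rule mono)
    finally show ?thesis by (rule code)
  next
    assume second: "n \<ge> r ^ 2 + 3 * r + 1 \<and> h \<le> (\<Sum>i=1..s. \<alpha> ^ lam i) + 1"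
    show ?thesis
    proof (cases "6 \<le> r")
      case True
      have "h \<le> (\<Sum>l=1..L. \<alpha> ^ l) + 1"
        using second sums(3)[where g = "\<lambda>l. \<alpha> ^ l"] unfolding L_def by linarith
      also have "\<dots> \<le> \<alpha> ^ (L + 1)"
        using \<alpha>2 by (rule second_bound)
      also have "\<dots> \<le> \<alpha> ^ k"
        using half_ge_exponent(2)[OF Lr L1 True] unfolding k_def[symmetric] by (rule mono)
      finally show ?thesis by (rule code)
    next
      case False
      have "(r + 1) * (r + 2) \<le> n + 1"
        using second by (simp add: power2_eq_square algebra_simps)
      then have \<alpha>r: "r + 2 \<le> \<alpha>"
        unfolding \<alpha> by (simp add: less_eq_div_iff_mult_less_eq mult.commute)
      have "lam ` {1..s} = {k}"
        unfolding k_def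
      proof (rule small_exponents[OF _ Lr _ assms(7,1)])
        show "lam ` {1..s} \<subseteq> {1..L}"
          unfolding L_def by (rule sums(2))
        show "r = (\<Sum>l\<in>lam ` {1..s}. 2 ^ l) + \<epsilon>"
          using assms(4) by (simp only: sum.reindex[OF sums(1)] o_def)
        show "r \<le> 5" using False by simp
      qed
      moreover have "(\<Sum>i=1..s. \<alpha> ^ lam i) = (\<Sum>l\<in>lam ` {1..s}. \<alpha> ^ l)"
        by (simp only: sum.reindex[OF sums(1)] o_def)
      ultimately have "h \<le> \<alpha> ^ k + 1"
        using second by simp
      then consider "h \<le> \<alpha> ^ k" | "h = \<alpha> ^ k + 1" by linarith
      then show ?thesis
      proof cases
        case 1
        then show ?thesis by (rule code)
      next
        case 2
        consider "r = 2" | "r = 3" | "4 \<le> r" "r \<le> 5" using assms(1) False by linarith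
        then show ?thesis
        proof cases
          case 1
          then show ?thesis
            using not_defective_planes[of \<alpha> n] n \<alpha>r 2 by (simp add: k_def)
        next
          assume r: "r = 3"
          then have k1: "k = 1" by (simp add: k_def)
          show ?thesis
            using \<alpha>r extra_word_3[of \<alpha>] 2 unfolding k1 r
            by (intro not_defective_codewords[OF n[unfolded r] k[unfolded k1 r] _ h disjI2]) auto
        next
          assume r: "4 \<le> r" "r \<le> 5"
          then have k2: "k = 2" by (simp add: k_def)
          show ?thesis
            using \<alpha>r extra_word_4[of \<alpha> r] r 2 unfolding k2
            by (intro not_defective_codewords[OF n k[unfolded k2] _ h disjI2]) auto
        qed
      qed
    qed
  qed
qed

end
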